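(* Let $n\ge 2$, let $1\le r\le\infty$, and let $s\in\mathbb{R}$ satisfy $s>0$ if $r>2$, and $s>n(2/r-1)$ if $1\le r\le 2$. Let $u_0$ be the divergence-free vector field on $\mathbb{T}^n$, depending only on the first two coordinates $(x,y)$, given by $$u_0(x,y)=\vec e_1\cos(y)+\vec e_2\sum_{q=0}^\infty \frac{1}{\lambda_q^{s}}\cos(\lambda_q x),\qquad \lambda_q=2^q.$$ Then there is $\delta=\delta(n,r,s)>0$ such that for every $T>0$ and every weak solution $u$ on $[0,T)$ of the Euler equation $u_t+(u\cdot\nabla)u=-\nabla p$, $\operatorname{div}u=0$, on $\mathbb{T}^n$ with initial condition $u(0)=u_0$, one has $$\limsup_{t\to 0^+}\|u(t)-u_0\|_{B^s_{r,\infty}}\ge\delta .$$ In particular $\delta$ is independent of $u$.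
   Context: $\mathbb{T}^n=(\mathbb{R}/2\pi\mathbb{Z})^n$, and $\vec e_1,\vec e_2$ are the first two vectors of the standard basis. Weak solution: a divergence-free, $L^2(\mathbb{T}^n)$-valued, weakly continuous (in time, on $[0,T)$) field $u$ satisfying the Euler equation in the sense of distributions (with some pressure distribution $p$). Littlewood-Paley projections: $\lambda_q=2^q$. Fix a nonnegative radial $\chi\in C_0^\infty(\mathbb{R}^n)$ with $\chi(\xi)=1$ for $|\xi|\le 1/2$ and $\chi(\xi)=0$ for $|\xi|\ge 1$. Put $\varphi(\xi)=\chi(\xi/2)-\chi(\xi)$, $\varphi_q(\xi)=\varphi(\lambda_q^{-1}\xi)$ for $q\ge 0$, and $\varphi_{-1}=\chi$. For a tempered distribution (vector field) $u=\sum_{k\in\mathbb{Z}^n}\hat u(k)e^{ik\cdot x}$ on $\mathbb{T}^n$, let $u_q(x)=\sum_{k\in\mathbb{Z}^n}\hat u(k)\varphi_q(k)e^{ik\cdot x}$, $q\ge -1$. Besov norm: $\|u\|_{B^s_{r,\infty}}=\sup_{q\ge -1}\lambda_q^s\|u_q\|_{L^r(\mathbb{T}^n)}$, taken to be $+\infty$ when $u\notin B^s_{r,\infty}$. *)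

theory Defs
  imports "HOL-Analysis.Analysis" "HOL-Probability.Essential_Supremum"
begin

section \<open>Smooth functions and functions on the torus\<close>

definition dderiv :: "'a::real_normed_vector \<Rightarrow> ('a \<Rightarrow> 'b::real_normed_vector) \<Rightarrow> 'a \<Rightarrow> 'b" where
  "dderiv v f z = frechet_derivative f (at z) v"

primrec iter_deriv ::
    "'a::real_normed_vector list \<Rightarrow> ('a \<Rightarrow> 'b::real_normed_vector) \<Rightarrow> 'a \<Rightarrow> 'b" where
  "iter_deriv [] f = f"
| "iter_deriv (v # vs) f = dderiv v (iter_deriv vs f)"

text \<open>All iterated partial derivatives exist and are differentiable, hence continuous.\<close>
definition smooth :: "('a::euclidean_space \<Rightarrow> 'b::real_normed_vector) \<Rightarrow> bool" where
  "smooth f \<longleftrightarrow> (\<forall>vs. set vs \<subseteq> Basis \<longrightarrow> (\<forall>z. iter_deriv vs f differentiable (at z)))"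

text \<open>
  Functions on \<open>(\<real>/2\<pi>\<int>)\<^sup>n\<close> are represented by functions on \<open>\<real>\<^sup>n\<close> that are
  \<open>2\<pi>\<close>-periodic in each coordinate, and integrated over the fundamental cube \<open>[0, 2\<pi>]\<^sup>n\<close>.
\<close>
definition periodic :: "(real^'n \<Rightarrow> 'b) \<Rightarrow> bool" where
  "periodic f \<longleftrightarrow> (\<forall>x i. f (x + axis i (2 * pi)) = f x)"

definition torus :: "(real^'n) measure" where
  "torus = lebesgue_on (cbox 0 (\<chi> i. 2 * pi))"

definition L2_field :: "(real^'n \<Rightarrow> real^'n) \<Rightarrow> bool" where
  "L2_field v \<longleftrightarrow> periodic v \<and> v \<in> borel_measurable torus \<and>
     integrable torus (\<lambda>x. (norm (v x))\<^sup>2)"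


section \<open>Weak solutions of the Euler equation\<close>

text \<open>
  Smooth functions on \<open>\<real> \<times> \<T>\<^sup>n\<close> with time support in \<open>[a, b]\<close>; the test functions on
  \<open>(0, T) \<times> \<T>\<^sup>n\<close> are those with \<open>0 < a\<close> and \<open>b < T\<close>, extended by zero.
\<close>
definition test_on :: "real \<Rightarrow> real \<Rightarrow> (real \<times> (real^'n) \<Rightarrow> 'b::real_normed_vector) \<Rightarrow> bool" where
  "test_on a b \<phi> \<longleftrightarrow> smooth \<phi> \<and> (\<forall>t. periodic (\<lambda>x. \<phi> (t, x))) \<and>
     (\<forall>t x. t \<notin> {a..b} \<longrightarrow> \<phi> (t, x) = 0)"

definition test_fun :: "real \<Rightarrow> (real \<times> (real^'n) \<Rightarrow> 'b::real_normed_vector) \<Rightarrow> bool" where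
  "test_fun T \<phi> \<longleftrightarrow> (\<exists>a b. 0 < a \<and> b < T \<and> test_on a b \<phi>)"

text \<open>
  Continuity is the usual seminorm estimate on each compact time interval; \<open>M\<close> ranges over
  the upper bounds of the \<open>C\<^sup>N\<close> norm of \<open>\<phi>\<close>.
\<close>
definition distribution :: "real \<Rightarrow> ((real \<times> (real^'n) \<Rightarrow> real) \<Rightarrow> real) \<Rightarrow> bool" where
  "distribution T p \<longleftrightarrow>
     (\<forall>\<phi> \<psi>. test_fun T \<phi> \<longrightarrow> test_fun T \<psi> \<longrightarrow> p (\<lambda>z. \<phi> z + \<psi> z) = p \<phi> + p \<psi>) \<and>
     (\<forall>c \<phi>. test_fun T \<phi> \<longrightarrow> p (\<lambda>z. c * \<phi> z) = c * p \<phi>) \<and>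
     (\<forall>a b. 0 < a \<longrightarrow> b < T \<longrightarrow>
        (\<exists>C N. \<forall>\<phi> M. test_on a b \<phi> \<longrightarrow>
           (\<forall>vs z. set vs \<subseteq> Basis \<longrightarrow> length vs \<le> N \<longrightarrow> \<bar>iter_deriv vs \<phi> z\<bar> \<le> M) \<longrightarrow>
           \<bar>p \<phi>\<bar> \<le> C * M))"

definition time_deriv ::
    "(real \<times> (real^'n) \<Rightarrow> 'b::real_normed_vector) \<Rightarrow> real \<Rightarrow> real^'n \<Rightarrow> 'b" where
  "time_deriv \<Phi> t x = dderiv (1, 0) \<Phi> (t, x)"

definition space_deriv ::
    "'n \<Rightarrow> (real \<times> (real^'n) \<Rightarrow> 'b::real_normed_vector) \<Rightarrow> real \<Rightarrow> real^'n \<Rightarrow> 'b" where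
  "space_deriv i \<Phi> t x = dderiv (0, axis i 1) \<Phi> (t, x)"

definition divergence :: "(real \<times> (real^'n) \<Rightarrow> real^'n) \<Rightarrow> real \<times> (real^'n) \<Rightarrow> real" where
  "divergence \<Phi> = (\<lambda>(t, x). \<Sum>i\<in>UNIV. space_deriv i \<Phi> t x $ i)"

definition div_free :: "(real^'n \<Rightarrow> real^'n) \<Rightarrow> bool" where
  "div_free v \<longleftrightarrow> (\<forall>\<psi> :: real^'n \<Rightarrow> real. smooth \<psi> \<longrightarrow> periodic \<psi> \<longrightarrow>
     (LINT x|torus. (\<Sum>i\<in>UNIV. v x $ i * dderiv (axis i 1) \<psi> x)) = 0)"

definition weakly_continuous :: "real \<Rightarrow> (real \<Rightarrow> real^'n \<Rightarrow> real^'n) \<Rightarrow> bool" where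
  "weakly_continuous T u \<longleftrightarrow>
     (\<forall>v. L2_field v \<longrightarrow> continuous_on {0..<T} (\<lambda>t. LINT x|torus. u t x \<bullet> v x))"

text \<open>
  The identity is \<open>u\<^sub>t + (u \<cdot> \<nabla>) u = - \<nabla> p\<close> tested against \<open>\<Phi>\<close>, where
  \<open>(u \<cdot> \<nabla>) u = div (u \<otimes> u)\<close> because \<open>div u = 0\<close>.  Only the values of \<open>u\<close> at times
  in \<open>[0, T)\<close> matter.
\<close>
definition euler_weak_solution :: "real \<Rightarrow> (real \<Rightarrow> real^'n \<Rightarrow> real^'n) \<Rightarrow> bool" where
  "euler_weak_solution T u \<longleftrightarrow>
     (\<forall>t\<in>{0..<T}. L2_field (u t) \<and> div_free (u t)) \<and>
     weakly_continuous T u \<and>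
     (\<exists>p. distribution T p \<and>
       (\<forall>\<Phi> :: real \<times> (real^'n) \<Rightarrow> real^'n. test_fun T \<Phi> \<longrightarrow>
          (LINT t:{0<..<T}|lborel. LINT x|torus.
             (u t x \<bullet> time_deriv \<Phi> t x +
              (\<Sum>i\<in>UNIV. \<Sum>j\<in>UNIV. u t x $ i * u t x $ j * space_deriv j \<Phi> t x $ i)))
          + p (divergence \<Phi>) = 0))"


section \<open>Littlewood-Paley projections and Besov norms\<close>

definition lam :: "int \<Rightarrow> real" where
  "lam q = 2 powi q"

definition LP_cutoff :: "(real^'n \<Rightarrow> real) \<Rightarrow> bool" where
  "LP_cutoff chi \<longleftrightarrow> smooth chi \<and> (\<forall>\<xi>. 0 \<le> chi \<xi>) \<and>
     (\<forall>\<xi> \<eta>. norm \<xi> = norm \<eta> \<longrightarrow> chi \<xi> = chi \<eta>) \<and>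
     (\<forall>\<xi>. norm \<xi> \<le> 1/2 \<longrightarrow> chi \<xi> = 1) \<and> (\<forall>\<xi>. norm \<xi> \<ge> 1 \<longrightarrow> chi \<xi> = 0)"

definition LP_symbol :: "(real^'n \<Rightarrow> real) \<Rightarrow> int \<Rightarrow> real^'n \<Rightarrow> real" where
  "LP_symbol chi q \<xi> =
     (if q = -1 then chi \<xi>
      else chi ((1/2) *\<^sub>R ((1 / lam q) *\<^sub>R \<xi>)) - chi ((1 / lam q) *\<^sub>R \<xi>))"

definition freq :: "int^'n \<Rightarrow> real^'n" where
  "freq k = (\<chi> i. real_of_int (k $ i))"

definition fourier_coeff :: "(real^'n \<Rightarrow> real^'n) \<Rightarrow> int^'n \<Rightarrow> complex^'n" where
  "fourier_coeff v k =
     (\<chi> j. (LINT x|torus. complex_of_real (v x $ j) * cis (- (freq k \<bullet> x)))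
            / complex_of_real ((2 * pi) ^ CARD('n)))"

text \<open>Since the cutoff has bounded support, only finitely many summands are nonzero.\<close>
definition LP_proj ::
    "(real^'n \<Rightarrow> real) \<Rightarrow> int \<Rightarrow> (real^'n \<Rightarrow> real^'n) \<Rightarrow> real^'n \<Rightarrow> complex^'n" where
  "LP_proj chi q v x =
     (\<Sum>\<^sub>\<infinity>k\<in>UNIV. (\<chi> j. fourier_coeff v k $ j * complex_of_real (LP_symbol chi q (freq k))
                          * cis (freq k \<bullet> x)))"

definition Lr_norm :: "ennreal \<Rightarrow> (real^'n \<Rightarrow> 'b::real_normed_vector) \<Rightarrow> ennreal" where
  "Lr_norm r f =
     (if r = \<infinity> then esssup torus (\<lambda>x. ennreal (norm (f x)))
      else let I = \<integral>\<^sup>+ x. ennreal (norm (f x) powr enn2real r) \<partial>torus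
           in if I = \<infinity> then \<infinity> else ennreal (enn2real I powr (1 / enn2real r)))"

text \<open>The norm \<open>B\<^sup>s\<^sub>r\<^sub>,\<^sub>\<infinity>\<close>, with value \<open>\<infinity>\<close> outside the space.\<close>
definition besov_norm ::
    "(real^'n \<Rightarrow> real) \<Rightarrow> real \<Rightarrow> ennreal \<Rightarrow> (real^'n \<Rightarrow> real^'n) \<Rightarrow> ennreal" where
  "besov_norm chi s r v = (SUP q\<in>{-1..}. ennreal (lam q powr s) * Lr_norm r (LP_proj chi q v))"


section \<open>The initial datum\<close>

text \<open>The indices \<open>i\<close> and \<open>j\<close> play the role of the first and second coordinate.\<close>
definition shear_datum :: "real \<Rightarrow> 'n \<Rightarrow> 'n \<Rightarrow> real^'n \<Rightarrow> real^'n" where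
  "shear_datum s i j x =
     cos (x $ j) *\<^sub>R axis i 1
     + (\<Sum>q::nat. 1 / lam (int q) powr s * cos (lam (int q) * x $ i)) *\<^sub>R axis j 1"

end

theory Submission
  imports Defs
begin

text \<open>
  Write \<open>w = u - u\<^sub>0\<close> and suppose, for a contradiction, that \<open>w(t)\<close> has Besov norm below \<open>\<delta>\<close> for all \<open>t\<close> in some \<open>(0, \<tau>)\<close>.
  The nonlinear interaction of \<open>cos y\<close> with the single mode \<open>N\<^sup>-\<^sup>s cos(N x)\<close> of the datum, where
  \<open>N\<close> is a power of two, is of size \<open>N\<^sup>1\<^sup>-\<^sup>s\<close> at the frequency \<open>(N, 1)\<close>. It would drive \<open>u\<close> at this
  frequency at a rate larger by the factor \<open>N\<close> than the size \<open>\<delta> N\<^sup>-\<^sup>s\<close> available there.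

  To make this precise, let \<open>k = N e\<^sub>i + e\<^sub>j\<close> and \<open>a = e\<^sub>i / N - e\<^sub>j\<close>, so that \<open>a\<close> is orthogonal to \<open>k\<close>,
  and test the equation with \<open>\<theta>(t) sin(k \<bullet> x) a\<close>, where \<open>\<theta> \<ge> 0\<close> is supported in \<open>(0, \<tau>)\<close>. This field is
  divergence-free, the pressure disappears, and the integral over time of
  \<open>\<theta>'(t) moment(u(t)) + \<theta>(t) flux(u(t))\<close> vanishes, where \<open>moment(u)\<close> is the integral of
  \<open>(u \<bullet> a) sin(k \<bullet> x)\<close> and \<open>flux(u)\<close> that of \<open>(u \<bullet> a) (u \<bullet> k) cos(k \<bullet> x)\<close>. The flux of the datum
  is \<open>(1/N - N) N\<^sup>-\<^sup>s (2\<pi>)\<^sup>n / 4\<close>. The flux of \<open>u(t)\<close> differs from it by at most \<open>C \<delta> N\<^sup>1\<^sup>-\<^sup>s\<close>, and the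
  moment of \<open>u(t)\<close> differs from that of the datum by at most \<open>C \<delta> N\<^sup>-\<^sup>s\<close> (\<open>flux_moment_perturb\<close>).
  The moment of the datum does not depend on time, so \<open>\<theta>'\<close> integrates it to zero
  (\<open>averaged_identity\<close>), and the outcome is
  \<open>N\<^sup>1\<^sup>-\<^sup>s \<integral>\<theta> \<le> C' \<delta> (N\<^sup>-\<^sup>s \<integral>|\<theta>'| + N\<^sup>1\<^sup>-\<^sup>s \<integral>\<theta>)\<close>. For \<open>\<delta>\<close> small, depending only on \<open>n\<close>, \<open>r\<close>, \<open>s\<close>, and
  \<open>\<theta>\<close> fixed, this fails as \<open>N\<close> tends to infinity.

  The perturbation bounds use the Besov norm as follows. Terms linear in \<open>w\<close> only involve Fourier
  coefficients of \<open>w\<close> at explicit frequencies, each of which is controlled by its Littlewood-Paley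
  blocks (\<open>norm_fourier_le_of_blocks\<close>). For the terms quadratic in \<open>w\<close>
  (\<open>norm_fourier_mult_le_of_blocks\<close>) both factors are decomposed into blocks: a pair of blocks
  contributes at a frequency of size \<open>N\<close> only if one of them has frequencies of size at least about \<open>N\<close>,
  and the pair is bounded by a Hoelder inequality in which Bernstein's inequality is applied to the
  block of lower frequency (\<open>bilinear_Lr\<close>). For \<open>r \<le> 2\<close> this costs the factor \<open>2\<^sup>P\<close> to the power
  \<open>n(2/r - 1)\<close>, and \<open>s > n(2/r - 1)\<close> makes the sum over the low blocks converge; for \<open>r > 2\<close> there is
  no loss. Since a weak solution is only square-integrable in space, this decomposition requires that
  the low-frequency parts of an \<open>L\<^sup>2\<close> function converge to it in \<open>L\<^sup>2\<close> (\<open>low_part_tendsto\<close>), which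
  rests on the density of trigonometric polynomials (\<open>L2_approx\<close>). The same convergence shows that the
  flux is a measurable function of time (\<open>cosint_quadratic_measurable\<close>).
\<close>

section \<open>Integration over the torus\<close>

text \<open>The volume \<open>(2\<pi>)\<^sup>n\<close> of the torus.\<close>
abbreviation tvol :: "'n itself \<Rightarrow> real" where
  "tvol (_ :: 'n itself) \<equiv> (2 * pi) ^ CARD('n)"

lemma space_torus: "space (torus :: (real^'n) measure) = cbox 0 (\<chi> i. 2 * pi)"
  by (simp add: torus_def)

lemma finite_measure_torus: "finite_measure (torus :: (real^'n) measure)"
  unfolding torus_def by (rule finite_measure_lebesgue_on) simp

interpretation torus: finite_measure "torus :: (real^'n) measure"
  by (rule finite_measure_torus)

lemma continuous_measurable_torus:
  assumes "continuous_on UNIV (f :: real^'n \<Rightarrow> 'b::{real_normed_vector,second_countable_topology})"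
  shows "f \<in> borel_measurable torus"
proof -
  have "f \<in> borel_measurable borel"
    using assms by (rule borel_measurable_continuous_onI)
  then show ?thesis
    unfolding torus_def
    by (intro measurable_restrict_space1 measurable_completion) simp
qed

lemma bounded_integrable_torus:
  assumes "(f :: real^'n \<Rightarrow> 'b::{banach,second_countable_topology}) \<in> borel_measurable torus" "\<And>x. norm (f x) \<le> B"
  shows "integrable torus f"
  using assms by (intro torus.integrable_const_bound[of _ B]) auto

lemma integral_torus_lborel:
  fixes f :: "real^'n \<Rightarrow> 'b::{banach,second_countable_topology}"
  assumes "continuous_on UNIV f"
  shows "(LINT x|torus. f x) = (LINT x|lborel. indicator (cbox 0 (\<chi> i. 2 * pi)) x *\<^sub>R f x)"
proof -
  have m: "f \<in> borel_measurable borel"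
    using assms by (rule borel_measurable_continuous_onI)
  have "(LINT x|torus. f x) = (LINT x|lebesgue. indicator (cbox 0 (\<chi> i. 2 * pi)) x *\<^sub>R f x)"
    unfolding torus_def by (subst integral_restrict_space) (auto simp: set_lebesgue_integral_def)
  also have "\<dots> = (LINT x|lborel. indicator (cbox 0 (\<chi> i. 2 * pi)) x *\<^sub>R f x)"
    using m by (intro integral_completion) auto
  finally show ?thesis .
qed

lemma integral_cis_circle:
  "(LINT t|lborel. indicator {0..2*pi} t *\<^sub>R cis (real_of_int m * t)) = (if m = 0 then 2 * pi else 0)"
proof (cases "m = 0")
  case True
  then show ?thesis by (simp add: scaleR_conv_of_real)
next
  case False
  let ?F = "\<lambda>t. - \<i> / of_int m * cis (real_of_int m * t)"
  have d: "(?F has_vector_derivative cis (real_of_int m * t)) (at t within {0..2*pi})" for t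
  proof -
    have "((\<lambda>z. - \<i> / of_int m * exp (\<i> * (of_int m * z))) has_field_derivative
        exp (\<i> * (of_int m * of_real t))) (at (of_real t))"
      using False by (auto intro!: derivative_eq_intros)
    from has_vector_derivative_real_field[OF this] show ?thesis
      by (simp add: cis_conv_exp)
  qed
  have "(LINT t|lborel. indicator {0..2*pi} t *\<^sub>R cis (real_of_int m * t)) = ?F (2*pi) - ?F 0"
    by (rule integral_FTC_atLeastAtMost[OF _ d]) (auto intro!: continuous_intros)
  also have "cis (real_of_int m * (2*pi)) = 1"
    using cis_multiple_2pi[of "real_of_int m"] by (simp add: mult.commute mult.left_commute)
  finally show ?thesis using False by simp
qed

text \<open>
  The Lebesgue measure of \<open>\<real>\<^sup>n\<close> is a product measure and the exponential is a product of functions of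
  one coordinate, so the integral factorises.
\<close>
lemma integral_cis_torus:
  fixes k :: "int^'n"
  shows "(LINT x|torus. cis (freq k \<bullet> x)) = (if k = 0 then of_real (tvol TYPE('n)) else 0)"
proof -
  let ?g = "\<lambda>(b::real^'n) t. indicator {0..2*pi} t *\<^sub>R cis ((freq k \<bullet> b) * t)"
  interpret P: product_sigma_finite "\<lambda>b::real^'n. lborel :: real measure"
    by standard
  have [measurable]: "cis \<in> borel_measurable borel"
    by (intro borel_measurable_continuous_onI continuous_intros)
  have box: "indicator (cbox 0 (\<chi> i. 2 * pi)) x = (\<Prod>b\<in>Basis. indicator {0..2*pi} (x \<bullet> b) :: real)" for x :: "real^'n"
  proof (cases "x \<in> cbox 0 (\<chi> i. 2 * pi)")
    case True
    then have "indicator {0..2*pi} (x \<bullet> b) = (1::real)" if "b \<in> Basis" for b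
      using that by (auto simp: mem_box_cart Basis_vec_def cart_eq_inner_axis[symmetric])
    then show ?thesis using True by simp
  next
    case False
    then obtain l where "x $ l \<notin> {0..2*pi}" by (auto simp: mem_box_cart)
    then have "\<exists>b\<in>Basis. indicator {0..2*pi} (x \<bullet> b) = (0::real)"
      by (intro bexI[of _ "axis l 1"]) (auto simp: Basis_vec_def cart_eq_inner_axis[symmetric])
    then have "(\<Prod>b\<in>Basis. indicator {0..2*pi} (x \<bullet> b)) = (0::real)"
      by (intro prod_zero) auto
    then show ?thesis using False by simp
  qed
  have cisp: "cis (\<Sum>b\<in>B. h b) = (\<Prod>b\<in>B. cis (h b))" if "finite B" for B :: "(real^'n) set" and h
    using that by (induction B) (auto simp: cis_mult[symmetric])
  have ind: "indicator (cbox 0 (\<chi> i. 2 * pi)) x *\<^sub>R cis (freq k \<bullet> x) = (\<Prod>b\<in>Basis. ?g b (x \<bullet> b))" for x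
    unfolding box by (subst euclidean_inner[of "freq k" x])
      (simp add: cisp scaleR_conv_of_real prod.distrib)
  have "(LINT x|torus. cis (freq k \<bullet> x)) = (LINT x|lborel. (\<Prod>b\<in>Basis. ?g b (x \<bullet> b)))"
    by (subst integral_torus_lborel) (auto intro!: continuous_intros simp: ind)
  also have "\<dots> = (LINT f|(\<Pi>\<^sub>M b\<in>(Basis :: (real^'n) set). lborel). (\<Prod>b\<in>Basis. ?g b ((\<Sum>c\<in>Basis. f c *\<^sub>R c) \<bullet> b)))"
    by (subst lborel_eq, subst integral_distr) auto
  also have "\<dots> = (LINT f|(\<Pi>\<^sub>M b\<in>(Basis :: (real^'n) set). lborel). (\<Prod>b\<in>Basis. ?g b (f b)))"
    by (intro Bochner_Integration.integral_cong prod.cong refl) simp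
  also have "\<dots> = (\<Prod>b\<in>(Basis :: (real^'n) set). LINT t|lborel. ?g b t)"
    by (intro P.product_integral_prod) (auto intro!: borel_integrable_atLeastAtMost' continuous_intros simp: set_integrable_def[symmetric])
  also have "\<dots> = (\<Prod>b\<in>(Basis :: (real^'n) set). if freq k \<bullet> b = 0 then 2 * pi else 0)"
  proof (subst of_real_prod, rule prod.cong)
    fix b :: "real^'n" assume "b \<in> Basis"
    then obtain l where b: "freq k \<bullet> b = real_of_int (k $ l)"
      by (auto simp: Basis_vec_def cart_eq_inner_axis[symmetric] freq_def)
    show "(LINT t|lborel. ?g b t) = of_real (if freq k \<bullet> b = 0 then 2 * pi else 0)"
      using integral_cis_circle[of "k $ l"] by (simp add: b)
  qed simp
  also have "\<dots> = (if k = 0 then of_real (tvol TYPE('n)) else 0)"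
  proof (cases "k = 0")
    case False
    then obtain l where "k $ l \<noteq> 0" by (auto simp: vec_eq_iff)
    then have "\<exists>b\<in>Basis. freq k \<bullet> b \<noteq> 0"
      by (intro bexI[of _ "axis l 1"]) (auto simp: Basis_vec_def cart_eq_inner_axis[symmetric] freq_def)
    then show ?thesis using False by auto
  next
    case True
    then have "freq k = 0" by (simp add: freq_def vec_eq_iff)
    then show ?thesis using True by simp
  qed
  finally show ?thesis .
qed

section \<open>Square-integrable functions and Fourier coefficients\<close>

text \<open>The exponential \<open>e\<^sup>i\<^sup>k\<^sup>x\<close>.\<close>
definition wave :: "int^'n \<Rightarrow> real^'n \<Rightarrow> complex" where
  "wave k x = cis (freq k \<bullet> x)"

text \<open>Fourier coefficients of scalar functions, without the normalising factor \<open>(2\<pi>)\<^sup>-\<^sup>n\<close>.\<close>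
definition fourier :: "(real^'n \<Rightarrow> complex) \<Rightarrow> int^'n \<Rightarrow> complex" where
  "fourier f k = (LINT x|torus. f x * wave (- k) x)"

text \<open>The trigonometric polynomial with coefficients \<open>c\<close> on the set \<open>K\<close> of frequencies.\<close>
definition trig :: "(int^'n) set \<Rightarrow> (int^'n \<Rightarrow> complex) \<Rightarrow> real^'n \<Rightarrow> complex" where
  "trig K c x = (\<Sum>k\<in>K. c k * wave k x)"

text \<open>
  Square-integrable scalar functions. They are functions on \<open>\<real>\<^sup>n\<close>, but only their values in the
  fundamental cube matter, and no periodicity is required.
\<close>
definition sqint :: "(real^'n \<Rightarrow> complex) \<Rightarrow> bool" where
  "sqint f \<longleftrightarrow> f \<in> borel_measurable torus \<and> integrable torus (\<lambda>x. (norm (f x))\<^sup>2)"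

text \<open>The square of the \<open>L\<^sup>2\<close> norm.\<close>
definition energy :: "(real^'n \<Rightarrow> complex) \<Rightarrow> real" where
  "energy f = (LINT x|torus. (norm (f x))\<^sup>2)"

lemma freq_simps: "freq 0 = 0" "freq (a + b) = freq a + freq b" "freq (- a) = - freq a"
    "freq (a - b) = freq a - freq b"
  by (auto simp: freq_def vec_eq_iff)

lemma wave_simps: "wave 0 x = 1" "wave (a + b) x = wave a x * wave b x"
    "norm (wave a x) = 1" "cnj (wave a x) = wave (- a) x"
  by (auto simp: wave_def freq_simps inner_add_left cis_mult cis_cnj)

lemma continuous_wave [continuous_intros]: "continuous_on S (wave k)"
  unfolding wave_def by (intro continuous_intros)

lemma wave_measurable [measurable]: "wave k \<in> borel_measurable torus"
  by (intro continuous_measurable_torus continuous_intros)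

lemma integral_wave: "(LINT x|torus. wave (k :: int^'n) x) = (if k = 0 then of_real (tvol TYPE('n)) else 0)"
  unfolding wave_def by (rule integral_cis_torus)

lemma measure_torus: "measure (torus :: (real^'n) measure) (space torus) = tvol TYPE('n)"
proof -
  have "complex_of_real (measure (torus :: (real^'n) measure) (space torus)) = of_real (tvol TYPE('n))"
    using integral_wave[of "0 :: int^'n"] by (simp add: wave_simps scaleR_conv_of_real)
  then show ?thesis unfolding of_real_eq_iff .
qed

lemma sqintD: "sqint f \<Longrightarrow> f \<in> borel_measurable torus" "sqint f \<Longrightarrow> integrable torus (\<lambda>x. (norm (f x))\<^sup>2)"
  by (auto simp: sqint_def)

lemma sqint_mult_norm:
  assumes "sqint f" "sqint g"
  shows "integrable torus (\<lambda>x. norm (f x) * norm (g x))"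
proof (rule Bochner_Integration.integrable_bound)
  show "integrable torus (\<lambda>x. (norm (f x))\<^sup>2 + (norm (g x))\<^sup>2)"
    using assms by (auto simp: sqint_def)
  show "AE x in torus. norm (norm (f x) * norm (g x)) \<le> norm ((norm (f x))\<^sup>2 + (norm (g x))\<^sup>2)"
  proof (rule AE_I2)
    fix x
    have "2 * (norm (f x) * norm (g x)) \<le> (norm (f x))\<^sup>2 + (norm (g x))\<^sup>2"
      using sum_squares_bound[of "norm (f x)" "norm (g x)"] by (simp add: mult.assoc)
    moreover have "0 \<le> norm (f x) * norm (g x)" by simp
    ultimately have "norm (f x) * norm (g x) \<le> (norm (f x))\<^sup>2 + (norm (g x))\<^sup>2" by linarith
    then show "norm (norm (f x) * norm (g x)) \<le> norm ((norm (f x))\<^sup>2 + (norm (g x))\<^sup>2)"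
      by (simp add: abs_mult)
  qed
qed (use sqintD(1)[OF assms(1)] sqintD(1)[OF assms(2)] in measurable)

lemma sqint_mult:
  assumes "sqint f" "sqint g"
  shows "integrable torus (\<lambda>x. f x * g x)"
  using sqint_mult_norm[OF assms] sqintD(1)[OF assms(1)] sqintD(1)[OF assms(2)]
  by (intro Bochner_Integration.integrable_bound[OF sqint_mult_norm[OF assms]]) (auto simp: norm_mult)

lemma sqint_bounded:
  assumes "f \<in> borel_measurable torus" "\<And>x. norm (f x) \<le> B"
  shows "sqint f"
proof -
  have "(norm (f x))\<^sup>2 \<le> B\<^sup>2" for x
    using assms(2) by (intro power_mono) auto
  then have "integrable torus (\<lambda>x. (norm (f x))\<^sup>2)"
    using assms(1) by (intro bounded_integrable_torus[of _ "B\<^sup>2"]) auto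
  then show ?thesis using assms(1) by (simp add: sqint_def)
qed

lemma norm_add_squared_le:
  fixes a b :: "'a::real_normed_vector"
  shows "(norm (a + b))\<^sup>2 \<le> 2 * (norm a)\<^sup>2 + 2 * (norm b)\<^sup>2"
proof -
  have "(norm (a + b))\<^sup>2 \<le> (norm a + norm b)\<^sup>2"
    by (intro power_mono norm_triangle_ineq) auto
  also have "\<dots> \<le> 2 * (norm a)\<^sup>2 + 2 * (norm b)\<^sup>2"
    using sum_squares_bound[of "norm a" "norm b"] by (simp add: power2_sum)
  finally show ?thesis .
qed

lemma sqint_add:
  assumes "sqint f" "sqint g"
  shows "sqint (\<lambda>x. f x + g x)"
proof -
  note [measurable] = sqintD(1)[OF assms(1)] sqintD(1)[OF assms(2)]
  have "integrable torus (\<lambda>x. (norm (f x + g x))\<^sup>2)"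
  proof (rule Bochner_Integration.integrable_bound)
    show "integrable torus (\<lambda>x. 2 * (norm (f x))\<^sup>2 + 2 * (norm (g x))\<^sup>2)"
      using assms by (auto simp: sqint_def)
    show "AE x in torus. norm ((norm (f x + g x))\<^sup>2) \<le> norm (2 * (norm (f x))\<^sup>2 + 2 * (norm (g x))\<^sup>2)"
      by (intro AE_I2) (simp add: norm_add_squared_le)
  qed measurable
  then show ?thesis by (simp add: sqint_def)
qed

lemma sqint_cmult: "sqint f \<Longrightarrow> sqint (\<lambda>x. c * f x)"
  by (auto simp: sqint_def norm_mult power_mult_distrib)

lemma sqint_diff:
  assumes "sqint f" "sqint g"
  shows "sqint (\<lambda>x. f x - g x)"
  using sqint_add[OF assms(1) sqint_cmult[OF assms(2), of "-1"]] by simp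

lemma sqint_wave: "sqint (wave k)"
  by (rule sqint_bounded[of _ 1]) (auto simp: wave_simps)

lemma sqint_wave_mult:
  assumes "sqint f"
  shows "sqint (\<lambda>x. f x * wave k x)"
  using assms unfolding sqint_def by (auto simp: norm_mult wave_simps)

lemma sqint_mult_wave_integrable:
  assumes "sqint f" "sqint g"
  shows "integrable torus (\<lambda>x. f x * g x * wave k x)"
  using sqint_mult[OF assms(1) sqint_wave_mult[OF assms(2)]] by (simp add: mult.assoc)

lemma sqint_sum:
  assumes "\<And>i. i \<in> I \<Longrightarrow> sqint (f i)"
  shows "sqint (\<lambda>x. \<Sum>i\<in>I. f i x)"
  using assms by (induction I rule: infinite_finite_induct)
    (auto intro: sqint_add sqint_bounded[of _ 0])

lemma sqint_trig: "sqint (trig K c)"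
  unfolding trig_def by (intro sqint_sum sqint_cmult sqint_wave)

lemma sqint_integrable: "sqint f \<Longrightarrow> integrable torus f"
  using sqint_mult[of f "\<lambda>_. 1"] sqint_bounded[of "\<lambda>_. 1" 1] by simp

lemma energy_nonneg: "0 \<le> energy f"
  by (simp add: energy_def)

lemma Cauchy_Schwarz_torus:
  assumes f: "sqint f" and g: "sqint g"
  shows "(LINT x|torus. norm (f x) * norm (g x)) \<le> sqrt (energy f) * sqrt (energy g)"
proof -
  let ?P = "LINT x|torus. norm (f x) * norm (g x)"
  have P: "0 \<le> ?P" by simp
  have q: "2 * ?P * t \<le> energy f * t\<^sup>2 + energy g" for t
  proof -
    have "0 \<le> (LINT x|torus. (norm (f x) * t - norm (g x))\<^sup>2)" by simp
    also have "\<dots> = (LINT x|torus. t\<^sup>2 * (norm (f x))\<^sup>2 - 2 * t * (norm (f x) * norm (g x)) + (norm (g x))\<^sup>2)"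
      by (intro Bochner_Integration.integral_cong) (auto simp: power2_eq_square algebra_simps)
    also have "\<dots> = t\<^sup>2 * energy f - 2 * t * ?P + energy g"
      unfolding energy_def using sqintD(2)[OF f] sqintD(2)[OF g] sqint_mult_norm[OF f g]
      by (subst Bochner_Integration.integral_add Bochner_Integration.integral_diff; (intro Bochner_Integration.integrable_diff integrable_mult_right)?; simp)+
    finally show ?thesis by (simp add: algebra_simps)
  qed
  have "?P\<^sup>2 \<le> energy f * energy g"
  proof (cases "energy f = 0")
    case True
    have "?P = 0"
    proof (rule ccontr)
      assume "?P \<noteq> 0"
      with q[of "(energy g + 1) / (2 * ?P)"] True show False by simp
    qed
    then show ?thesis by (simp add: energy_nonneg)
  next
    case False
    then have e: "energy f > 0" using energy_nonneg[of f] by simp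
    have "2 * ?P * (?P / energy f) \<le> energy f * (?P / energy f)\<^sup>2 + energy g" by (rule q)
    then show ?thesis using e by (simp add: field_simps power2_eq_square)
  qed
  then have "sqrt (?P\<^sup>2) \<le> sqrt (energy f * energy g)" by (rule real_sqrt_le_mono)
  then show ?thesis using P by (simp add: real_sqrt_mult)
qed

lemma energy_add_le:
  assumes f: "sqint f" and g: "sqint g"
  shows "energy (\<lambda>x. f x + g x) \<le> 2 * energy f + 2 * energy g"
proof -
  have "energy (\<lambda>x. f x + g x) \<le> (LINT x|torus. 2 * (norm (f x))\<^sup>2 + 2 * (norm (g x))\<^sup>2)"
    unfolding energy_def
    using sqintD(2)[OF sqint_add[OF f g]] sqintD(2)[OF f] sqintD(2)[OF g]
    by (intro integral_mono norm_add_squared_le) auto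
  also have "\<dots> = 2 * energy f + 2 * energy g"
    using sqintD(2)[OF f] sqintD(2)[OF g] by (simp add: energy_def)
  finally show ?thesis .
qed

lemma integral_trig_mult:
  fixes f :: "real^'n \<Rightarrow> complex"
  assumes "sqint f"
  shows "(LINT x|torus. f x * cnj (trig K c x)) = (\<Sum>k\<in>K. cnj (c k) * fourier f k)"
proof -
  have "(LINT x|torus. f x * cnj (trig K c x)) = (LINT x|torus. (\<Sum>k\<in>K. cnj (c k) * (f x * wave (- k) x)))"
    by (intro Bochner_Integration.integral_cong) (auto simp: trig_def sum_distrib_left wave_simps ac_simps)
  also have "\<dots> = (\<Sum>k\<in>K. LINT x|torus. cnj (c k) * (f x * wave (- k) x))"
    using assms by (intro Bochner_Integration.integral_sum integrable_mult_right sqint_mult sqint_wave)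
  finally show ?thesis by (simp add: fourier_def)
qed

lemma fourier_trig:
  fixes c :: "int^'n \<Rightarrow> complex"
  assumes "finite K"
  shows "fourier (trig K c) a = (if a \<in> K then of_real (tvol TYPE('n)) * c a else 0)"
proof -
  have "fourier (trig K c) a = (LINT x|torus. (\<Sum>k\<in>K. c k * wave (k - a) x))"
    unfolding fourier_def trig_def
    by (intro Bochner_Integration.integral_cong) (auto simp: sum_distrib_right wave_simps(2) diff_conv_add_uminus mult.assoc simp del: add_uminus_conv_diff)
  also have "\<dots> = (\<Sum>k\<in>K. LINT x|torus. c k * wave (k - a) x)"
    by (intro Bochner_Integration.integral_sum) (auto intro!: sqint_integrable sqint_wave sqint_cmult)
  also have "\<dots> = (\<Sum>k\<in>K. if k = a then of_real (tvol TYPE('n)) * c a else 0)"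
    by (intro sum.cong) (auto simp: integral_wave)
  finally show ?thesis using assms by simp
qed

lemma energy_trig:
  fixes c :: "int^'n \<Rightarrow> complex"
  assumes "finite K"
  shows "energy (trig K c) = tvol TYPE('n) * (\<Sum>k\<in>K. (norm (c k))\<^sup>2)"
proof -
  have "complex_of_real (energy (trig K c)) = (LINT x|torus. trig K c x * cnj (trig K c x))"
    unfolding energy_def by (subst integral_complex_of_real[symmetric])
      (auto intro!: Bochner_Integration.integral_cong simp: complex_norm_square simp del: of_real_power)
  also have "\<dots> = (\<Sum>k\<in>K. cnj (c k) * fourier (trig K c) k)"
    by (intro integral_trig_mult sqint_trig)
  also have "\<dots> = (\<Sum>k\<in>K. of_real (tvol TYPE('n)) * of_real ((norm (c k))\<^sup>2))"
    using assms by (intro sum.cong refl) (simp only: fourier_trig complex_norm_square if_True ac_simps)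
  also have "\<dots> = complex_of_real (tvol TYPE('n) * (\<Sum>k\<in>K. (norm (c k))\<^sup>2))"
    by (simp add: sum_distrib_left)
  finally show ?thesis unfolding of_real_eq_iff .
qed

lemma Bessel_torus:
  fixes f :: "real^'n \<Rightarrow> complex"
  assumes f: "sqint f" and K: "finite K"
  shows "(\<Sum>k\<in>K. (norm (fourier f k))\<^sup>2) \<le> tvol TYPE('n) * energy f"
proof -
  define V where "V = tvol TYPE('n)"
  let ?S = "\<Sum>k\<in>K. (norm (fourier f k))\<^sup>2"
  define g where "g = trig K (\<lambda>k. fourier f k / of_real V)"
  have g: "sqint g" unfolding g_def by (rule sqint_trig)
  have V: "V > 0" by (simp add: V_def)
  have Eg: "energy g = ?S / V"
    unfolding g_def energy_trig[OF K] V_def[symmetric] using V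
    by (simp add: norm_divide power_divide sum_divide_distrib[symmetric] power2_eq_square norm_power)
  have "(LINT x|torus. f x * cnj (g x)) = (\<Sum>k\<in>K. cnj (fourier f k / of_real V) * fourier f k)"
    unfolding g_def by (rule integral_trig_mult[OF f])
  also have "\<dots> = (\<Sum>k\<in>K. of_real ((norm (fourier f k))\<^sup>2 / V))"
    by (intro sum.cong refl) (simp add: complex_norm_square mult.commute del: of_real_power)
  also have "\<dots> = of_real (?S / V)" by (simp add: sum_divide_distrib)
  finally have fg: "(LINT x|torus. f x * cnj (g x)) = of_real (?S / V)" .
  have cg: "sqint (\<lambda>x. cnj (g x))"
    using g borel_measurable_continuous_onI[OF continuous_on_cnj[OF continuous_on_id]]
    by (auto simp: sqint_def intro: measurable_compose)
  have i: "integrable torus (\<lambda>x. f x * cnj (g x))" by (rule sqint_mult[OF f cg])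
  have R: "(LINT x|torus. Re (f x * cnj (g x))) = ?S / V"
    using fg integral_Re[OF i] by (simp del: of_real_divide of_real_sum)
  have "0 \<le> energy (\<lambda>x. f x - g x)" by (rule energy_nonneg)
  also have "energy (\<lambda>x. f x - g x) = (LINT x|torus. (norm (f x))\<^sup>2 - 2 * Re (f x * cnj (g x)) + (norm (g x))\<^sup>2)"
    unfolding energy_def
    by (intro Bochner_Integration.integral_cong refl) (simp only: cmod_power2, simp add: power2_eq_square algebra_simps)
  also have "\<dots> = energy f - 2 * (?S / V) + energy g"
  proof -
    have "integrable torus (\<lambda>x. 2 * Re (f x * cnj (g x)))"
      using i by (intro integrable_mult_right integrable_Re)
    then show ?thesis
      unfolding energy_def R[symmetric] using sqintD(2)[OF f] sqintD(2)[OF g]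
      by (subst Bochner_Integration.integral_add Bochner_Integration.integral_diff;
          (intro Bochner_Integration.integrable_diff)?; (simp del: times_complex.sel)?)+
  qed
  finally show ?thesis using V unfolding Eg V_def[symmetric] by (simp add: field_simps)
qed

text \<open>The Fourier multiplier with symbol \<open>m\<close>, restricted to the frequencies in \<open>K\<close>.\<close>
definition multiplier :: "(int^'n \<Rightarrow> real) \<Rightarrow> (int^'n) set \<Rightarrow> (real^'n \<Rightarrow> complex) \<Rightarrow> real^'n \<Rightarrow> complex" where
  "multiplier m K f = trig K (\<lambda>k. fourier f k / of_real (tvol TYPE('n)) * of_real (m k))"

lemma energy_multiplier_le:
  fixes f :: "real^'n \<Rightarrow> complex"
  assumes f: "sqint f" and K: "finite K" and m: "\<And>k. \<bar>m k\<bar> \<le> B"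
  shows "energy (multiplier m K f) \<le> B\<^sup>2 * energy f"
proof -
  define V where "V = tvol TYPE('n)"
  have V: "V > 0" by (simp add: V_def)
  have "energy (multiplier m K f) = V * (\<Sum>k\<in>K. (norm (fourier f k))\<^sup>2 / V\<^sup>2 * (m k)\<^sup>2)"
    unfolding multiplier_def energy_trig[OF K] V_def[symmetric] using V
    by (simp add: norm_mult norm_divide power_mult_distrib power_divide norm_power)
  also have "\<dots> \<le> V * (\<Sum>k\<in>K. (norm (fourier f k))\<^sup>2 / V\<^sup>2 * B\<^sup>2)"
    using m V by (intro mult_left_mono sum_mono) (auto simp: abs_le_square_iff[symmetric] intro: order_trans[OF _ abs_ge_self])
  also have "\<dots> = B\<^sup>2 / V * (\<Sum>k\<in>K. (norm (fourier f k))\<^sup>2)"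
    using V by (simp add: sum_distrib_left sum_divide_distrib power2_eq_square field_simps)
  also have "\<dots> \<le> B\<^sup>2 / V * (V * energy f)"
    using V Bessel_torus[OF f K] unfolding V_def by (intro mult_left_mono) auto
  finally show ?thesis using V by simp
qed

section \<open>Density of trigonometric polynomials in L2\<close>

text \<open>
  Trigonometric polynomials again, in a form suited to closure properties: finite sums of multiples of
  exponentials, whatever the set of frequencies.
\<close>
inductive trigpoly :: "(real^'n \<Rightarrow> complex) \<Rightarrow> bool" where
  wave: "trigpoly (\<lambda>x. c * wave k x)"
| add: "trigpoly p \<Longrightarrow> trigpoly q \<Longrightarrow> trigpoly (\<lambda>x. p x + q x)"

lemma trigpoly_const: "trigpoly (\<lambda>x. c)"
  using trigpoly.wave[of c 0] by (simp add: wave_simps)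

lemma trigpoly_mult_wave: "trigpoly p \<Longrightarrow> trigpoly (\<lambda>x. c * wave k x * p x)"
proof (induction rule: trigpoly.induct)
  case (wave d l)
  show ?case using trigpoly.wave[of "c * d" "k + l"] by (simp add: wave_simps ac_simps)
next
  case (add p q)
  from trigpoly.add[OF add.IH] show ?case by (simp add: algebra_simps)
qed

lemma trigpoly_mult: "trigpoly p \<Longrightarrow> trigpoly q \<Longrightarrow> trigpoly (\<lambda>x. p x * q x)"
proof (induction rule: trigpoly.induct)
  case (wave c k)
  then show ?case by (rule trigpoly_mult_wave)
next
  case (add p q')
  from trigpoly.add[OF add.IH] add.prems show ?case by (simp add: algebra_simps)
qed

lemma trigpoly_cmult: "trigpoly p \<Longrightarrow> trigpoly (\<lambda>x. c * p x)"
  using trigpoly_mult[OF trigpoly_const] .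

lemma trigpoly_sum: "(\<And>i. i \<in> I \<Longrightarrow> trigpoly (p i)) \<Longrightarrow> trigpoly (\<lambda>x. \<Sum>i\<in>I. p i x)"
  by (induction I rule: infinite_finite_induct) (auto intro: trigpoly_const trigpoly.add)

lemma sqint_trigpoly: "trigpoly p \<Longrightarrow> sqint p"
  by (induction rule: trigpoly.induct) (auto intro: sqint_add sqint_cmult sqint_wave)

lemma freq_axis: "freq (axis l m) \<bullet> x = of_int m * x $ l"
proof -
  have "freq (axis l m) = axis l (of_int m)" by (auto simp: freq_def axis_def vec_eq_iff)
  then show ?thesis by (simp add: inner_axis')
qed

lemma trigpoly_cos: "trigpoly (\<lambda>x::real^'n. of_real (cos (x $ l)))"
proof -
  have "(of_real (cos (x $ l)) :: complex) = 1/2 * wave (axis l 1) x + 1/2 * wave (- axis l 1) x" for x :: "real^'n"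
    by (simp add: wave_def freq_simps freq_axis complex_eq_iff)
  then show ?thesis by (simp only:) (intro trigpoly.intros)
qed

lemma trigpoly_sin: "trigpoly (\<lambda>x::real^'n. of_real (sin (x $ l)))"
proof -
  have "(of_real (sin (x $ l)) :: complex) = - \<i>/2 * wave (axis l 1) x + \<i>/2 * wave (- axis l 1) x" for x :: "real^'n"
    by (simp add: wave_def freq_simps freq_axis complex_eq_iff)
  then show ?thesis by (simp only:) (intro trigpoly.intros)
qed

text \<open>
  The map \<open>x \<mapsto> (e\<^sup>i\<^sup>x\<^sup>1, ..., e\<^sup>i\<^sup>x\<^sup>n)\<close> embeds the torus into \<open>\<complex>\<^sup>n\<close>; restricted to its image, a real
  polynomial in the real and imaginary parts is a trigonometric polynomial.
\<close>
lemma trigpoly_real_polynomial_function: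
  assumes "real_polynomial_function g"
  shows "trigpoly (\<lambda>x::real^'n. complex_of_real (g (\<chi> l. cis (x $ l))))"
  using assms
proof (induction rule: real_polynomial_function.induct)
  case (linear f)
  interpret bounded_linear f by fact
  have eq: "complex_of_real (f (\<chi> l. cis (x $ l)))
      = (\<Sum>b\<in>Basis. of_real (f b) * of_real ((\<chi> l. cis (x $ l)) \<bullet> b))" for x :: "real^'n"
  proof -
    have "f (\<chi> l. cis (x $ l)) = f (\<Sum>b\<in>Basis. ((\<chi> l. cis (x $ l)) \<bullet> b) *\<^sub>R b)"
      by (simp add: euclidean_representation)
    also have "\<dots> = (\<Sum>b\<in>Basis. f b * ((\<chi> l. cis (x $ l)) \<bullet> b))"
      by (simp add: sum scaleR ac_simps)
    finally show ?thesis by simp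
  qed
  have "trigpoly (\<lambda>x::real^'n. complex_of_real ((\<chi> l. cis (x $ l)) \<bullet> b))" if "b \<in> Basis" for b :: "complex^'n"
  proof -
    from that obtain l u where b: "b = axis l u" "u \<in> {1, \<i>}"
      by (auto simp: Basis_vec_def Basis_complex_def)
    then have "((\<chi> l. cis (x $ l)) \<bullet> b) = (if u = 1 then cos (x $ l) else sin (x $ l))" for x :: "real^'n"
      by (auto simp: inner_axis inner_complex_def)
    then show ?thesis by (cases "u = 1") (simp_all add: trigpoly_cos trigpoly_sin)
  qed
  then show ?case unfolding eq by (intro trigpoly_sum trigpoly_cmult)
next
  case (const c)
  then show ?case by (rule trigpoly_const)
next
  case (add f g)
  from trigpoly.add[OF add.IH] show ?case by simp
next
  case (mult f g)
  from trigpoly_mult[OF mult.IH] show ?case by simp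
qed

text \<open>This identifies which points of the fundamental cube represent the same point of the torus.\<close>
lemma cis_eq_imp_endpoints:
  assumes "cis a = cis b" "a \<in> {0..2*pi}" "b \<in> {0..2*pi}" "a \<noteq> b"
  shows "a \<in> {0, 2*pi}" "b \<in> {0, 2*pi}"
proof -
  have "cos (a - b) = 1"
    using assms(1) by (simp add: cos_diff complex_eq_iff cis.sel power2_eq_square[symmetric])
  then obtain n :: int where n: "a - b = n * (2 * pi)"
    by (auto simp: cos_one_2pi_int)
  have "\<bar>real_of_int n\<bar> * (2 * pi) = \<bar>a - b\<bar>" by (simp add: n abs_mult)
  also have "\<dots> \<le> 1 * (2 * pi)" using assms by auto
  finally have "\<bar>real_of_int n\<bar> \<le> 1" by (rule mult_right_le_imp_le) simp
  then have "n = -1 \<or> n = 0 \<or> n = 1" by linarith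
  with n assms show "a \<in> {0, 2*pi}" "b \<in> {0, 2*pi}" by auto
qed

text \<open>
  A continuous function that vanishes outside the open cube takes equal values at points of the closed
  cube that represent the same point of the torus. It therefore descends to the compact image \<open>E ` ?Q\<close> of
  the cube in \<open>\<complex>\<^sup>n\<close>, where the Stone-Weierstrass theorem applies.
\<close>
lemma trigpoly_uniform_approx_real:
  fixes h :: "real^'n \<Rightarrow> real"
  assumes h: "continuous_on UNIV h" and h0: "\<And>x. x \<notin> box 0 (\<chi> i. 2 * pi) \<Longrightarrow> h x = 0" and e: "e > 0"
  obtains p where "trigpoly p" "\<And>x. x \<in> cbox 0 (\<chi> i. 2 * pi) \<Longrightarrow> norm (of_real (h x) - p x) < e"
proof -
  let ?Q = "cbox 0 (\<chi> i. 2 * pi) :: (real^'n) set"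
  define E where "E = (\<lambda>x::real^'n. \<chi> l. cis (x $ l))"
  have E: "continuous_on A E" for A unfolding E_def by (intro continuous_intros)
  have inj: "h x = h y" if "x \<in> ?Q" "y \<in> ?Q" "E x = E y" for x y
  proof (cases "x = y")
    case False
    then obtain l where l: "x $ l \<noteq> y $ l" by (auto simp: vec_eq_iff)
    from that have "cis (x $ l) = cis (y $ l)" "x $ l \<in> {0..2*pi}" "y $ l \<in> {0..2*pi}"
      by (auto simp: E_def vec_eq_iff mem_box_cart)
    from cis_eq_imp_endpoints[OF this l]
    have "\<not> (0 < x $ l \<and> x $ l < 2 * pi)" "\<not> (0 < y $ l \<and> y $ l < 2 * pi)" by auto
    then have "x \<notin> box 0 (\<chi> i. 2 * pi)" "y \<notin> box 0 (\<chi> i. 2 * pi)"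
      by (auto simp: mem_box_cart)
    then show ?thesis by (simp add: h0)
  qed simp
  define F where "F z = h (SOME x. x \<in> ?Q \<and> E x = z)" for z
  have F: "F (E x) = h x" if "x \<in> ?Q" for x
  proof -
    have "\<exists>y. y \<in> ?Q \<and> E y = E x" using that by blast
    from someI_ex[OF this] show ?thesis unfolding F_def using inj that by blast
  qed
  have cpt: "compact (E ` ?Q)" by (intro compact_continuous_image E compact_cbox)
  have "continuous_on (E ` ?Q) F"
    unfolding continuous_on_closed_invariant
  proof safe
    fix C :: "real set" assume C: "closed C"
    have "closed (h -` C)"
      using h C by (simp add: continuous_on_closed_vimage)
    then have "compact (?Q \<inter> h -` C)" by (intro compact_Int_closed compact_cbox)
    then have "closed (E ` (?Q \<inter> h -` C))"
      by (intro compact_imp_closed compact_continuous_image E)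
    moreover have "E ` (?Q \<inter> h -` C) \<inter> E ` ?Q = F -` C \<inter> E ` ?Q"
      by (auto simp: F) (metis inj)
    ultimately show "\<exists>A. closed A \<and> A \<inter> E ` ?Q = F -` C \<inter> E ` ?Q" by blast
  qed
  from Stone_Weierstrass_real_polynomial_function[OF cpt this e]
  obtain g where g: "real_polynomial_function g" "\<And>z. z \<in> E ` ?Q \<Longrightarrow> \<bar>F z - g z\<bar> < e" by blast
  show ?thesis
  proof
    show "trigpoly (\<lambda>x::real^'n. complex_of_real (g (E x)))"
      unfolding E_def by (rule trigpoly_real_polynomial_function[OF g(1)])
    fix x assume x: "x \<in> ?Q"
    have "norm (complex_of_real (h x) - complex_of_real (g (E x))) = \<bar>h x - g (E x)\<bar>"
      by (simp only: of_real_diff[symmetric] norm_of_real)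
    then show "norm (complex_of_real (h x) - complex_of_real (g (E x))) < e"
      using g(2)[of "E x"] x by (simp add: F)
  qed
qed

lemma trigpoly_uniform_approx:
  fixes h :: "real^'n \<Rightarrow> complex"
  assumes h: "continuous_on UNIV h" and h0: "\<And>x. x \<notin> box 0 (\<chi> i. 2 * pi) \<Longrightarrow> h x = 0" and e: "e > 0"
  obtains p where "trigpoly p" "\<And>x. x \<in> cbox 0 (\<chi> i. 2 * pi) \<Longrightarrow> norm (h x - p x) < e"
proof -
  obtain p where p: "trigpoly p" "\<And>x. x \<in> cbox 0 (\<chi> i. 2 * pi) \<Longrightarrow> norm (of_real (Re (h x)) - p x) < e/2"
    using trigpoly_uniform_approx_real[of "\<lambda>x. Re (h x)" "e/2"] h h0 e by (auto intro!: continuous_intros)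
  obtain q where q: "trigpoly q" "\<And>x. x \<in> cbox 0 (\<chi> i. 2 * pi) \<Longrightarrow> norm (of_real (Im (h x)) - q x) < e/2"
    using trigpoly_uniform_approx_real[of "\<lambda>x. Im (h x)" "e/2"] h h0 e by (auto intro!: continuous_intros)
  show ?thesis
  proof
    show "trigpoly (\<lambda>x. p x + \<i> * q x)"
      by (intro trigpoly.add trigpoly_cmult p q)
    fix x :: "real^'n" assume x: "x \<in> cbox 0 (\<chi> i. 2 * pi)"
    have "h x - (p x + \<i> * q x) = (of_real (Re (h x)) - p x) + \<i> * (of_real (Im (h x)) - q x)"
      by (subst complex_eq[of "h x"]) (simp add: algebra_simps)
    then have "norm (h x - (p x + \<i> * q x)) \<le> norm (of_real (Re (h x)) - p x) + norm (\<i> * (of_real (Im (h x)) - q x))"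
      by (simp only: norm_triangle_ineq)
    with p(2)[OF x] q(2)[OF x] show "norm (h x - (p x + \<i> * q x)) < e"
      by (simp add: norm_mult)
  qed
qed

text \<open>The radial retraction of \<open>\<complex>\<close> onto the disc of radius \<open>M\<close>.\<close>
definition clamp_norm :: "real \<Rightarrow> complex \<Rightarrow> complex" where
  "clamp_norm M z = of_real (M / max M (norm z)) * z"

lemma clamp_norm:
  assumes "M > 0"
  shows "continuous_on UNIV (clamp_norm M)" "norm (clamp_norm M z) \<le> M"
    "norm z \<le> M \<Longrightarrow> clamp_norm M z = z" "norm (z - clamp_norm M z) \<le> norm z"
proof -
  show "continuous_on UNIV (clamp_norm M)"
    unfolding clamp_norm_def using assms by (intro continuous_intros) auto
  show "norm (clamp_norm M z) \<le> M"
    unfolding clamp_norm_def norm_mult norm_of_real using assms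
    by (auto simp: field_simps max_def)
  show "norm z \<le> M \<Longrightarrow> clamp_norm M z = z"
    unfolding clamp_norm_def using assms by (simp add: max_def)
  have "z - clamp_norm M z = of_real (1 - M / max M (norm z)) * z"
    by (simp add: clamp_norm_def algebra_simps)
  then have "norm (z - clamp_norm M z) = \<bar>1 - M / max M (norm z)\<bar> * norm z"
    by (simp only: norm_mult norm_of_real)
  also have "\<dots> \<le> 1 * norm z"
  proof (rule mult_right_mono)
    have "0 \<le> M / max M (norm z)" "M / max M (norm z) \<le> 1"
      using assms by (auto simp: max_def divide_le_eq)
    then show "\<bar>1 - M / max M (norm z)\<bar> \<le> 1" by linarith
  qed simp
  finally show "norm (z - clamp_norm M z) \<le> norm z" by simp
qed

lemma energy_tendsto_0:
  fixes f :: "nat \<Rightarrow> real^'n \<Rightarrow> complex"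
  assumes m: "\<And>n. f n \<in> borel_measurable torus" and w: "integrable torus w"
    and b: "\<And>n x. (norm (f n x))\<^sup>2 \<le> w x" and l: "AE x in torus. (\<lambda>n. f n x) \<longlonglongrightarrow> 0"
  shows "(\<lambda>n. energy (f n)) \<longlonglongrightarrow> 0"
proof -
  have "(\<lambda>n. LINT x|torus. (norm (f n x))\<^sup>2) \<longlonglongrightarrow> (LINT x|(torus::(real^'n) measure). 0)"
  proof (rule integral_dominated_convergence[where w = w])
    show "AE x in torus. (\<lambda>n. (norm (f n x))\<^sup>2) \<longlonglongrightarrow> 0"
      using l by eventually_elim (auto intro!: tendsto_eq_intros)
  qed (use m w b in auto)
  then show ?thesis by (simp add: energy_def)
qed

text \<open>
  A measurable function is almost everywhere a limit of continuous functions \<open>g n\<close>. Retracting these to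
  the disc of radius \<open>M\<close> and multiplying by cutoffs that vanish outside the open cube gives uniformly
  bounded approximations \<open>h n\<close>, to which dominated convergence and the uniform approximation apply.
\<close>
lemma bounded_L2_approx:
  fixes f :: "real^'n \<Rightarrow> complex"
  assumes f: "f \<in> borel_measurable torus" and M: "\<And>x. norm (f x) \<le> M" "M > 0" and e: "e > 0"
  obtains p where "trigpoly p" "energy (\<lambda>x. f x - p x) < e"
proof -
  let ?Q = "cbox 0 (\<chi> i. 2 * pi) :: (real^'n) set" and ?B = "box 0 (\<chi> i. 2 * pi) :: (real^'n) set"
  have "f measurable_on ?Q"
    using f by (simp add: measurable_on_iff_borel_measurable torus_def)
  then obtain N g where N: "negligible N" and g: "\<And>n::nat. continuous_on UNIV (g n)"
    and lim: "\<And>x. x \<notin> N \<Longrightarrow> (\<lambda>n. g n x) \<longlonglongrightarrow> (if x \<in> ?Q then f x else 0)"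
    by (auto simp: measurable_on_def)
  \<comment> \<open>The factor \<open>min 1 ...\<close> vanishes outside the open cube and tends to 1 inside it as \<open>n\<close> grows.\<close>
  define h where "h n x = of_real (min 1 (real n * infdist x (- ?B))) * clamp_norm M (g n x)" for n x
  have h: "continuous_on UNIV (h n)" for n
    unfolding h_def by (intro continuous_intros continuous_on_compose2[OF clamp_norm(1)[OF M(2)] g]) auto
  have h0: "h n x = 0" if "x \<notin> ?B" for n x
    using that by (simp add: h_def)
  have hM: "norm (h n x) \<le> M" for n x
  proof -
    have "norm (h n x) = \<bar>min 1 (real n * infdist x (- ?B))\<bar> * norm (clamp_norm M (g n x))"
      by (simp only: h_def norm_mult norm_of_real)
    also have "\<dots> \<le> 1 * M"
      using M(2) by (intro mult_mono clamp_norm) (auto simp: infdist_nonneg)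
    finally show ?thesis by simp
  qed
  have ae: "AE x in torus. x \<in> ?B \<and> x \<notin> N"
  proof -
    have "negligible (N \<union> (?Q - ?B))"
      using N negligible_frontier_interval by auto
    then have "N \<union> (?Q - ?B) \<in> null_sets lebesgue" by (simp add: negligible_iff_null_sets)
    then have "AE x in lebesgue. x \<notin> N \<union> (?Q - ?B)" by (rule AE_not_in)
    then have "AE x in lebesgue. x \<in> ?Q \<longrightarrow> x \<in> ?B \<and> x \<notin> N" by eventually_elim auto
    then show ?thesis unfolding torus_def by (subst AE_restrict_space_iff) auto
  qed
  have conv: "(\<lambda>n. f x - h n x) \<longlonglongrightarrow> 0" if x: "x \<in> ?B" "x \<notin> N" for x
  proof -
    have xQ: "x \<in> ?Q" using x(1) box_subset_cbox by blast
    have "(\<lambda>n. g n x) \<longlonglongrightarrow> f x" using lim[OF x(2)] xQ by simp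
    then have "(\<lambda>n. clamp_norm M (g n x)) \<longlonglongrightarrow> clamp_norm M (f x)"
      by (rule continuous_on_tendsto_compose[OF clamp_norm(1)[OF M(2)]]) auto
    then have c: "(\<lambda>n. clamp_norm M (g n x)) \<longlonglongrightarrow> f x"
      using clamp_norm(3)[OF M(2) M(1)] by simp
    have "- ?B \<noteq> {}" using not_interval_UNIV(2) by blast
    moreover have "closed (- ?B)" by (simp add: open_box closed_Compl)
    ultimately have d: "infdist x (- ?B) > 0"
      using x(1) in_closed_iff_infdist_zero[of "- ?B" x] infdist_nonneg[of x "- ?B"] by force
    then obtain n0 where n0: "real n0 * infdist x (- ?B) > 1"
      using reals_Archimedean3 by blast
    have "min 1 (real n * infdist x (- ?B)) = 1" if "n \<ge> n0" for n
    proof -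
      have "real n0 * infdist x (- ?B) \<le> real n * infdist x (- ?B)"
        using that d by (intro mult_right_mono) auto
      then show ?thesis using n0 by simp
    qed
    then have "eventually (\<lambda>n. clamp_norm M (g n x) = h n x) sequentially"
      unfolding h_def by (intro eventually_sequentiallyI[of n0]) simp
    from tendsto_cong[OF this] c have "(\<lambda>n. h n x) \<longlonglongrightarrow> f x" by simp
    from tendsto_diff[OF tendsto_const this, of "f x"] show ?thesis by simp
  qed
  have hm: "h n \<in> borel_measurable torus" for n by (rule continuous_measurable_torus[OF h])
  have "(\<lambda>n. energy (\<lambda>x. f x - h n x)) \<longlonglongrightarrow> 0"
  proof (rule energy_tendsto_0[where w = "\<lambda>_. (2 * M)\<^sup>2"])
    fix n x
    have "norm (f x - h n x) \<le> 2 * M"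
      using norm_triangle_ineq4[of "f x" "h n x"] M(1)[of x] hM[of n x] by linarith
    then show "(norm (f x - h n x))\<^sup>2 \<le> (2 * M)\<^sup>2" by (intro power_mono) auto
  next
    show "AE x in torus. (\<lambda>n. f x - h n x) \<longlonglongrightarrow> 0"
      using ae by eventually_elim (auto intro: conv)
  qed (use f hm in auto)
  then obtain n where n: "energy (\<lambda>x. f x - h n x) < e / 4"
    using e by (metis (no_types, lifting) eventually_happens order_tendstoD(2) zero_less_divide_iff zero_less_numeral trivial_limit_sequentially)
  define V where "V = tvol TYPE('n)"
  have V: "V > 0" by (simp add: V_def)
  define d where "d = sqrt (e / (8 * V))"
  have d: "d > 0" "d\<^sup>2 * V = e / 8" using e V by (auto simp: d_def)
  obtain p where p: "trigpoly p" "\<And>x. x \<in> ?Q \<Longrightarrow> norm (h n x - p x) < d"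
    using trigpoly_uniform_approx[OF h h0 d(1)] by blast
  have sf: "sqint f" "sqint (h n)" "sqint p"
    using sqint_bounded[OF f M(1)] sqint_bounded[OF hm hM] sqint_trigpoly[OF p(1)] by auto
  have "energy (\<lambda>x. h n x - p x) \<le> (LINT x|(torus :: (real^'n) measure). d\<^sup>2)"
    unfolding energy_def
  proof (rule integral_mono)
    fix x :: "real^'n" assume "x \<in> space torus"
    then show "(norm (h n x - p x))\<^sup>2 \<le> d\<^sup>2"
      using p(2)[of x] by (intro power_mono) (auto simp: space_torus intro: less_imp_le)
  qed (use sf in \<open>auto intro: sqintD sqint_diff\<close>)
  also have "\<dots> = d\<^sup>2 * V"
    using measure_torus[where 'n = 'n] by (simp add: V_def)
  finally have "energy (\<lambda>x. h n x - p x) \<le> e / 8" using d by simp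
  moreover have "energy (\<lambda>x. f x - p x) \<le> 2 * energy (\<lambda>x. f x - h n x) + 2 * energy (\<lambda>x. h n x - p x)"
    using energy_add_le[OF sqint_diff[OF sf(1,2)] sqint_diff[OF sf(2,3)]] by simp
  ultimately have "energy (\<lambda>x. f x - p x) < e" using n e by linarith
  with p(1) show ?thesis by (rule that)
qed

lemma L2_approx:
  fixes f :: "real^'n \<Rightarrow> complex"
  assumes f: "sqint f" and e: "e > 0"
  obtains p where "trigpoly p" "energy (\<lambda>x. f x - p x) < e"
proof -
  note fm [measurable] = sqintD(1)[OF f]
  define g where "g n x = clamp_norm (real (Suc n)) (f x)" for n x
  have gm [measurable]: "g n \<in> borel_measurable torus" for n
    unfolding g_def using borel_measurable_continuous_onI[OF clamp_norm(1)[of "real (Suc n)"]]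
    by (intro measurable_compose[OF fm]) auto
  have "(\<lambda>n. energy (\<lambda>x. f x - g n x)) \<longlonglongrightarrow> 0"
  proof (rule energy_tendsto_0[where w = "\<lambda>x. (norm (f x))\<^sup>2"])
    fix n x
    show "(norm (f x - g n x))\<^sup>2 \<le> (norm (f x))\<^sup>2"
      unfolding g_def by (intro power_mono clamp_norm) auto
  next
    show "AE x in torus. (\<lambda>n. f x - g n x) \<longlonglongrightarrow> 0"
    proof (rule AE_I2)
      fix x
      obtain n0 where n0: "norm (f x) \<le> real n0" using real_arch_simple by blast
      have "eventually (\<lambda>n. f x - g n x = 0) sequentially"
        unfolding g_def using n0 by (intro eventually_sequentiallyI[of n0]) (auto simp: clamp_norm(3))
      then show "(\<lambda>n. f x - g n x) \<longlonglongrightarrow> 0" by (rule tendsto_eventually)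
    qed
  qed (use sqintD(2)[OF f] in auto)
  then obtain n where n: "energy (\<lambda>x. f x - g n x) < e / 4"
    using e by (metis (no_types, lifting) eventually_happens order_tendstoD(2) zero_less_divide_iff zero_less_numeral trivial_limit_sequentially)
  have gb: "norm (g n x) \<le> real (Suc n)" for x
    unfolding g_def by (rule clamp_norm) simp
  obtain p where p: "trigpoly p" "energy (\<lambda>x. g n x - p x) < e / 4"
    using bounded_L2_approx[OF gm gb, of "e/4"] e by auto
  have sf: "sqint (g n)" "sqint p"
    using sqint_bounded[OF gm gb] p by (auto intro: sqint_trigpoly)
  have "energy (\<lambda>x. f x - p x) \<le> 2 * energy (\<lambda>x. f x - g n x) + 2 * energy (\<lambda>x. g n x - p x)"
    using energy_add_le[OF sqint_diff[OF f sf(1)] sqint_diff[OF sf]] by simp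
  then have "energy (\<lambda>x. f x - p x) < e" using n p by linarith
  with p(1) show ?thesis by (rule that)
qed

section \<open>Littlewood-Paley blocks and their convergence in L2\<close>

text \<open>The frequencies in the cube of half-side \<open>2\<^sup>P\<close>; they contain the support of the symbols below.\<close>
definition modes :: "nat \<Rightarrow> (int^'n) set" where
  "modes P = {k. \<forall>l. \<bar>k $ l\<bar> \<le> 2 ^ P}"

lemma modes_eq_image: "(modes P :: (int^'n) set) = (\<lambda>f. \<chi> l. f l) ` (\<Pi>\<^sub>E l\<in>UNIV. {- (2 ^ P)..2 ^ P})"
proof safe
  fix k :: "int^'n" assume "k \<in> modes P"
  then have "- (2 ^ P) \<le> k $ l \<and> k $ l \<le> 2 ^ P" for l
    by (auto simp: modes_def abs_le_iff minus_le_iff)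
  then show "k \<in> (\<lambda>f. \<chi> l. f l) ` (\<Pi>\<^sub>E l\<in>UNIV. {- (2 ^ P)..2 ^ P})"
    by (intro image_eqI[of _ _ "\<lambda>l. k $ l"]) auto
next
  fix f :: "'n \<Rightarrow> int" assume "f \<in> (\<Pi>\<^sub>E l\<in>UNIV. {- (2 ^ P)..2 ^ P})"
  then have "- (2 ^ P) \<le> f l \<and> f l \<le> 2 ^ P" for l by (auto simp: PiE_iff)
  then show "(\<chi> l. f l) \<in> modes P"
    by (auto simp: modes_def abs_le_iff minus_le_iff)
qed

lemma finite_modes [simp]: "finite (modes P :: (int^'n) set)"
  unfolding modes_eq_image by (intro finite_imageI finite_PiE) auto

lemma card_modes_le: "real (card (modes P :: (int^'n) set)) \<le> (3 * 2 ^ P) ^ CARD('n)"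
proof -
  have "card (modes P :: (int^'n) set) \<le> card (\<Pi>\<^sub>E l\<in>(UNIV::'n set). {- (2 ^ P)..2 ^ P :: int})"
    unfolding modes_eq_image by (intro card_image_le finite_PiE) auto
  also have "\<dots> = nat (2 * 2 ^ P + 1) ^ CARD('n)"
    by (simp add: card_PiE)
  finally have "real (card (modes P :: (int^'n) set)) \<le> real (nat (2 * 2 ^ P + 1) ^ CARD('n))"
    by (rule of_nat_mono)
  also have "\<dots> = (2 * 2 ^ P + 1) ^ CARD('n)"
    by simp
  also have "\<dots> \<le> (3 * 2 ^ P) ^ CARD('n)"
    using one_le_power[of "2::real" P] by (intro power_mono) auto
  finally show ?thesis .
qed

lemma modesI: "norm (freq k) \<le> 2 ^ P \<Longrightarrow> k \<in> modes P"
proof -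
  assume a: "norm (freq k) \<le> 2 ^ P"
  have "\<bar>k $ l\<bar> \<le> 2 ^ P" for l
  proof -
    have "real_of_int \<bar>k $ l\<bar> \<le> norm (freq k)"
      using component_le_norm_cart[of "freq k" l] by (simp add: freq_def)
    with a have "real_of_int \<bar>k $ l\<bar> \<le> real_of_int (2 ^ P)" by simp
    then show ?thesis by (simp only: of_int_le_iff)
  qed
  then show ?thesis by (simp add: modes_def)
qed

text \<open>
  Blocks are numbered by natural numbers, with block \<open>P\<close> equal to the Littlewood-Paley projection of
  index \<open>P - 1\<close>. The symbols of the blocks \<open>0, ..., P\<close> add up to \<open>low_symbol chi P\<close>, the cutoff
  \<open>chi(\<xi> / 2\<^sup>P)\<close>.
\<close>
definition low_symbol :: "(real^'n \<Rightarrow> real) \<Rightarrow> nat \<Rightarrow> int^'n \<Rightarrow> real" where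
  "low_symbol chi P k = chi ((1 / 2 ^ P) *\<^sub>R freq k)"

text \<open>The symbol of block \<open>P\<close>: it is supported in \<open>|\<xi>| < 2\<^sup>P\<close>.\<close>
definition block_symbol :: "(real^'n \<Rightarrow> real) \<Rightarrow> nat \<Rightarrow> int^'n \<Rightarrow> real" where
  "block_symbol chi P k = (if P = 0 then low_symbol chi 0 k else low_symbol chi P k - low_symbol chi (P - 1) k)"

text \<open>The sum of the blocks \<open>0, ..., P\<close> of \<open>f\<close>, a trigonometric polynomial.\<close>
definition low_part :: "(real^'n \<Rightarrow> real) \<Rightarrow> nat \<Rightarrow> (real^'n \<Rightarrow> complex) \<Rightarrow> real^'n \<Rightarrow> complex" where
  "low_part chi P = multiplier (low_symbol chi P) (modes P)"

text \<open>The Littlewood-Paley block of index \<open>P - 1\<close> of a scalar function.\<close>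
definition block :: "(real^'n \<Rightarrow> real) \<Rightarrow> nat \<Rightarrow> (real^'n \<Rightarrow> complex) \<Rightarrow> real^'n \<Rightarrow> complex" where
  "block chi P = multiplier (block_symbol chi P) (modes P)"

lemma LP_symbol_eq_block_symbol: "LP_symbol chi (int P - 1) (freq k) = block_symbol chi P k"
proof (cases P)
  case (Suc m)
  then show ?thesis
    by (simp add: LP_symbol_def block_symbol_def low_symbol_def lam_def power_int_of_nat field_simps)
qed (simp add: LP_symbol_def block_symbol_def low_symbol_def)

lemma sum_block_symbol: "(\<Sum>P\<le>Q. block_symbol chi P k) = low_symbol chi Q k"
  by (induction Q) (auto simp: block_symbol_def)

lemma fourier_add: "sqint f \<Longrightarrow> sqint g \<Longrightarrow> fourier (\<lambda>x. f x + g x) k = fourier f k + fourier g k"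
  unfolding fourier_def distrib_right
  by (intro Bochner_Integration.integral_add sqint_mult sqint_wave)

lemma fourier_diff: "sqint f \<Longrightarrow> sqint g \<Longrightarrow> fourier (\<lambda>x. f x - g x) k = fourier f k - fourier g k"
  unfolding fourier_def left_diff_distrib
  by (intro Bochner_Integration.integral_diff sqint_mult sqint_wave)

lemma norm_fourier_mult_le:
  assumes "sqint f" "sqint g"
  shows "norm (fourier (\<lambda>x. f x * g x) k) \<le> sqrt (energy f) * sqrt (energy g)"
proof -
  have "norm (fourier (\<lambda>x. f x * g x) k) \<le> (LINT x|torus. norm (f x * g x * wave (- k) x))"
    unfolding fourier_def by (rule integral_norm_bound)
  also have "\<dots> = (LINT x|torus. norm (f x) * norm (g x))"
    by (simp add: norm_mult wave_simps)
  also have "\<dots> \<le> sqrt (energy f) * sqrt (energy g)" by (rule Cauchy_Schwarz_torus[OF assms])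
  finally show ?thesis .
qed

lemma fourier_trig_mult:
  fixes c d :: "int^'n \<Rightarrow> complex"
  shows "fourier (\<lambda>x. trig K c x * trig L d x) k =
    (\<Sum>a\<in>K. \<Sum>b\<in>L. c a * d b * (if a + b = k then of_real (tvol TYPE('n)) else 0))"
proof -
  have "fourier (\<lambda>x. trig K c x * trig L d x) k = (LINT x|torus. (\<Sum>a\<in>K. \<Sum>b\<in>L. c a * d b * wave (a + b - k) x))"
    unfolding fourier_def
  proof (intro Bochner_Integration.integral_cong refl)
    fix x :: "real^'n"
    have "wave (a + b - k) x = wave a x * wave b x * wave (- k) x" for a b
      by (simp only: diff_conv_add_uminus wave_simps(2))
    then show "trig K c x * trig L d x * wave (- k) x = (\<Sum>a\<in>K. \<Sum>b\<in>L. c a * d b * wave (a + b - k) x)"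
      unfolding trig_def sum_product
      by (subst sum_distrib_right, intro sum.cong refl, subst sum_distrib_right, intro sum.cong refl)
        (simp add: ac_simps)
  qed
  also have "\<dots> = (\<Sum>a\<in>K. LINT x|torus. (\<Sum>b\<in>L. c a * d b * wave (a + b - k) x))"
    by (intro Bochner_Integration.integral_sum sqint_integrable sqint_sum sqint_cmult sqint_wave)
  also have "\<dots> = (\<Sum>a\<in>K. \<Sum>b\<in>L. LINT x|torus. c a * d b * wave (a + b - k) x)"
    by (intro sum.cong refl Bochner_Integration.integral_sum sqint_integrable sqint_cmult sqint_wave)
  also have "\<dots> = (\<Sum>a\<in>K. \<Sum>b\<in>L. c a * d b * (if a + b = k then of_real (tvol TYPE('n)) else 0))"
    by (simp add: integral_wave)
  finally show ?thesis .
qed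

lemma sqint_low_part: "sqint (low_part chi P f)"
  by (simp add: low_part_def multiplier_def sqint_trig)

lemma sqint_block: "sqint (block chi P f)"
  by (simp add: block_def multiplier_def sqint_trig)

lemma low_part_add: "sqint f \<Longrightarrow> sqint g \<Longrightarrow> low_part chi Q (\<lambda>x. f x + g x) x = low_part chi Q f x + low_part chi Q g x"
  by (simp add: low_part_def multiplier_def trig_def fourier_add sum.distrib[symmetric] algebra_simps add_divide_distrib)

lemma low_part_diff: "sqint f \<Longrightarrow> sqint g \<Longrightarrow> low_part chi Q (\<lambda>x. f x - g x) x = low_part chi Q f x - low_part chi Q g x"
  by (simp add: low_part_def multiplier_def trig_def fourier_diff sum_subtractf[symmetric] algebra_simps diff_divide_distrib)

context
  fixes chi :: "real^'n \<Rightarrow> real"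
  assumes chi: "LP_cutoff chi"
begin

lemma low_symbol_eq_0: "2 ^ P \<le> norm (freq k) \<Longrightarrow> low_symbol chi P k = 0"
  using chi by (auto simp: LP_cutoff_def low_symbol_def field_simps)

lemma low_symbol_eq_1: "norm (freq k) \<le> 2 ^ P / 2 \<Longrightarrow> low_symbol chi P k = 1"
  using chi by (auto simp: LP_cutoff_def low_symbol_def field_simps)

lemma block_symbol_eq_0: "2 ^ P \<le> norm (freq k) \<Longrightarrow> block_symbol chi P k = 0"
proof -
  assume a: "2 ^ P \<le> norm (freq k)"
  have "(2::real) ^ (P - 1) \<le> 2 ^ P" by (intro power_increasing) auto
  then have "2 ^ (P - 1) \<le> norm (freq k)" using a by linarith
  then show ?thesis
    using a low_symbol_eq_0[of P k] low_symbol_eq_0[of "P - 1" k] by (cases "P = 0") (auto simp: block_symbol_def)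
qed

lemma block_symbol_outside: "k \<notin> modes P \<Longrightarrow> block_symbol chi P k = 0"
  using modesI[of k P] block_symbol_eq_0[of P k] by linarith

lemma eventually_low_symbol_eq_1: "eventually (\<lambda>Q. low_symbol chi Q k = 1 \<and> k \<in> modes Q) sequentially"
proof -
  obtain n where n: "2 * norm (freq k) < 2 ^ n" using real_arch_pow[of 2 "2 * norm (freq k)"] by auto
  show ?thesis
  proof (rule eventually_sequentiallyI[of n])
    fix Q assume "n \<le> Q"
    then have "(2::real) ^ n \<le> 2 ^ Q" by (intro power_increasing) auto
    with n have "norm (freq k) \<le> 2 ^ Q / 2" "norm (freq k) \<le> 2 ^ Q" using norm_ge_zero[of "freq k"] by linarith+
    then show "low_symbol chi Q k = 1 \<and> k \<in> modes Q" by (auto intro: low_symbol_eq_1 modesI)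
  qed
qed

lemma low_symbol_bounded: obtains B where "\<And>P k. \<bar>low_symbol chi P k\<bar> \<le> B"
proof -
  have "iter_deriv [] chi differentiable (at z)" for z
    using chi unfolding LP_cutoff_def smooth_def by (metis empty_set empty_subsetI)
  then have "continuous_on (cball 0 1) chi"
    by (auto intro!: continuous_at_imp_continuous_on differentiable_imp_continuous_within)
  then have "bounded (chi ` cball 0 1)"
    by (intro compact_imp_bounded compact_continuous_image compact_cball)
  then obtain B where B: "\<And>\<xi>. norm \<xi> \<le> 1 \<Longrightarrow> \<bar>chi \<xi>\<bar> \<le> B"
    by (force simp: bounded_iff)
  have "\<bar>chi \<xi>\<bar> \<le> max B 0" for \<xi>
  proof (cases "norm \<xi> \<le> 1")
    case True
    then show ?thesis using B[of \<xi>] by auto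
  next
    case False
    then have "chi \<xi> = 0" using chi unfolding LP_cutoff_def by (meson linear)
    then show ?thesis by simp
  qed
  then show ?thesis using that[of "max B 0"] unfolding low_symbol_def by blast
qed

lemma sum_block: "(\<Sum>P\<le>Q. block chi P f x) = low_part chi Q f x"
proof -
  have "block chi P f x = multiplier (block_symbol chi P) (modes Q) f x" if "P \<le> Q" for P
    unfolding block_def multiplier_def trig_def
  proof (rule sum.mono_neutral_left)
    have "(2::int) ^ P \<le> 2 ^ Q" using that by (intro power_increasing) auto
    then show "modes P \<subseteq> modes Q" by (auto simp: modes_def intro: order_trans)
  qed (auto simp: block_symbol_outside)
  then have "(\<Sum>P\<le>Q. block chi P f x) = (\<Sum>P\<le>Q. multiplier (block_symbol chi P) (modes Q) f x)" by simp
  also have "\<dots> = low_part chi Q f x"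
    unfolding low_part_def multiplier_def trig_def
    by (subst sum.swap) (simp only: sum_distrib_right[symmetric] sum_distrib_left[symmetric]
        of_real_sum[symmetric] sum_block_symbol)
  finally show ?thesis .
qed

lemma eventually_low_part_trigpoly:
  assumes "trigpoly p"
  shows "eventually (\<lambda>Q. low_part chi Q p = p) sequentially"
  using assms
proof (induction rule: trigpoly.induct)
  case (wave c k)
  have F: "fourier (\<lambda>x. c * wave k x) a = (if a = k then of_real (tvol TYPE('n)) * c else 0)" for a :: "int^'n"
    using fourier_trig[of "{k}" "\<lambda>_. c" a] by (simp add: trig_def[abs_def])
  show ?case
    using eventually_low_symbol_eq_1[of k]
  proof eventually_elim
    case (elim Q)
    show ?case
    proof
      fix x
      have "low_part chi Q (\<lambda>x. c * wave k x) x = (\<Sum>a\<in>modes Q. if a = k then c * wave k x else 0)"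
        unfolding low_part_def multiplier_def trig_def F using elim
        by (intro sum.cong) auto
      then show "low_part chi Q (\<lambda>x. c * wave k x) x = c * wave k x" using elim by simp
    qed
  qed
next
  case (add p q)
  from add.IH show ?case
    by eventually_elim (use add.hyps in \<open>auto simp: low_part_add sqint_trigpoly\<close>)
qed

lemma energy_low_part_le:
  obtains B where "B \<ge> 0" "\<And>f Q. sqint f \<Longrightarrow> energy (low_part chi Q f) \<le> B * energy f"
proof -
  obtain B where B: "\<And>P k. \<bar>low_symbol chi P k\<bar> \<le> B" using low_symbol_bounded by blast
  show ?thesis
    by (rule that[of "B\<^sup>2"]) (auto simp: low_part_def intro!: energy_multiplier_le B)
qed

text \<open>
  The low-frequency parts reproduce every trigonometric polynomial eventually and are bounded on \<open>L\<^sup>2\<close>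
  uniformly in \<open>Q\<close>, so the claim follows from density.
\<close>
lemma low_part_tendsto:
  assumes f: "sqint f"
  shows "(\<lambda>Q. energy (\<lambda>x. f x - low_part chi Q f x)) \<longlonglongrightarrow> 0"
proof (rule LIMSEQ_I)
  obtain B where B: "B \<ge> 0" "\<And>f Q. sqint f \<Longrightarrow> energy (low_part chi Q f) \<le> B * energy f"
    using energy_low_part_le by blast
  fix e :: real assume e: "e > 0"
  define d where "d = e / (2 + 2 * B)"
  have "2 + 2 * B \<noteq> 0" using B(1) by simp
  then have "d * (2 + 2 * B) = e" by (simp add: d_def)
  then have d2: "2 * d + 2 * (B * d) = e" by (simp add: distrib_left mult.left_commute mult.commute)
  have d: "d > 0" using e B(1) by (simp add: d_def)
  obtain p where p: "trigpoly p" "energy (\<lambda>x. f x - p x) < d"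
    using L2_approx[OF f d] by blast
  have sp: "sqint p" "sqint (\<lambda>x. f x - p x)" using p f by (auto intro: sqint_trigpoly sqint_diff)
  obtain N where N: "\<And>Q. Q \<ge> N \<Longrightarrow> low_part chi Q p = p"
    using eventually_low_part_trigpoly[OF p(1)] by (auto simp: eventually_sequentially)
  have "norm (energy (\<lambda>x. f x - low_part chi Q f x) - 0) < e" if "Q \<ge> N" for Q
  proof -
    have "(\<lambda>x. f x - low_part chi Q f x) = (\<lambda>x. (f x - p x) + (-1) * low_part chi Q (\<lambda>x. f x - p x) x)"
      using N[OF that] by (simp add: low_part_diff[OF f sp(1)])
    then have "energy (\<lambda>x. f x - low_part chi Q f x)
        \<le> 2 * energy (\<lambda>x. f x - p x) + 2 * energy (\<lambda>x. (-1) * low_part chi Q (\<lambda>x. f x - p x) x)"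
      using energy_add_le[OF sp(2) sqint_cmult[OF sqint_low_part, of "-1"]] by (simp only:)
    moreover have "energy (\<lambda>x. (-1) * low_part chi Q (\<lambda>x. f x - p x) x) = energy (low_part chi Q (\<lambda>x. f x - p x))"
      by (simp add: energy_def)
    moreover have "energy (low_part chi Q (\<lambda>x. f x - p x)) \<le> B * energy (\<lambda>x. f x - p x)"
      by (rule B(2)[OF sp(2)])
    moreover have "B * energy (\<lambda>x. f x - p x) \<le> B * d"
      using p(2) B(1) by (intro mult_left_mono) auto
    ultimately have "energy (\<lambda>x. f x - low_part chi Q f x) < e" using p(2) d2 by linarith
    then show ?thesis using energy_nonneg[of "\<lambda>x. f x - low_part chi Q f x"] by simp
  qed
  then show "\<exists>N. \<forall>Q\<ge>N. norm (energy (\<lambda>x. f x - low_part chi Q f x) - 0) < e" by blast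
qed

lemma fourier_mult_low_part_tendsto:
  assumes f: "sqint f" and g: "sqint g"
  shows "(\<lambda>Q. fourier (\<lambda>x. low_part chi Q f x * low_part chi Q g x) k) \<longlonglongrightarrow> fourier (\<lambda>x. f x * g x) k"
proof -
  obtain B where B: "B \<ge> 0" "\<And>f Q. sqint f \<Longrightarrow> energy (low_part chi Q f) \<le> B * energy f"
    using energy_low_part_le by blast
  let ?R = "\<lambda>Q. sqrt (energy (\<lambda>x. f x - low_part chi Q f x)) * sqrt (energy g)
      + sqrt (B * energy f) * sqrt (energy (\<lambda>x. g x - low_part chi Q g x))"
  have "(\<lambda>Q. fourier (\<lambda>x. f x * g x) k - fourier (\<lambda>x. low_part chi Q f x * low_part chi Q g x) k) \<longlonglongrightarrow> 0"
  proof (rule Lim_null_comparison)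
    have "?R \<longlonglongrightarrow> sqrt 0 * sqrt (energy g) + sqrt (B * energy f) * sqrt 0"
      by (intro tendsto_intros low_part_tendsto f g)
    then show "?R \<longlonglongrightarrow> 0" by simp
    have "norm (fourier (\<lambda>x. f x * g x) k - fourier (\<lambda>x. low_part chi Q f x * low_part chi Q g x) k) \<le> ?R Q" for Q
    proof -
      let ?f = "low_part chi Q f" and ?g = "low_part chi Q g"
      note s = sqint_low_part[of chi Q f] sqint_low_part[of chi Q g]
      note d = sqint_diff[OF f s(1)] sqint_diff[OF g s(2)]
      have "fourier (\<lambda>x. f x * g x) k - fourier (\<lambda>x. ?f x * ?g x) k
          = (LINT x|torus. f x * g x * wave (- k) x - ?f x * ?g x * wave (- k) x)"
        unfolding fourier_def
        by (rule Bochner_Integration.integral_diff[symmetric]) (intro sqint_mult_wave_integrable f g s)+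
      also have "\<dots> = (LINT x|torus. (f x - ?f x) * g x * wave (- k) x + ?f x * (g x - ?g x) * wave (- k) x)"
        by (intro Bochner_Integration.integral_cong) (auto simp: algebra_simps)
      also have "\<dots> = fourier (\<lambda>x. (f x - ?f x) * g x) k + fourier (\<lambda>x. ?f x * (g x - ?g x)) k"
        unfolding fourier_def
        by (rule Bochner_Integration.integral_add) (intro sqint_mult_wave_integrable f g s d)+
      finally have "norm (fourier (\<lambda>x. f x * g x) k - fourier (\<lambda>x. ?f x * ?g x) k)
          \<le> norm (fourier (\<lambda>x. (f x - ?f x) * g x) k) + norm (fourier (\<lambda>x. ?f x * (g x - ?g x)) k)"
        by (simp only: norm_triangle_ineq)
      also have "\<dots> \<le> sqrt (energy (\<lambda>x. f x - ?f x)) * sqrt (energy g)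
          + sqrt (energy ?f) * sqrt (energy (\<lambda>x. g x - ?g x))"
        by (intro add_mono norm_fourier_mult_le f g s d)
      also have "\<dots> \<le> ?R Q"
        by (intro add_mono mult_right_mono real_sqrt_le_mono B(2) f order_refl) (simp add: energy_nonneg)
      finally show ?thesis .
    qed
    then show "eventually (\<lambda>Q. norm (fourier (\<lambda>x. f x * g x) k - fourier (\<lambda>x. low_part chi Q f x * low_part chi Q g x) k) \<le> ?R Q) sequentially"
      by simp
  qed
  from tendsto_diff[OF tendsto_const this, of "fourier (\<lambda>x. f x * g x) k"] show ?thesis by simp
qed

text \<open>
  The product of two blocks has frequencies of size below \<open>2\<^sup>P + 2\<^sup>P\<^sup>'\<close>.
\<close>
lemma fourier_block_mult_eq_0:
  assumes "2 ^ P + 2 ^ P' \<le> norm (freq k)"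
  shows "fourier (\<lambda>x. block chi P f x * block chi P' g x) k = 0"
  unfolding block_def multiplier_def fourier_trig_mult
proof (intro sum.neutral ballI, goal_cases)
  case (1 a b)
  show ?case
  proof (cases "a + b = k")
    case True
    then have "norm (freq k) \<le> norm (freq a) + norm (freq b)"
      by (auto simp: freq_simps norm_triangle_ineq)
    with assms have "2 ^ P \<le> norm (freq a) \<or> 2 ^ P' \<le> norm (freq b)" by linarith
    then have "block_symbol chi P a = 0 \<or> block_symbol chi P' b = 0" by (auto simp: block_symbol_eq_0)
    then show ?thesis by auto
  qed simp
qed

end

section \<open>Bernstein and Hoelder estimates for a pair of blocks\<close>

text \<open>
  The bound \<open>\<parallel>g\<parallel>\<^sub>r \<le> L\<close> for a bounded scalar function, with the integral of \<open>|g|\<^sup>r\<close> taken in the reals. For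
  functions that are not integrable to the power \<open>r\<close> this reading would be wrong, and it is only used
  for bounded ones.
\<close>
definition Lr_le :: "ennreal \<Rightarrow> real \<Rightarrow> (real^'n \<Rightarrow> complex) \<Rightarrow> bool" where
  "Lr_le r L g \<longleftrightarrow> (if r = \<infinity> then AE x in torus. norm (g x) \<le> L
     else (LINT x|torus. norm (g x) powr enn2real r) \<le> L powr enn2real r)"

text \<open>Bounded measurable functions, scalar or vector-valued.\<close>
definition bounded_measurable :: "(real^'n \<Rightarrow> 'b::{real_normed_vector,second_countable_topology}) \<Rightarrow> bool" where
  "bounded_measurable g \<longleftrightarrow> g \<in> borel_measurable torus \<and> (\<exists>B. \<forall>x. norm (g x) \<le> B)"

lemma bounded_measurable_powr_integrable:
  fixes g :: "real^'n \<Rightarrow> 'b::{real_normed_vector,second_countable_topology}"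
  assumes "bounded_measurable g" "\<rho> \<ge> 0"
  shows "integrable torus (\<lambda>x. norm (g x) powr \<rho>)"
proof -
  from assms obtain B where g [measurable]: "g \<in> borel_measurable torus" and B: "\<And>x. norm (g x) \<le> B"
    by (auto simp: bounded_measurable_def)
  show ?thesis
  proof (rule bounded_integrable_torus)
    show "norm (norm (g x) powr \<rho>) \<le> B powr \<rho>" for x
      using B[of x] assms(2) by (auto intro!: powr_mono2)
  qed measurable
qed

lemma bounded_measurable_sqint: "bounded_measurable g \<Longrightarrow> sqint g"
  by (auto simp: bounded_measurable_def intro: sqint_bounded)

lemma norm_trig_le: "norm (trig K c x) \<le> (\<Sum>k\<in>K. norm (c k))"
  unfolding trig_def by (rule order_trans[OF norm_sum]) (simp add: norm_mult wave_simps)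

lemma bounded_measurable_trig: "bounded_measurable (trig K c)"
  unfolding bounded_measurable_def using norm_trig_le[of K c] sqintD(1)[OF sqint_trig] by blast

lemma enn2real_ge_1: "1 \<le> r \<Longrightarrow> r \<noteq> \<infinity> \<Longrightarrow> 1 \<le> enn2real r"
  using enn2real_mono[of 1 r] by (simp add: top.not_eq_extremum)

lemma Lr_norm_component:
  fixes G :: "real^'n \<Rightarrow> complex^'n"
  assumes G: "bounded_measurable G" and L: "L > 0" and r: "1 \<le> r" and le: "Lr_norm r G \<le> ennreal L"
  shows "Lr_le r L (\<lambda>x. G x $ l)"
proof (cases "r = \<infinity>")
  case True
  have [measurable]: "G \<in> borel_measurable torus" using G by (simp add: bounded_measurable_def)
  have "AE x in torus. ennreal (norm (G x)) \<le> esssup torus (\<lambda>x. ennreal (norm (G x)))"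
    by (rule esssup_AE)
  then have "AE x in torus. norm (G x $ l) \<le> L"
  proof eventually_elim
    case (elim x)
    with le True have "ennreal (norm (G x)) \<le> ennreal L" by (simp add: Lr_norm_def)
    then have "norm (G x) \<le> L" using L by simp
    then show ?case using Finite_Cartesian_Product.norm_nth_le[of "G x" l] by linarith
  qed
  then show ?thesis using True by (simp add: Lr_le_def)
next
  case False
  define \<rho> where "\<rho> = enn2real r"
  have \<rho>: "\<rho> \<ge> 1" using r False unfolding \<rho>_def by (rule enn2real_ge_1)
  define I where "I = (\<integral>\<^sup>+ x. ennreal (norm (G x) powr \<rho>) \<partial>torus)"
  have int: "integrable torus (\<lambda>x. norm (G x) powr \<rho>)"
    using G \<rho> by (intro bounded_measurable_powr_integrable) auto
  have I: "I = ennreal (LINT x|torus. norm (G x) powr \<rho>)"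
    unfolding I_def by (rule nn_integral_eq_integral[OF int]) auto
  then have eI: "enn2real I = (LINT x|torus. norm (G x) powr \<rho>)" by simp
  have "ennreal (enn2real I powr (1 / \<rho>)) \<le> ennreal L"
    using le False I by (simp add: Lr_norm_def \<rho>_def[symmetric] I_def[symmetric] Let_def split: if_splits)
  then have "enn2real I powr (1 / \<rho>) \<le> L" using L by simp
  then have "(enn2real I powr (1 / \<rho>)) powr \<rho> \<le> L powr \<rho>"
    using \<rho> by (intro powr_mono2) auto
  then have "(LINT x|torus. norm (G x) powr \<rho>) \<le> L powr \<rho>"
    using \<rho> eI by (simp add: powr_powr)
  moreover have "(LINT x|torus. norm (G x $ l) powr \<rho>) \<le> (LINT x|torus. norm (G x) powr \<rho>)"
  proof (rule integral_mono)
    have "continuous_on UNIV (\<lambda>v::complex^'n. v $ l)" by (intro continuous_intros)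
    then have "(\<lambda>v::complex^'n. v $ l) \<in> borel_measurable borel"
      by (rule borel_measurable_continuous_onI)
    moreover have "G \<in> borel_measurable torus" using G by (simp add: bounded_measurable_def)
    ultimately have "(\<lambda>x. G x $ l) \<in> borel_measurable torus"
      by (rule measurable_compose[rotated])
    moreover from G obtain B where "\<And>x. norm (G x) \<le> B" by (auto simp: bounded_measurable_def)
    then have "norm (G x $ l) \<le> B" for x
      using Finite_Cartesian_Product.norm_nth_le[of "G x" l] order_trans by blast
    ultimately have "bounded_measurable (\<lambda>x. G x $ l)" by (auto simp: bounded_measurable_def)
    then show "integrable torus (\<lambda>x. norm (G x $ l) powr \<rho>)"
      using \<rho> by (intro bounded_measurable_powr_integrable) auto
  next
    fix x
    show "norm (G x $ l) powr \<rho> \<le> norm (G x) powr \<rho>"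
      using \<rho> Finite_Cartesian_Product.norm_nth_le[of "G x" l] by (intro powr_mono2) auto
  qed (rule int)
  ultimately show ?thesis using False by (simp add: Lr_le_def \<rho>_def)
qed

lemma powr_le_one_plus:
  assumes "(a::real) \<ge> 0" "p \<le> q" "0 \<le> p"
  shows "a powr p \<le> 1 + a powr q"
proof (cases "a \<le> 1")
  case True
  then have "a powr p \<le> 1 powr p" using assms by (intro powr_mono2) auto
  then show ?thesis by (simp add: add_increasing2)
next
  case False
  then have "a powr p \<le> a powr q" using assms by (intro powr_mono) auto
  then show ?thesis by simp
qed

text \<open>
  The torus has finite measure, so a bound on the \<open>L\<^sup>r\<close> norm bounds the \<open>L\<^sup>p\<close> norms with \<open>1 \<le> p \<le> r\<close>. The
  pointwise inequality \<open>a\<^sup>p \<le> 1 + a\<^sup>r\<close> replaces Hoelder's inequality, at the price of a worse constant.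
\<close>
lemma Lr_le_powr:
  fixes g :: "real^'n \<Rightarrow> complex"
  assumes g: "bounded_measurable g" and L: "L > 0" and p: "1 \<le> p" "r = \<infinity> \<or> p \<le> enn2real r" and le: "Lr_le r L g"
  shows "(LINT x|torus. norm (g x) powr p) \<le> (tvol TYPE('n) + 1) * L powr p"
proof (cases "r = \<infinity>")
  case True
  have "(LINT x|torus. norm (g x) powr p) \<le> (LINT x|(torus :: (real^'n) measure). L powr p)"
  proof (rule integral_mono_AE)
    have "AE x in torus. norm (g x) \<le> L" using le True by (simp add: Lr_le_def)
    then show "AE x in torus. norm (g x) powr p \<le> L powr p"
      by eventually_elim (use p(1) in \<open>auto intro: powr_mono2\<close>)
  qed (use g p in \<open>auto intro!: bounded_measurable_powr_integrable\<close>)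
  also have "\<dots> = tvol TYPE('n) * L powr p" by (simp only: lebesgue_integral_const measure_torus real_scaleR_def)
  also have "\<dots> \<le> (tvol TYPE('n) + 1) * L powr p" by (intro mult_right_mono) auto
  finally show ?thesis .
next
  case False
  define \<rho> where "\<rho> = enn2real r"
  have \<rho>: "p \<le> \<rho>" using p False by (simp add: \<rho>_def)
  have le': "(LINT x|torus. norm (g x) powr \<rho>) \<le> L powr \<rho>" using le False by (simp add: Lr_le_def \<rho>_def)
  have int: "integrable torus (\<lambda>x. norm (g x) powr \<rho>)"
    using g \<rho> p by (intro bounded_measurable_powr_integrable) auto
  have "(LINT x|torus. norm (g x) powr p) \<le> (LINT x|torus. L powr p + L powr p * (norm (g x) powr \<rho> / L powr \<rho>))"
  proof (rule integral_mono)
    fix x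
    have "(norm (g x) / L) powr p \<le> 1 + (norm (g x) / L) powr \<rho>"
      using L p \<rho> by (intro powr_le_one_plus) auto
    then have "norm (g x) powr p / L powr p \<le> 1 + norm (g x) powr \<rho> / L powr \<rho>"
      using L by (simp add: powr_divide)
    then show "norm (g x) powr p \<le> L powr p + L powr p * (norm (g x) powr \<rho> / L powr \<rho>)"
      using L by (simp add: divide_le_eq algebra_simps)
  qed (use g p int in \<open>auto intro!: bounded_measurable_powr_integrable\<close>)
  also have "\<dots> = tvol TYPE('n) * L powr p + L powr p * ((LINT x|torus. norm (g x) powr \<rho>) / L powr \<rho>)"
    using int measure_torus[where 'n = 'n] by simp
  also have "\<dots> \<le> tvol TYPE('n) * L powr p + L powr p * 1"
    using le' L by (intro add_left_mono mult_left_mono) (auto simp: divide_le_eq)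
  finally show ?thesis by (simp add: algebra_simps)
qed

lemma Lr_le_integral_norm:
  fixes g :: "real^'n \<Rightarrow> complex"
  assumes g: "bounded_measurable g" and L: "L > 0" and r: "1 \<le> r" and le: "Lr_le r L g"
  shows "(LINT x|torus. norm (g x)) \<le> (tvol TYPE('n) + 1) * L"
  using Lr_le_powr[OF g L, of 1 r] enn2real_ge_1[OF r] le L by auto

text \<open>
  Bernstein's inequality from \<open>L\<^sup>\<rho>\<close> to \<open>L\<^sup>\<infinity>\<close> for \<open>1 \<le> \<rho> \<le> 2\<close>. Let \<open>M\<close> be the maximum of \<open>|g|\<close>. The
  Cauchy-Schwarz inequality for the coefficients bounds \<open>M\<^sup>2\<close> by the number of frequencies times the
  mean of \<open>|g|\<^sup>2\<close>, and \<open>|g|\<^sup>2 \<le> M\<^sup>2\<^sup>-\<^sup>\<rho> |g|\<^sup>\<rho>\<close> allows \<open>M\<^sup>2\<^sup>-\<^sup>\<rho>\<close> to be cancelled.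
\<close>
lemma trig_sup_le:
  fixes c :: "int^'n \<Rightarrow> complex"
  assumes \<rho>: "1 \<le> \<rho>" "\<rho> \<le> 2" and L: "L > 0"
    and le: "(LINT x|torus. norm (trig (modes P) c x) powr \<rho>) \<le> L powr \<rho>"
    and x: "x \<in> cbox 0 (\<chi> i. 2 * pi)"
  shows "norm (trig (modes P) c x) \<le> (2 ^ P) powr (real CARD('n) / \<rho>) * L"
proof -
  let ?Q = "cbox 0 (\<chi> i. 2 * pi) :: (real^'n) set"
  let ?g = "trig (modes P) c"
  define V where "V = tvol TYPE('n)"
  have V: "V > 0" by (simp add: V_def)
  have "continuous_on ?Q (\<lambda>x. norm (?g x))"
    unfolding trig_def by (intro continuous_intros)
  from continuous_attains_sup[OF compact_cbox _ this] x
  obtain x0 where x0: "x0 \<in> ?Q" "\<And>y. y \<in> ?Q \<Longrightarrow> norm (?g y) \<le> norm (?g x0)" by blast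
  define M where "M = norm (?g x0)"
  have "M \<le> (2 ^ P) powr (real CARD('n) / \<rho>) * L"
  proof (cases "M = 0")
    case True
    then show ?thesis using L by simp
  next
    case False
    then have M: "M > 0" by (simp add: M_def)
    have "M \<le> (\<Sum>k\<in>modes P. norm (c k) * 1)" unfolding M_def using norm_trig_le[of "modes P" c x0] by simp
    then have "M\<^sup>2 \<le> (\<Sum>k\<in>modes P. norm (c k) * 1)\<^sup>2" using M by (intro power_mono) auto
    also have "\<dots> \<le> (\<Sum>k\<in>modes P. (norm (c k))\<^sup>2) * (\<Sum>k\<in>(modes P :: (int^'n) set). 1\<^sup>2)"
      by (rule Cauchy_Schwarz_ineq_sum)
    also have "\<dots> = energy ?g / V * real (card (modes P :: (int^'n) set))"
      unfolding energy_trig[OF finite_modes] V_def[symmetric] using V by simp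
    also have "\<dots> \<le> energy ?g / V * (3 * 2 ^ P) ^ CARD('n)"
      using V by (intro mult_left_mono card_modes_le) (simp add: energy_nonneg)
    \<comment> \<open>Since \<open>3 \<le> 2\<pi>\<close>, the volume of the torus absorbs the constant in the number of frequencies.\<close>
    also have "\<dots> \<le> energy ?g / V * (2 * pi * 2 ^ P) ^ CARD('n)"
      using V pi_gt3 by (intro mult_left_mono power_mono mult_right_mono) (auto simp: energy_nonneg)
    also have "\<dots> = energy ?g * (2 ^ P) ^ CARD('n)"
      using V by (simp add: V_def power_mult_distrib)
    also have "energy ?g \<le> M powr (2 - \<rho>) * (LINT x|torus. norm (?g x) powr \<rho>)"
    proof -
      have "energy ?g \<le> (LINT x|torus. M powr (2 - \<rho>) * norm (?g x) powr \<rho>)"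
        unfolding energy_def
      proof (rule integral_mono)
        fix y :: "real^'n" assume "y \<in> space torus"
        then have y: "norm (?g y) \<le> M" using x0(2) by (simp add: space_torus M_def)
        show "(norm (?g y))\<^sup>2 \<le> M powr (2 - \<rho>) * norm (?g y) powr \<rho>"
        proof (cases "?g y = 0")
          case False
          then have "(norm (?g y))\<^sup>2 = norm (?g y) powr (2 - \<rho>) * norm (?g y) powr \<rho>"
            by (simp add: powr_add[symmetric])
          also have "\<dots> \<le> M powr (2 - \<rho>) * norm (?g y) powr \<rho>"
            using y \<rho> by (intro mult_right_mono powr_mono2) auto
          finally show ?thesis .
        qed simp
      qed (use \<rho> in \<open>auto intro!: bounded_measurable_powr_integrable bounded_measurable_trig sqintD sqint_trig\<close>)
      then show ?thesis by simp
    qed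
    then have "energy ?g * (2 ^ P) ^ CARD('n) \<le> M powr (2 - \<rho>) * L powr \<rho> * (2 ^ P) ^ CARD('n)"
      using mult_left_mono[OF le, of "M powr (2 - \<rho>)"] by (intro mult_right_mono) auto
    finally have "M\<^sup>2 \<le> M powr (2 - \<rho>) * (L powr \<rho> * (2 ^ P) ^ CARD('n))" by (simp add: mult.assoc)
    moreover have "M\<^sup>2 = M powr (2 - \<rho>) * M powr \<rho>"
      using M by (simp add: powr_add[symmetric])
    ultimately have "M powr \<rho> \<le> L powr \<rho> * (2 ^ P) ^ CARD('n)"
      using M by (simp add: mult_le_cancel_left)
    then have "(M powr \<rho>) powr (1 / \<rho>) \<le> (L powr \<rho> * (2 ^ P) ^ CARD('n)) powr (1 / \<rho>)"
      using \<rho> by (intro powr_mono2) auto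
    moreover have "(M powr \<rho>) powr (1 / \<rho>) = M" "(L powr \<rho>) powr (1 / \<rho>) = L"
      using M L \<rho> by (simp_all add: powr_powr)
    moreover have "((2 ^ P) ^ CARD('n)) powr (1 / \<rho>) = ((2::real) ^ P) powr (real CARD('n) / \<rho>)"
      by (simp add: powr_powr powr_realpow[symmetric])
    ultimately show ?thesis by (simp add: powr_mult mult.commute)
  qed
  then show ?thesis using x0(2)[OF x] unfolding M_def by linarith
qed

text \<open>
  This pointwise inequality plays the role of Hoelder's inequality for a factor \<open>G\<close> bounded by \<open>S\<close>: in each
  of the cases \<open>G \<le> F\<close> and \<open>F < G\<close> the product is at most \<open>G\<^sup>2\<^sup>-\<^sup>\<rho>\<close> times the larger of \<open>F\<^sup>\<rho>\<close> and \<open>G\<^sup>\<rho>\<close>.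
\<close>
lemma mult_le_powr_sum:
  assumes "0 \<le> F" "0 \<le> G" "G \<le> S" "1 \<le> \<rho>" "\<rho> \<le> (2::real)"
  shows "F * G \<le> S powr (2 - \<rho>) * (F powr \<rho> + G powr \<rho>)"
proof (cases "F = 0 \<or> G = 0")
  case False
  then have FG: "F > 0" "G > 0" using assms by auto
  have S: "G powr (2 - \<rho>) \<le> S powr (2 - \<rho>)" using assms by (intro powr_mono2) auto
  show ?thesis
  proof (cases "G \<le> F")
    case True
    have "F * G = F powr \<rho> * (F powr (1 - \<rho>) * G)" using FG by (simp add: powr_diff)
    also have "\<dots> \<le> F powr \<rho> * (G powr (1 - \<rho>) * G)"
      using FG True assms by (intro mult_left_mono mult_right_mono powr_mono2') auto
    also have "G powr (1 - \<rho>) * G = G powr (2 - \<rho>)"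
      using FG by (simp add: powr_diff power2_eq_square)
    also have "F powr \<rho> * G powr (2 - \<rho>) \<le> F powr \<rho> * S powr (2 - \<rho>)" using S by (intro mult_left_mono) auto
    also have "\<dots> \<le> S powr (2 - \<rho>) * (F powr \<rho> + G powr \<rho>)" by (simp add: algebra_simps)
    finally show ?thesis .
  next
    case False
    then have "F * G \<le> G * G" using FG by (intro mult_right_mono) auto
    also have "\<dots> = G powr (2 - \<rho>) * G powr \<rho>" using FG by (simp add: powr_add[symmetric] power2_eq_square)
    also have "\<dots> \<le> S powr (2 - \<rho>) * G powr \<rho>" using S by (intro mult_right_mono) auto
    also have "\<dots> \<le> S powr (2 - \<rho>) * (F powr \<rho> + G powr \<rho>)" by (simp add: algebra_simps)
    finally show ?thesis .
  qed
qed auto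

text \<open>
  The exponent lost in the product estimate: \<open>n(2/r - 1)\<close> for \<open>r \<le> 2\<close>, and zero for \<open>r > 2\<close>. The
  regularity assumption of the theorem implies \<open>loss < s\<close>.
\<close>
definition loss :: "'n itself \<Rightarrow> ennreal \<Rightarrow> real" where
  "loss (_ :: 'n itself) r = (if r \<le> 2 then real CARD('n) * (2 / enn2real r - 1) else 0)"

text \<open>
  Only the frequencies of the second factor enter the bound, so that in a product of two blocks the
  loss can be charged to the block of lower frequency.
\<close>
lemma bilinear_Lr:
  fixes f :: "real^'n \<Rightarrow> complex" and c :: "int^'n \<Rightarrow> complex"
  assumes r: "1 \<le> r" and L: "L > 0" "L' > 0" and f: "bounded_measurable f" "Lr_le r L f"
    and g: "Lr_le r L' (trig (modes P) c)"
  shows "(LINT x|torus. norm (f x) * norm (trig (modes P) c x))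
    \<le> (tvol TYPE('n) + 1) * (2 ^ P) powr loss TYPE('n) r * (L * L')"
proof -
  let ?g = "trig (modes P) c"
  define V where "V = tvol TYPE('n)"
  have V: "V \<ge> 1"
  proof -
    have "1 ^ CARD('n) \<le> V" unfolding V_def using pi_gt3 by (intro power_mono) auto
    then show ?thesis by simp
  qed
  have g': "bounded_measurable ?g" by (rule bounded_measurable_trig)
  show ?thesis
  proof (cases "r \<le> 2")
    case False
    have r2: "r = \<infinity> \<or> 2 \<le> enn2real r"
    proof (cases "r = \<infinity>")
      case False
      then show ?thesis using \<open>\<not> r \<le> 2\<close> enn2real_mono[of 2 r] by (simp add: top.not_eq_extremum)
    qed simp
    have en: "energy h \<le> (V + 1) * K\<^sup>2" if "bounded_measurable h" "K > 0" "Lr_le r K h" for h :: "real^'n \<Rightarrow> complex" and K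
    proof -
      have "energy h = (LINT x|torus. norm (h x) powr 2)"
        unfolding energy_def by (intro Bochner_Integration.integral_cong) auto
      also have "\<dots> \<le> (V + 1) * K powr 2"
        unfolding V_def using Lr_le_powr[OF that(1,2) _ r2 that(3)] by simp
      finally show ?thesis using that(2) by simp
    qed
    have "(LINT x|torus. norm (f x) * norm (?g x)) \<le> sqrt (energy f) * sqrt (energy ?g)"
      by (intro Cauchy_Schwarz_torus bounded_measurable_sqint f g')
    also have "\<dots> \<le> sqrt ((V + 1) * L\<^sup>2) * sqrt ((V + 1) * L'\<^sup>2)"
      using en[OF f(1) L(1) f(2)] en[OF g' L(2) g] V
      by (intro mult_mono real_sqrt_le_mono) (auto simp: energy_nonneg)
    also have "\<dots> = (V + 1) * (L * L')"
      using L V by (simp add: real_sqrt_mult)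
    finally show ?thesis using False by (simp add: loss_def V_def)
  next
    case True
    define \<rho> where "\<rho> = enn2real r"
    have rf: "r \<noteq> \<infinity>" using True by (auto simp: top_unique)
    have \<rho>: "1 \<le> \<rho>" "\<rho> \<le> 2"
      using enn2real_ge_1[OF r rf] True enn2real_mono[of r 2] by (auto simp: \<rho>_def)
    define S where "S = ((2::real) ^ P) powr (real CARD('n) / \<rho>)"
    have S: "S powr (2 - \<rho>) = (2 ^ P) powr loss TYPE('n) r"
      using True \<rho> unfolding S_def loss_def \<rho>_def[symmetric] by (simp add: powr_powr field_simps)
    have fi: "integrable torus (\<lambda>x. norm (f x) powr \<rho>)" "integrable torus (\<lambda>x. norm (?g x) powr \<rho>)"
      using f g' \<rho> by (auto intro: bounded_measurable_powr_integrable)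
    have fl: "(LINT x|torus. norm (f x) powr \<rho>) \<le> L powr \<rho>" "(LINT x|torus. norm (?g x) powr \<rho>) \<le> L' powr \<rho>"
      using f g rf by (auto simp: Lr_le_def \<rho>_def)
    have "(LINT x|torus. norm (f x) * norm (?g x)) \<le>
      (LINT x|torus. L * L' * S powr (2 - \<rho>) * (norm (f x) powr \<rho> / L powr \<rho> + norm (?g x) powr \<rho> / L' powr \<rho>))"
    proof (rule integral_mono)
      fix x :: "real^'n" assume "x \<in> space torus"
      then have "norm (?g x) \<le> S * L'"
        unfolding S_def using trig_sup_le[OF \<rho> L(2) fl(2)] by (simp add: space_torus)
      then have "norm (?g x) / L' \<le> S" using L by (simp add: divide_le_eq)
      then have "norm (f x) / L * (norm (?g x) / L') \<le> S powr (2 - \<rho>) * ((norm (f x) / L) powr \<rho> + (norm (?g x) / L') powr \<rho>)"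
        using L \<rho> by (intro mult_le_powr_sum) auto
      then have "(L * L') * (norm (f x) / L * (norm (?g x) / L')) \<le> (L * L') * (S powr (2 - \<rho>) * ((norm (f x) / L) powr \<rho> + (norm (?g x) / L') powr \<rho>))"
        using L by (intro mult_left_mono) auto
      then show "norm (f x) * norm (?g x) \<le> L * L' * S powr (2 - \<rho>) * (norm (f x) powr \<rho> / L powr \<rho> + norm (?g x) powr \<rho> / L' powr \<rho>)"
        using L by (simp add: powr_divide)
    qed (use fi in \<open>auto intro!: sqint_mult_norm bounded_measurable_sqint f g'\<close>)
    also have "\<dots> = L * L' * S powr (2 - \<rho>) * ((LINT x|torus. norm (f x) powr \<rho>) / L powr \<rho> + (LINT x|torus. norm (?g x) powr \<rho>) / L' powr \<rho>)"
      using fi by simp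
    also have "\<dots> \<le> L * L' * S powr (2 - \<rho>) * (1 + 1)"
      using fl L by (intro mult_left_mono add_mono) (auto simp: divide_le_eq)
    also have "\<dots> \<le> L * L' * S powr (2 - \<rho>) * (V + 1)"
      using V L by (intro mult_left_mono) auto
    finally show ?thesis by (simp add: S V_def ac_simps)
  qed
qed

section \<open>Fourier coefficients of functions with small Besov norm\<close>

lemma LP_proj_component:
  fixes chi :: "real^'n \<Rightarrow> real" and w :: "real^'n \<Rightarrow> real^'n"
  assumes chi: "LP_cutoff chi"
  shows "LP_proj chi (int P - 1) w x $ l = block chi P (\<lambda>x. of_real (w x $ l)) x" (is ?thesis1)
    and "bounded_measurable (LP_proj chi (int P - 1) w)" (is ?thesis2)
proof -
  define a where "a k = (\<chi> j. fourier_coeff w k $ j * of_real (block_symbol chi P k))" for k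
  have LP: "LP_proj chi (int P - 1) w x = (\<Sum>k\<in>modes P. \<chi> j. a k $ j * wave k x)" for x
  proof -
    have "LP_proj chi (int P - 1) w x = infsum (\<lambda>k. \<chi> j. a k $ j * wave k x) UNIV"
      by (simp add: LP_proj_def LP_symbol_eq_block_symbol a_def wave_def)
    also have "\<dots> = infsum (\<lambda>k. \<chi> j. a k $ j * wave k x) (modes P)"
      by (rule infsum_cong_neutral) (auto simp: a_def block_symbol_outside[OF chi] vec_eq_iff)
    finally show ?thesis by simp
  qed
  show ?thesis1
    unfolding LP
    by (simp add: block_def multiplier_def trig_def a_def fourier_coeff_def fourier_def wave_def freq_simps)
  have "norm (LP_proj chi (int P - 1) w x) \<le> (\<Sum>k\<in>modes P. norm (a k))" for x
  proof -
    have "norm (LP_proj chi (int P - 1) w x) \<le> (\<Sum>k\<in>modes P. norm (\<chi> j. a k $ j * wave k x))"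
      unfolding LP by (rule norm_sum)
    also have "\<dots> = (\<Sum>k\<in>modes P. norm (a k))"
      by (simp add: norm_vec_def norm_mult wave_simps)
    finally show ?thesis .
  qed
  moreover have "LP_proj chi (int P - 1) w \<in> borel_measurable torus"
    by (intro continuous_measurable_torus) (auto simp: LP[abs_def] intro!: continuous_intros)
  ultimately show ?thesis2 by (auto simp: bounded_measurable_def)
qed

text \<open>
  The scalar form of smallness in the Besov space: \<open>f\<close> is square-integrable and the \<open>L\<^sup>r\<close> norm of its
  block \<open>P\<close> is at most \<open>D 2\<^sup>-\<^sup>s\<^sup>P\<close>.
\<close>
definition blocks_le :: "(real^'n \<Rightarrow> real) \<Rightarrow> real \<Rightarrow> ennreal \<Rightarrow> real \<Rightarrow> (real^'n \<Rightarrow> complex) \<Rightarrow> bool" where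
  "blocks_le chi s r D f \<longleftrightarrow> sqint f \<and> (\<forall>P. Lr_le r (D * (2 powr - s) ^ P) (block chi P f))"

text \<open>The factor \<open>2\<^sup>s\<close> comes from the shift of the index by one between blocks and projections.\<close>
lemma besov_norm_imp_blocks_le:
  fixes chi :: "real^'n \<Rightarrow> real" and w :: "real^'n \<Rightarrow> real^'n"
  assumes chi: "LP_cutoff chi" and r: "1 \<le> r" and d: "\<delta> > 0"
    and w: "besov_norm chi s r w \<le> ennreal \<delta>" and sq: "sqint (\<lambda>x. of_real (w x $ l))"
  shows "blocks_le chi s r (\<delta> * 2 powr s) (\<lambda>x. of_real (w x $ l))"
  unfolding blocks_le_def
proof (intro conjI allI sq)
  fix P
  define q where "q = int P - 1"
  have lamq: "lam q powr s = 2 powr (real P * s) / 2 powr s"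
  proof -
    have e: "lam q = 2 powr (real P - 1)"
      by (simp add: lam_def q_def power_int_diff powr_diff powr_realpow)
    show ?thesis unfolding e powr_powr by (simp add: left_diff_distrib powr_diff)
  qed
  have "ennreal (lam q powr s) * Lr_norm r (LP_proj chi q w) \<le> besov_norm chi s r w"
    unfolding besov_norm_def by (rule SUP_upper) (simp add: q_def)
  with w have *: "ennreal (lam q powr s) * Lr_norm r (LP_proj chi q w) \<le> ennreal \<delta>" by (rule order_trans[rotated])
  have pos: "lam q powr s > 0" unfolding lamq by simp
  have "Lr_norm r (LP_proj chi q w) \<le> ennreal (\<delta> / lam q powr s)"
  proof (cases "Lr_norm r (LP_proj chi q w)")
    case (real y)
    with * pos d have "lam q powr s * y \<le> \<delta>" by (simp add: ennreal_mult'[symmetric])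
    then have "y \<le> \<delta> / lam q powr s" using pos by (simp add: pos_le_divide_eq mult.commute)
    then show ?thesis using real by (simp add: ennreal_leI)
  next
    case top
    with * pos show ?thesis by (simp add: ennreal_mult_top top_unique)
  qed
  also have "\<delta> / lam q powr s = \<delta> * 2 powr s * (2 powr - s) ^ P"
    by (simp add: lamq powr_minus powr_powr[symmetric] powr_realpow[symmetric] field_simps powr_power)
  finally have "Lr_norm r (LP_proj chi q w) \<le> ennreal (\<delta> * 2 powr s * (2 powr - s) ^ P)" .
  from Lr_norm_component[OF LP_proj_component(2)[OF chi] _ r this[unfolded q_def], of l] d
  show "Lr_le r (\<delta> * 2 powr s * (2 powr - s) ^ P) (block chi P (\<lambda>x. of_real (w x $ l)))"
    by (simp add: LP_proj_component(1)[OF chi])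
qed

lemma geometric_tail_le:
  assumes "0 \<le> b" "b < (1::real)"
  shows "(\<Sum>P\<le>Q. if q \<le> P then b ^ P else 0) \<le> b ^ q / (1 - b)"
proof -
  have "(1 - b) * (\<Sum>P\<le>Q. if q \<le> P then b ^ P else 0) + (if q \<le> Q then b ^ Suc Q else b ^ q) = b ^ q"
    by (induction Q) (auto simp: algebra_simps not_le le_Suc_eq)
  moreover have "0 \<le> (if q \<le> Q then b ^ Suc Q else b ^ q)" using assms by simp
  ultimately have "(1 - b) * (\<Sum>P\<le>Q. if q \<le> P then b ^ P else 0) \<le> b ^ q" by linarith
  then show ?thesis using assms by (simp add: field_simps)
qed

lemma norm_fourier_le: "norm (fourier f k) \<le> (LINT x|torus. norm (f x))"
  unfolding fourier_def by (rule order_trans[OF integral_norm_bound]) (simp add: norm_mult wave_simps)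

lemma bounded_measurable_block: "bounded_measurable (block chi P f)"
  by (simp add: block_def multiplier_def bounded_measurable_trig)

text \<open>
  Only blocks \<open>P \<ge> p\<close> see a frequency of size at least \<open>2\<^sup>p\<close>; for \<open>p = 0\<close> every block is allowed.
\<close>
lemma norm_fourier_le_of_blocks:
  fixes chi :: "real^'n \<Rightarrow> real"
  assumes chi: "LP_cutoff chi" and r: "1 \<le> r" and s: "s > 0" and D: "D > 0" and f: "blocks_le chi s r D f"
    and p: "p = 0 \<or> 2 ^ p \<le> norm (freq k)"
  shows "norm (fourier f k) \<le> (tvol TYPE('n) + 1) / (1 - 2 powr - s) * (D * (2 powr - s) ^ p)"
proof -
  define b where "b = 2 powr - s"
  have b: "0 < b" "b < 1" using s by (auto simp: b_def powr_less_one)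
  define W where "W = tvol TYPE('n) + 1"
  have W: "W > 0" unfolding W_def by (intro add_pos_pos) auto
  obtain Q where Q: "low_symbol chi Q k = 1"
    using eventually_low_symbol_eq_1[OF chi, of k] by (auto simp: eventually_sequentially)
  have block: "fourier (block chi P f) k = of_real (block_symbol chi P k) * fourier f k" for P
    unfolding block_def multiplier_def fourier_trig[OF finite_modes]
    by (auto simp: block_symbol_outside[OF chi])
  have "fourier f k = (\<Sum>P\<le>Q. fourier (block chi P f) k)"
    unfolding block sum_distrib_right[symmetric] of_real_sum[symmetric] sum_block_symbol Q by simp
  then have "norm (fourier f k) \<le> (\<Sum>P\<le>Q. norm (fourier (block chi P f) k))" by (metis norm_sum)
  also have "\<dots> \<le> (\<Sum>P\<le>Q. W * D * (if p \<le> P then b ^ P else 0))"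
  proof (rule sum_mono)
    fix P
    show "norm (fourier (block chi P f) k) \<le> W * D * (if p \<le> P then b ^ P else 0)"
    proof (cases "p \<le> P")
      case True
      have "norm (fourier (block chi P f) k) \<le> (LINT x|torus. norm (block chi P f x))"
        by (rule norm_fourier_le)
      also have "\<dots> \<le> W * (D * b ^ P)"
        unfolding W_def using f D b r
        by (intro Lr_le_integral_norm bounded_measurable_block) (auto simp: blocks_le_def b_def)
      finally show ?thesis using True by (simp add: mult.assoc)
    next
      case False
      have "(2::real) ^ P \<le> 2 ^ p" using False by (intro power_increasing) auto
      moreover have "2 ^ p \<le> norm (freq k)" using p False by auto
      ultimately have "2 ^ P \<le> norm (freq k)" by linarith
      then show ?thesis using False by (simp add: block block_symbol_eq_0[OF chi])
    qed
  qed
  also have "\<dots> \<le> W * D * (b ^ p / (1 - b))"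
    unfolding sum_distrib_left[symmetric] using W D b by (intro mult_left_mono geometric_tail_le) auto
  finally show ?thesis by (simp add: W_def b_def)
qed

text \<open>
  For \<open>P' \<le> P\<close> the product of the two blocks reaches frequencies of size \<open>2\<^sup>q\<close> only if \<open>q \<le> P\<close>.
\<close>
lemma norm_fourier_block_mult_le:
  fixes chi :: "real^'n \<Rightarrow> real"
  assumes chi: "LP_cutoff chi" and r: "1 \<le> r" and D: "D > 0"
    and f: "blocks_le chi s r D f" and g: "blocks_le chi s r D g" and q: "2 ^ q \<le> norm (freq k)" and le: "P' \<le> P"
  shows "norm (fourier (\<lambda>x. block chi P f x * block chi P' g x) k) \<le>
    (tvol TYPE('n) + 1) * D\<^sup>2 * ((if q \<le> P then (2 powr - s) ^ P else 0) * (2 powr (loss TYPE('n) r - s)) ^ P')"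
proof (cases "q \<le> P")
  case False
  have "(2::real) ^ P \<le> 2 ^ (q - 1)" "(2::real) ^ P' \<le> 2 ^ (q - 1)"
    using False le by (auto intro: power_increasing)
  moreover have "2 ^ (q - 1) + 2 ^ (q - 1) = (2::real) ^ q" using False by (cases q) auto
  ultimately have "2 ^ P + 2 ^ P' \<le> norm (freq k)" using q by linarith
  from fourier_block_mult_eq_0[OF chi this] show ?thesis using False by simp
next
  case True
  have "norm (fourier (\<lambda>x. block chi P f x * block chi P' g x) k) \<le> (LINT x|torus. norm (block chi P f x) * norm (block chi P' g x))"
    by (rule order_trans[OF norm_fourier_le]) (simp add: norm_mult)
  also have "\<dots> \<le> (tvol TYPE('n) + 1) * (2 ^ P') powr loss TYPE('n) r * ((D * (2 powr - s) ^ P) * (D * (2 powr - s) ^ P'))"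
  proof -
    have "Lr_le r (D * (2 powr - s) ^ P') (block chi P' g)" "Lr_le r (D * (2 powr - s) ^ P) (block chi P f)"
      using f g by (auto simp: blocks_le_def)
    then show ?thesis
      unfolding block_def[of chi P'] multiplier_def
      using D by (intro bilinear_Lr r bounded_measurable_block) auto
  qed
  also have "(2 ^ P') powr loss TYPE('n) r = ((2::real) powr loss TYPE('n) r) ^ P'"
    by (simp add: powr_realpow[symmetric] powr_powr powr_power mult.commute)
  also have "(2::real) powr loss TYPE('n) r = 2 powr (loss TYPE('n) r - s) / 2 powr - s"
    by (simp add: powr_diff[symmetric])
  also have "(tvol TYPE('n) + 1) * (2 powr (loss TYPE('n) r - s) / 2 powr - s) ^ P' * ((D * (2 powr - s) ^ P) * (D * (2 powr - s) ^ P'))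
      = (tvol TYPE('n) + 1) * D\<^sup>2 * ((2 powr - s) ^ P * (2 powr (loss TYPE('n) r - s)) ^ P')"
    by (simp add: power_divide power2_eq_square)
  finally show ?thesis using True by simp
qed

text \<open>
  The quadratic estimate: at frequencies of size at least \<open>2\<^sup>q\<close>, the product \<open>f g\<close> has Fourier
  coefficients of the same order \<open>2\<^sup>-\<^sup>s\<^sup>q\<close> as \<open>f\<close> and \<open>g\<close> themselves.
\<close>
lemma norm_fourier_mult_le_of_blocks:
  fixes chi :: "real^'n \<Rightarrow> real"
  assumes chi: "LP_cutoff chi" and r: "1 \<le> r" and s: "s > 0" "loss TYPE('n) r < s" and D: "D > 0"
    and f: "blocks_le chi s r D f" and g: "blocks_le chi s r D g" and q: "2 ^ q \<le> norm (freq k)"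
  shows "norm (fourier (\<lambda>x. f x * g x) k) \<le>
    2 * (tvol TYPE('n) + 1) / ((1 - 2 powr - s) * (1 - 2 powr (loss TYPE('n) r - s))) * (D\<^sup>2 * (2 powr - s) ^ q)"
    (is "_ \<le> ?C")
proof -
  \<comment> \<open>Geometric ratios: \<open>b\<close> for the high block, \<open>c\<close> for the low block after the Bernstein loss.\<close>
  define b where "b = 2 powr - s"
  have b: "0 < b" "b < 1" using s by (auto simp: b_def powr_less_one)
  define c where "c = 2 powr (loss TYPE('n) r - s)"
  have c: "0 < c" "c < 1" using s by (auto simp: c_def powr_less_one)
  define W where "W = tvol TYPE('n) + 1"
  have W: "W > 0" unfolding W_def by (intro add_pos_pos) auto
  let ?u = "\<lambda>P. if q \<le> P then b ^ P else 0"
  have bound: "norm (fourier (\<lambda>x. low_part chi Q f x * low_part chi Q g x) k) \<le> ?C" for Q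
  proof -
    note int = sqint_mult_wave_integrable[OF sqint_block sqint_block]
    have "fourier (\<lambda>x. low_part chi Q f x * low_part chi Q g x) k
      = (LINT x|torus. (\<Sum>P\<le>Q. \<Sum>P'\<le>Q. block chi P f x * block chi P' g x * wave (- k) x))"
      unfolding fourier_def sum_block[OF chi, symmetric] sum_product
      by (simp only: sum_distrib_right)
    also have "\<dots> = (\<Sum>P\<le>Q. LINT x|torus. (\<Sum>P'\<le>Q. block chi P f x * block chi P' g x * wave (- k) x))"
      by (intro Bochner_Integration.integral_sum Bochner_Integration.integrable_sum int)
    also have "\<dots> = (\<Sum>P\<le>Q. \<Sum>P'\<le>Q. fourier (\<lambda>x. block chi P f x * block chi P' g x) k)"
      unfolding fourier_def by (intro sum.cong refl Bochner_Integration.integral_sum int)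
    finally have "norm (fourier (\<lambda>x. low_part chi Q f x * low_part chi Q g x) k)
      \<le> (\<Sum>P\<le>Q. \<Sum>P'\<le>Q. norm (fourier (\<lambda>x. block chi P f x * block chi P' g x) k))"
      by (auto intro!: order_trans[OF norm_sum] sum_mono)
    also have "\<dots> \<le> (\<Sum>P\<le>Q. \<Sum>P'\<le>Q. W * D\<^sup>2 * (?u P * c ^ P' + c ^ P * ?u P'))"
    proof (intro sum_mono)
      fix P P'
      have nn: "0 \<le> W * D\<^sup>2 * (?u P * c ^ P')" "0 \<le> W * D\<^sup>2 * (c ^ P * ?u P')"
        using W b c by auto
      show "norm (fourier (\<lambda>x. block chi P f x * block chi P' g x) k) \<le> W * D\<^sup>2 * (?u P * c ^ P' + c ^ P * ?u P')"
      proof (cases "P' \<le> P")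
        case True
        have "norm (fourier (\<lambda>x. block chi P f x * block chi P' g x) k) \<le> W * D\<^sup>2 * (?u P * c ^ P')"
          unfolding W_def b_def c_def by (rule norm_fourier_block_mult_le[OF chi r D f g q True])
        then show ?thesis unfolding distrib_left using nn by linarith
      next
        case False
        then have "P \<le> P'" by simp
        from norm_fourier_block_mult_le[OF chi r D g f q this]
        have "norm (fourier (\<lambda>x. block chi P' g x * block chi P f x) k) \<le> W * D\<^sup>2 * (?u P' * c ^ P)"
          unfolding W_def b_def c_def .
        then have "norm (fourier (\<lambda>x. block chi P f x * block chi P' g x) k) \<le> W * D\<^sup>2 * (c ^ P * ?u P')"
          by (simp only: mult.commute)
        then show ?thesis unfolding distrib_left using nn by linarith
      qed
    qed
    also have "\<dots> = 2 * (W * D\<^sup>2) * ((\<Sum>P\<le>Q. ?u P) * (\<Sum>P\<le>Q. if 0 \<le> P then c ^ P else 0))"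
    proof -
      have "(\<Sum>P\<le>Q. \<Sum>P'\<le>Q. W * D\<^sup>2 * (?u P * c ^ P' + c ^ P * ?u P'))
         = W * D\<^sup>2 * ((\<Sum>P\<le>Q. \<Sum>P'\<le>Q. ?u P * c ^ P') + (\<Sum>P\<le>Q. \<Sum>P'\<le>Q. c ^ P * ?u P'))"
        by (simp only: sum.distrib distrib_left sum_distrib_left)
      also have "\<dots> = W * D\<^sup>2 * ((\<Sum>P\<le>Q. ?u P) * (\<Sum>P\<le>Q. c ^ P) + (\<Sum>P\<le>Q. c ^ P) * (\<Sum>P\<le>Q. ?u P))"
        by (simp only: sum_product)
      finally show ?thesis by (simp add: algebra_simps)
    qed
    also have "\<dots> \<le> 2 * (W * D\<^sup>2) * ((b ^ q / (1 - b)) * (c ^ 0 / (1 - c)))"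
      using W b c by (intro mult_left_mono mult_mono geometric_tail_le) (auto intro!: sum_nonneg)
    also have "\<dots> = ?C" by (simp add: W_def b_def c_def field_simps)
    finally show ?thesis .
  qed
  have "(\<lambda>Q. norm (fourier (\<lambda>x. low_part chi Q f x * low_part chi Q g x) k)) \<longlonglongrightarrow> norm (fourier (\<lambda>x. f x * g x) k)"
    using f g by (intro tendsto_norm fourier_mult_low_part_tendsto[OF chi]) (auto simp: blocks_le_def)
  then show ?thesis using bound by (intro LIMSEQ_le_const2) auto
qed

section \<open>The Fourier side of the initial datum\<close>

text \<open>The cosine coefficient of a real function.\<close>
definition cosint :: "(real^'n \<Rightarrow> real) \<Rightarrow> int^'n \<Rightarrow> real" where
  "cosint f k = (LINT x|torus. f x * cos (freq k \<bullet> x))"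

text \<open>
  The lacunary component of the datum. Here \<open>2\<^sup>-\<^sup>s\<^sup>m\<close> is written as the power \<open>(2\<^sup>-\<^sup>s)\<^sup>m\<close>, which turns the
  sums over dyadic frequencies into geometric series.
\<close>
definition rough :: "real \<Rightarrow> 'n::finite \<Rightarrow> real^'n \<Rightarrow> real" where
  "rough s i x = (\<Sum>m. (2 powr - s) ^ m * cos (freq (axis i (2 ^ m)) \<bullet> x))"

lemma shear_datum_eq:
  assumes "i \<noteq> j"
  shows "shear_datum s i j x $ i = cos (freq (axis j 1) \<bullet> x)"
    and "shear_datum s i j x $ j = rough s i x"
    and "l \<noteq> i \<Longrightarrow> l \<noteq> j \<Longrightarrow> shear_datum s i j x $ l = 0"
proof -
  have "1 / lam (int m) powr s * cos (lam (int m) * x $ i) = (2 powr - s) ^ m * cos (freq (axis i (2 ^ m)) \<bullet> x)" for m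
    by (simp add: lam_def power_int_of_nat freq_axis powr_realpow[symmetric] powr_powr powr_power powr_minus
        field_simps)
  then have "(\<Sum>m::nat. 1 / lam (int m) powr s * cos (lam (int m) * x $ i)) = rough s i x"
    by (simp add: rough_def)
  then show "shear_datum s i j x $ i = cos (freq (axis j 1) \<bullet> x)"
    and "shear_datum s i j x $ j = rough s i x"
    and "l \<noteq> i \<Longrightarrow> l \<noteq> j \<Longrightarrow> shear_datum s i j x $ l = 0"
    using assms unfolding shear_datum_def by (auto simp: axis_def freq_axis[unfolded axis_def])
qed

lemma cosint_eq_fourier:
  assumes "sqint (\<lambda>x. of_real (f x))"
  shows "cosint f k = Re (fourier (\<lambda>x. of_real (f x)) k)"
proof -
  have i: "integrable torus (\<lambda>x. of_real (f x) * wave (- k) x)"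
    using assms by (intro sqint_mult sqint_wave)
  show ?thesis
    unfolding fourier_def cosint_def by (subst integral_Re[OF i, symmetric]) (simp add: wave_def freq_simps)
qed

lemma abs_cosint_le:
  assumes "sqint (\<lambda>x. of_real (f x))"
  shows "\<bar>cosint f k\<bar> \<le> norm (fourier (\<lambda>x. of_real (f x)) k)"
  unfolding cosint_eq_fourier[OF assms] by (rule abs_Re_le_cmod)

lemma cosint_mult_eq_fourier:
  assumes "sqint (\<lambda>x. of_real (f x))" "sqint (\<lambda>x. of_real (g x))"
  shows "cosint (\<lambda>x. f x * g x) k = Re (fourier (\<lambda>x. of_real (f x) * of_real (g x)) k)"
  unfolding fourier_def cosint_def
  by (subst integral_Re[OF sqint_mult_wave_integrable[OF assms], symmetric]) (simp add: wave_def freq_simps)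

lemma cos_mult_freq: "cos (freq a \<bullet> x) * cos (freq k \<bullet> x) = cos (freq (k + a) \<bullet> x) / 2 + cos (freq (k - a) \<bullet> x) / 2"
  by (simp add: cos_times_cos freq_simps inner_add_left inner_diff_left)
     (metis add.commute add_divide_distrib cos_minus minus_diff_eq)

lemma cos_freq_measurable [measurable]: "(\<lambda>x. cos (freq k \<bullet> x)) \<in> borel_measurable torus"
  by (intro continuous_measurable_torus continuous_intros)

lemma integrable_mult_cos:
  assumes "integrable torus (f :: real^'n \<Rightarrow> real)"
  shows "integrable torus (\<lambda>x. f x * cos (freq k \<bullet> x))"
  by (rule Bochner_Integration.integrable_bound[OF assms])
     (use assms in \<open>auto simp: abs_mult intro!: AE_I2 mult_left_le\<close>)

lemma cosint_mult_cos:
  assumes "integrable torus f"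
  shows "cosint (\<lambda>x. f x * cos (freq a \<bullet> x)) k = cosint f (k + a) / 2 + cosint f (k - a) / 2"
proof -
  have "cosint (\<lambda>x. f x * cos (freq a \<bullet> x)) k
      = (LINT x|torus. f x * cos (freq (k + a) \<bullet> x) / 2 + f x * cos (freq (k - a) \<bullet> x) / 2)"
    unfolding cosint_def by (simp only: mult.assoc cos_mult_freq distrib_left times_divide_eq_right)
  also have "\<dots> = cosint f (k + a) / 2 + cosint f (k - a) / 2"
    unfolding cosint_def using integrable_mult_cos[OF assms] by simp
  finally show ?thesis .
qed

lemma cosint_1: "cosint (\<lambda>x::real^'n. 1) k = (if k = 0 then tvol TYPE('n) else 0)"
proof -
  have "sqint (\<lambda>x::real^'n. of_real 1)" by (rule sqint_bounded[of _ 1]) auto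
  from cosint_eq_fourier[OF this, of k] show ?thesis
    by (simp add: fourier_def integral_wave)
qed

lemma integrable_cos: "integrable torus (\<lambda>x::real^'n. cos (freq k \<bullet> x))"
  by (intro bounded_integrable_torus[of _ 1]) auto

lemma integrable_const_torus: "integrable torus (\<lambda>x::real^'n. 1 :: real)"
  by (intro bounded_integrable_torus[of _ 1]) auto

lemma cosint_cos: "cosint (\<lambda>x::real^'n. cos (freq a \<bullet> x)) k
    = (if k = - a then tvol TYPE('n) else 0) / 2 + (if k = a then tvol TYPE('n) else 0) / 2"
  using cosint_mult_cos[OF integrable_const_torus, of a k] unfolding cosint_1
  by (simp add: add_eq_0_iff2)

text \<open>
  Of the products of two components of the datum, only the mixed one has a nonzero cosine coefficient at
  a frequency \<open>N e\<^sub>i + e\<^sub>j\<close> with \<open>N\<close> a power of two, and a single term of the lacunary series produces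
  it; see also \<open>cosint_cos_rough_datum\<close> and \<open>cosint_rough_rough_datum\<close>.
\<close>
lemma cosint_cos_cos_datum:
  fixes i j :: "'n::finite"
  assumes "i \<noteq> j" "N \<noteq> 0"
  shows "cosint (\<lambda>x. cos (freq (axis j 1) \<bullet> x) * cos (freq (axis j 1) \<bullet> x)) (axis i N + axis j 1) = 0"
proof -
  have "axis i N + axis j 1 + axis j 1 \<noteq> - axis j 1" "axis i N + axis j 1 + axis j 1 \<noteq> axis j 1"
    "axis i N + axis j 1 - axis j 1 \<noteq> - axis j 1" "axis i N + axis j 1 - axis j 1 \<noteq> axis j 1"
    using assms by (auto simp: vec_eq_iff axis_def intro!: exI[of _ i])
  then show ?thesis unfolding cosint_mult_cos[OF integrable_cos] cosint_cos by simp
qed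

lemma rough_measurable [measurable]: "rough s i \<in> borel_measurable torus"
  unfolding rough_def by measurable

context
  fixes s :: real
  assumes s: "s > 0"
begin

lemma decay: "0 < 2 powr - s" "2 powr - s < 1"
  using s by (auto simp: powr_less_one)

lemma rough_summable: "summable (\<lambda>m. norm ((2 powr - s) ^ m * cos (freq (axis i (2 ^ m)) \<bullet> x)))"
  using decay
  by (intro summable_comparison_test[OF _ summable_geometric[of "2 powr - s"]])
     (auto simp: abs_mult intro: mult_left_le)

lemma rough_bounded: "\<bar>rough s i x\<bar> \<le> 1 / (1 - 2 powr - s)"
proof -
  have "\<bar>rough s i x\<bar> \<le> (\<Sum>m. norm ((2 powr - s) ^ m * cos (freq (axis i (2 ^ m)) \<bullet> x)))"
    unfolding rough_def using summable_norm[OF rough_summable] by simp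
  also have "\<dots> \<le> (\<Sum>m. (2 powr - s) ^ m)"
    using decay by (intro suminf_le rough_summable summable_geometric) (auto simp: abs_mult intro: mult_left_le)
  also have "\<dots> = 1 / (1 - 2 powr - s)" using decay by (simp add: suminf_geometric)
  finally show ?thesis .
qed

text \<open>
  The lacunary series may be integrated term by term against any integrable function, because it is
  dominated by a geometric series.
\<close>
lemma integral_mult_rough:
  fixes h :: "real^'n \<Rightarrow> real"
  assumes h: "integrable torus h"
  shows "(\<lambda>m. (2 powr - s) ^ m * (LINT x|torus. h x * cos (freq (axis i (2 ^ m)) \<bullet> x))) sums (LINT x|torus. h x * rough s i x)"
proof -
  let ?f = "\<lambda>m x. (2 powr - s) ^ m * (h x * cos (freq (axis i (2 ^ m)) \<bullet> x))"
  have "(\<lambda>m. LINT x|torus. ?f m x) sums (LINT x|torus. (\<Sum>m. ?f m x))"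
  proof (rule sums_integral)
    show "integrable torus (?f m)" for m
      using integrable_mult_cos[OF h] by simp
    show "AE x in torus. summable (\<lambda>m. norm (?f m x))"
    proof (rule AE_I2)
      fix x
      show "summable (\<lambda>m. norm (?f m x))"
        using summable_mult[OF rough_summable[of i x], of "\<bar>h x\<bar>"] by (simp add: abs_mult ac_simps)
    qed
    show "summable (\<lambda>m. LINT x|torus. norm (?f m x))"
    proof (rule summable_comparison_test)
      show "summable (\<lambda>m. (2 powr - s) ^ m * (LINT x|torus. norm (h x)))"
        using decay by (intro summable_mult2 summable_geometric) auto
      have "(LINT x|torus. norm (?f m x)) \<le> (2 powr - s) ^ m * (LINT x|torus. norm (h x))" for m
      proof -
        have "(LINT x|torus. norm (?f m x)) \<le> (LINT x|torus. (2 powr - s) ^ m * norm (h x))"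
        proof (rule integral_mono)
          show "integrable torus (\<lambda>x. norm (?f m x))"
            using integrable_mult_cos[OF h] by (intro integrable_norm integrable_mult_right)
          show "norm (?f m x) \<le> (2 powr - s) ^ m * norm (h x)" for x
            using decay by (auto simp: abs_mult intro!: mult_left_le mult_left_mono)
        qed (use h in auto)
        then show ?thesis by simp
      qed
      then show "\<exists>N. \<forall>n\<ge>N. norm (LINT x|torus. norm (?f n x)) \<le> (2 powr - s) ^ n * (LINT x|torus. norm (h x))"
        by simp
    qed
  qed
  moreover have "(\<Sum>m. ?f m x) = h x * rough s i x" for x
    unfolding rough_def
    by (subst suminf_mult[symmetric]) (auto simp: ac_simps intro: summable_norm_cancel[OF rough_summable])
  ultimately show ?thesis by simp
qed

lemma cosint_mult_rough:
  fixes f :: "real^'n \<Rightarrow> real"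
  assumes f: "integrable torus f"
  shows "(\<lambda>m. (2 powr - s) ^ m * (cosint f (k + axis i (2 ^ m)) / 2 + cosint f (k - axis i (2 ^ m)) / 2))
     sums cosint (\<lambda>x. f x * rough s i x) k"
proof -
  have "(\<lambda>m. (2 powr - s) ^ m * (LINT x|torus. (f x * cos (freq k \<bullet> x)) * cos (freq (axis i (2 ^ m)) \<bullet> x)))
     sums (LINT x|torus. (f x * cos (freq k \<bullet> x)) * rough s i x)"
    by (intro integral_mult_rough integrable_mult_cos f)
  moreover have "(LINT x|torus. (f x * cos (freq k \<bullet> x)) * cos (freq (axis i (2 ^ m)) \<bullet> x))
     = cosint f (k + axis i (2 ^ m)) / 2 + cosint f (k - axis i (2 ^ m)) / 2" for m
    unfolding cosint_mult_cos[OF f, symmetric] unfolding cosint_def by (simp add: ac_simps)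
  ultimately show ?thesis unfolding cosint_def by (simp add: ac_simps)
qed

lemma integrable_rough: "integrable torus (rough s i :: real^'n \<Rightarrow> real)"
  using rough_bounded by (intro bounded_integrable_torus) auto

lemma cosint_cos_rough_datum:
  fixes i j :: "'n::finite"
  assumes ij: "i \<noteq> j"
  shows "cosint (\<lambda>x. cos (freq (axis j 1) \<bullet> x) * rough s i x) (axis i (2 ^ q) + axis j 1) = (2 powr - s) ^ q * tvol TYPE('n) / 4"
proof -
  let ?k = "axis i (2 ^ q) + axis j 1 :: int^'n" and ?f = "\<lambda>x. cos (freq (axis j 1) \<bullet> x)"
  have ne: "?k + axis i (2 ^ m) \<noteq> - axis j 1" "?k + axis i (2 ^ m) \<noteq> axis j 1" "?k - axis i (2 ^ m) \<noteq> - axis j 1" for m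
  proof -
    have "(?k + axis i (2 ^ m)) $ i \<noteq> (- axis j 1) $ i" "(?k + axis i (2 ^ m)) $ i \<noteq> axis j 1 $ i"
      using ij zero_less_power[of "2::int" q] zero_less_power[of "2::int" m] by (auto simp: axis_def simp del: zero_less_power)
    moreover have "(?k - axis i (2 ^ m)) $ j \<noteq> (- axis j 1) $ j" using ij by (auto simp: axis_def)
    ultimately show "?k + axis i (2 ^ m) \<noteq> - axis j 1" "?k + axis i (2 ^ m) \<noteq> axis j 1" "?k - axis i (2 ^ m) \<noteq> - axis j 1"
      by metis+
  qed
  have eq: "?k - axis i (2 ^ m) = axis j 1 \<longleftrightarrow> m = q" for m
  proof
    assume "?k - axis i (2 ^ m) = axis j 1"
    then have "(?k - axis i (2 ^ m)) $ i = axis j 1 $ i" by simp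
    then have "(2::int) ^ q = 2 ^ m" using ij by (simp add: axis_def)
    then show "m = q" by simp
  qed simp
  have "(\<lambda>m. (2 powr - s) ^ m * (cosint ?f (?k + axis i (2 ^ m)) / 2 + cosint ?f (?k - axis i (2 ^ m)) / 2))
     sums cosint (\<lambda>x. ?f x * rough s i x) ?k"
    by (rule cosint_mult_rough[OF integrable_cos])
  moreover have "(\<lambda>m. (2 powr - s) ^ m * (cosint ?f (?k + axis i (2 ^ m)) / 2 + cosint ?f (?k - axis i (2 ^ m)) / 2))
     = (\<lambda>m. if m = q then (2 powr - s) ^ q * tvol TYPE('n) / 4 else 0)"
    unfolding cosint_cos using ne eq by (auto simp: fun_eq_iff)
  ultimately show ?thesis
    using sums_single[of q "\<lambda>_. (2 powr - s) ^ q * tvol TYPE('n) / 4"] sums_unique2 by fastforce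
qed

lemma cosint_rough_rough_datum:
  fixes i j :: "'n::finite"
  assumes ij: "i \<noteq> j"
  shows "cosint (\<lambda>x. rough s i x * rough s i x) (axis i N + axis j 1) = 0"
proof -
  have *: "cosint (rough s i) k = 0" if "k $ j \<noteq> 0" for k :: "int^'n"
  proof -
    have "k + axis i (2 ^ m) \<noteq> 0" "k - axis i (2 ^ m) \<noteq> 0" for m
      using that ij by (auto simp: vec_eq_iff axis_def)
    then show ?thesis
      using cosint_mult_rough[OF integrable_const_torus, of k i] unfolding cosint_1
      by (simp add: sums_iff)
  qed
  have "cosint (rough s i) (axis i N + axis j 1 + axis i (2 ^ m)) = 0"
    "cosint (rough s i) (axis i N + axis j 1 - axis i (2 ^ m)) = 0" for m
    using ij by (auto intro!: * simp: axis_def)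
  then show ?thesis
    using cosint_mult_rough[OF integrable_rough, of i "axis i N + axis j 1" i] by (simp add: sums_iff)
qed

text \<open>
  Multiplication by term \<open>m\<close> of the lacunary series shifts the first component of the frequency by \<open>\<plusminus> 2\<^sup>m\<close>. The shifted
  frequency has size at least \<open>2\<^sup>q\<close>, where the coefficient of \<open>f\<close> is small, unless \<open>m = Suc q\<close> and the two
  frequencies cancel; in that case the weight \<open>2\<^sup>-\<^sup>s\<^sup>m\<close> of the term is small.
\<close>
lemma abs_cosint_mult_rough_le:
  fixes f :: "real^'n \<Rightarrow> real" and i j :: "'n::finite"
  assumes f: "integrable torus f" and X: "X \<ge> 0" and ij: "i \<noteq> j"
    and bound: "\<And>k p. p = 0 \<or> 2 ^ p \<le> norm (freq k) \<Longrightarrow> \<bar>cosint f k\<bar> \<le> X * (2 powr - s) ^ p"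
  shows "\<bar>cosint (\<lambda>x. f x * rough s i x) (axis i (2 ^ Suc q) + axis j 1)\<bar>
    \<le> X * (2 powr - s) ^ q * (1 / (1 - 2 powr - s) + 1)"
proof -
  let ?k = "axis i (2 ^ Suc q) + axis j 1 :: int^'n"
  let ?b = "2 powr - s"
  let ?t = "\<lambda>m. ?b ^ m * (cosint f (?k + axis i (2 ^ m)) / 2 + cosint f (?k - axis i (2 ^ m)) / 2)"
  have S: "?t sums cosint (\<lambda>x. f x * rough s i x) ?k" by (rule cosint_mult_rough[OF f])
  have far: "\<bar>cosint f a\<bar> \<le> X * ?b ^ q" if "2 ^ q \<le> \<bar>a $ i\<bar>" for a :: "int^'n"
  proof (rule bound)
    have "2 ^ q \<le> real_of_int \<bar>a $ i\<bar>" using of_int_le_iff[where 'a = real, THEN iffD2, OF that] by simp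
    also have "\<dots> = \<bar>freq a $ i\<bar>" by (simp add: freq_def)
    also have "\<dots> \<le> norm (freq a)" by (rule component_le_norm_cart)
    finally show "q = 0 \<or> 2 ^ q \<le> norm (freq a)" by simp
  qed
  have near: "\<bar>cosint f a\<bar> \<le> X" for a using bound[of 0 a] by simp
  have plus: "\<bar>cosint f (?k + axis i (2 ^ m))\<bar> \<le> X * ?b ^ q" for m
    using ij by (intro far) (simp add: axis_def abs_of_nonneg)
  have b1: "?b ^ q \<le> 1" using decay by (intro power_le_one) auto
  have bq: "?b ^ Suc q \<le> ?b ^ q" using decay by (intro power_decreasing) auto
  have summand: "norm (?t m) \<le> X * ?b ^ q * ?b ^ m + (if m = Suc q then X * ?b ^ q else 0)" for m
  proof -
    have c: "\<bar>cosint f (?k + axis i (2 ^ m)) / 2 + cosint f (?k - axis i (2 ^ m)) / 2\<bar>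
       \<le> X * ?b ^ q + (if m = Suc q then X else 0)"
    proof (cases "m = Suc q")
      case True
      have "X * ?b ^ q \<ge> 0" using X decay by simp
      then show ?thesis using plus[of m] near[of "?k - axis i (2 ^ m)"] True by auto
    next
      case False
      have "(2::int) ^ q \<le> \<bar>2 ^ Suc q - 2 ^ m\<bar>"
      proof (cases "m \<le> q")
        case True
        then have "(2::int) ^ m \<le> 2 ^ q" by (intro power_increasing) auto
        then have "(2::int) ^ q \<le> 2 ^ Suc q - 2 ^ m" by simp
        then show ?thesis by linarith
      next
        case g: False
        with False have "(2::int) ^ Suc (Suc q) \<le> 2 ^ m" by (intro power_increasing) auto
        then show ?thesis using zero_less_power[of "2::int" q] by simp
      qed
      then have "\<bar>cosint f (?k - axis i (2 ^ m))\<bar> \<le> X * ?b ^ q"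
        using ij by (intro far) (simp add: axis_def)
      then show ?thesis using plus[of m] False by auto
    qed
    have "norm (?t m) = ?b ^ m * \<bar>cosint f (?k + axis i (2 ^ m)) / 2 + cosint f (?k - axis i (2 ^ m)) / 2\<bar>"
      using decay by (simp add: abs_mult)
    also have "\<dots> \<le> ?b ^ m * (X * ?b ^ q + (if m = Suc q then X else 0))"
      using c decay by (intro mult_left_mono) auto
    also have "\<dots> \<le> X * ?b ^ q * ?b ^ m + (if m = Suc q then X * ?b ^ q else 0)"
      using mult_left_mono[OF bq X] by (simp add: algebra_simps)
    finally show ?thesis .
  qed
  have u: "(\<lambda>m. X * ?b ^ q * ?b ^ m + (if m = Suc q then X * ?b ^ q else 0)) sums (X * ?b ^ q * (1 / (1 - ?b)) + X * ?b ^ q)"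
    using decay by (intro sums_add sums_mult geometric_sums sums_single) auto
  have "\<bar>cosint (\<lambda>x. f x * rough s i x) ?k\<bar> = norm (\<Sum>m. ?t m)" using S by (simp add: sums_iff)
  also have "\<dots> \<le> (\<Sum>m. X * ?b ^ q * ?b ^ m + (if m = Suc q then X * ?b ^ q else 0))"
    using summand u by (intro norm_suminf_le) (auto simp: sums_iff)
  also have "\<dots> = X * ?b ^ q * (1 / (1 - ?b) + 1)" using u by (simp add: sums_iff distrib_left)
  finally show ?thesis .
qed

lemma abs_cosint_mult_cos_le:
  fixes f :: "real^'n \<Rightarrow> real" and i j :: "'n::finite"
  assumes f: "integrable torus f" and X: "X \<ge> 0" and ij: "i \<noteq> j"
    and bound: "\<And>k p. p = 0 \<or> 2 ^ p \<le> norm (freq k) \<Longrightarrow> \<bar>cosint f k\<bar> \<le> X * (2 powr - s) ^ p"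
  shows "\<bar>cosint (\<lambda>x. f x * cos (freq (axis j 1) \<bullet> x)) (axis i (2 ^ q) + axis j 1)\<bar> \<le> X * (2 powr - s) ^ q"
proof -
  have far: "\<bar>cosint f a\<bar> \<le> X * (2 powr - s) ^ q" if "a $ i = 2 ^ q" for a :: "int^'n"
  proof (rule bound)
    have "2 ^ q = \<bar>freq a $ i\<bar>" using that by (simp add: freq_def)
    also have "\<dots> \<le> norm (freq a)" by (rule component_le_norm_cart)
    finally show "q = 0 \<or> 2 ^ q \<le> norm (freq a)" by simp
  qed
  have "\<bar>cosint f (axis i (2 ^ q) + axis j 1 + axis j 1)\<bar> \<le> X * (2 powr - s) ^ q"
    "\<bar>cosint f (axis i (2 ^ q) + axis j 1 - axis j 1)\<bar> \<le> X * (2 powr - s) ^ q"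
    using ij by (auto intro!: far simp: axis_def)
  then show ?thesis unfolding cosint_mult_cos[OF f] by linarith
qed

end

section \<open>Plane-wave test functions and averaging in time\<close>

text \<open>
  The time cutoff and its derivatives, obtained from the Littlewood-Paley cutoff: \<open>bump chi i c h m\<close> is
  the \<open>m\<close>-th derivative of the restriction of \<open>chi\<close> to the \<open>i\<close>-th axis, recentred at \<open>c\<close> and rescaled by
  \<open>h\<close>. The restriction of a smooth function to a line is smooth.
\<close>
definition bump :: "(real^'n \<Rightarrow> real) \<Rightarrow> 'n \<Rightarrow> real \<Rightarrow> real \<Rightarrow> nat \<Rightarrow> real \<Rightarrow> real" where
  "bump chi i c h m t = iter_deriv (replicate m (axis i 1)) chi (((t - c) / h) *\<^sub>R axis i 1) / h ^ m"

lemma dderiv_eq: "(f has_derivative f') (at z) \<Longrightarrow> dderiv v f z = f' v"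
  unfolding dderiv_def using frechet_derivative_at by metis

lemma bump_has_derivative:
  fixes chi :: "real^'n \<Rightarrow> real"
  assumes chi: "smooth chi" and h: "h > 0"
  shows "(bump chi i c h m has_real_derivative bump chi i c h (Suc m) t) (at t)"
proof -
  let ?e = "axis i 1 :: real^'n"
  let ?g = "iter_deriv (replicate m ?e) chi"
  let ?z = "((t - c) / h) *\<^sub>R ?e"
  have "?e \<in> Basis" by simp
  then have "?g differentiable (at ?z)"
    using chi unfolding smooth_def by (auto dest!: spec[of _ "replicate m ?e"])
  then have g: "(?g has_derivative frechet_derivative ?g (at ?z)) (at ?z)"
    by (rule frechet_derivative_works[THEN iffD1])
  have lin: "linear (frechet_derivative ?g (at ?z))" using g by (rule has_derivative_linear)
  \<comment> \<open>Chain rule along the line \<open>t \<mapsto> ((t - c) / h) e\<close>.\<close>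
  have "((\<lambda>t. ((t - c) / h) *\<^sub>R ?e) has_derivative (\<lambda>d. (d / h) *\<^sub>R ?e)) (at t)"
    using h by (auto intro!: derivative_eq_intros)
  from has_derivative_compose[OF this g]
  have "((\<lambda>t. ?g (((t - c) / h) *\<^sub>R ?e)) has_derivative (\<lambda>d. d / h * dderiv ?e ?g ?z)) (at t)"
    by (simp add: dderiv_def linear_scale[OF lin])
  then have "((\<lambda>t. ?g (((t - c) / h) *\<^sub>R ?e)) has_real_derivative dderiv ?e ?g ?z / h) (at t)"
  proof -
    have "(\<lambda>d. d / h * dderiv ?e ?g ?z) = (*) (dderiv ?e ?g ?z / h)" by (rule ext) simp
    then show ?thesis
      using \<open>((\<lambda>t. ?g (((t - c) / h) *\<^sub>R ?e)) has_derivative (\<lambda>d. d / h * dderiv ?e ?g ?z)) (at t)\<close>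
      unfolding has_field_derivative_def by simp
  qed
  from DERIV_cdivide[OF this, of "h ^ m"] show ?thesis
    unfolding bump_def[abs_def] by (simp add: field_simps)
qed

lemma bump_0:
  fixes chi :: "real^'n \<Rightarrow> real"
  assumes chi: "LP_cutoff chi" and h: "h > 0"
  shows "0 \<le> bump chi i c h 0 t" "\<bar>t - c\<bar> \<le> h / 2 \<Longrightarrow> bump chi i c h 0 t = 1"
    "t \<notin> {c - h..c + h} \<Longrightarrow> bump chi i c h m t = 0"
proof -
  have n: "norm (((t - c) / h) *\<^sub>R (axis i 1 :: real^'n)) = \<bar>t - c\<bar> / h" for t
    using h by simp
  show "0 \<le> bump chi i c h 0 t" using chi by (simp add: bump_def LP_cutoff_def)
  show "\<bar>t - c\<bar> \<le> h / 2 \<Longrightarrow> bump chi i c h 0 t = 1"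
    using chi n[of t] h by (simp add: bump_def LP_cutoff_def field_simps)
  have zero: "iter_deriv vs chi z = 0" if "norm z > 1" for z vs
    using that
  proof (induction vs arbitrary: z)
    case Nil
    then have "1 \<le> norm z" by simp
    moreover have "\<forall>z. 1 \<le> norm z \<longrightarrow> chi z = 0" using chi unfolding LP_cutoff_def by blast
    ultimately show ?case by simp
  next
    case (Cons v vs)
    have "open {z :: real^'n. 1 < norm z}" by (intro open_Collect_less continuous_on_const continuous_on_norm continuous_on_id)
    then have "(iter_deriv vs chi has_derivative (\<lambda>_. 0)) (at z)"
      using Cons by (intro has_derivative_transform_within_open[OF has_derivative_const[of 0]]) auto
    then show ?case by (simp add: dderiv_eq)
  qed
  assume "t \<notin> {c - h..c + h}"
  then have "\<bar>t - c\<bar> > h" by auto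
  then have "norm (((t - c) / h) *\<^sub>R (axis i 1 :: real^'n)) > 1" unfolding n using h by (simp add: field_simps)
  from zero[OF this] show "bump chi i c h m t = 0" by (simp add: bump_def)
qed

text \<open>A smooth function \<open>\<theta> 0\<close> of one variable, given together with all its derivatives \<open>\<theta> m\<close>.\<close>
definition derivative_chain :: "(nat \<Rightarrow> real \<Rightarrow> real) \<Rightarrow> bool" where
  "derivative_chain \<theta> \<longleftrightarrow> (\<forall>m t. (\<theta> m has_real_derivative \<theta> (Suc m) t) (at t))"

text \<open>
  The field \<open>\<theta>\<^sub>m(t) c sin(k \<bullet> x + d) a\<close>. The test field is the case \<open>m = 0\<close>, \<open>c = 1\<close>, \<open>d = 0\<close>; the
  parameters \<open>m\<close>, \<open>c\<close> and \<open>d\<close> make the family closed under partial derivatives, which yields smoothness.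
\<close>
definition plane_test :: "(nat \<Rightarrow> real \<Rightarrow> real) \<Rightarrow> int^'n \<Rightarrow> real^'n \<Rightarrow> nat \<Rightarrow> real \<Rightarrow> real \<Rightarrow> real \<times> (real^'n) \<Rightarrow> real^'n" where
  "plane_test \<theta> k a m c d z = (\<theta> m (fst z) * (c * sin (freq k \<bullet> snd z + d))) *\<^sub>R a"

lemma plane_test_has_derivative:
  assumes "derivative_chain \<theta>"
  shows "(plane_test \<theta> k a m c d has_derivative
     (\<lambda>v. (fst v * \<theta> (Suc m) (fst z) * (c * sin (freq k \<bullet> snd z + d))
        + \<theta> m (fst z) * (c * (cos (freq k \<bullet> snd z + d) * (freq k \<bullet> snd v)))) *\<^sub>R a)) (at z)"
proof -
  have "(\<theta> m has_real_derivative \<theta> (Suc m) (fst z)) (at (fst z))"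
    using assms by (simp add: derivative_chain_def)
  from DERIV_compose_FDERIV[OF this has_derivative_fst[OF has_derivative_ident]]
  have [derivative_intros]: "((\<lambda>z. \<theta> m (fst z)) has_derivative (\<lambda>v. fst v * \<theta> (Suc m) (fst z))) (at z)"
    by simp
  show ?thesis
    unfolding plane_test_def[abs_def]
    by (auto intro!: derivative_eq_intros simp: algebra_simps)
qed

lemma iter_deriv_plane_test:
  assumes \<theta>: "derivative_chain \<theta>" and vs: "set vs \<subseteq> Basis"
  shows "\<exists>m c' d'. iter_deriv vs (plane_test \<theta> k a 0 c d) = plane_test \<theta> k a m c' d'"
  using vs
proof (induction vs)
  case Nil
  then show ?case by (metis iter_deriv.simps(1))
next
  case (Cons v vs)
  then obtain m c' d' where IH: "iter_deriv vs (plane_test \<theta> k a 0 c d) = plane_test \<theta> k a m c' d'" by auto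
  have D: "dderiv v (plane_test \<theta> k a m c' d') z
      = (fst v * \<theta> (Suc m) (fst z) * (c' * sin (freq k \<bullet> snd z + d'))
        + \<theta> m (fst z) * (c' * (cos (freq k \<bullet> snd z + d') * (freq k \<bullet> snd v)))) *\<^sub>R a" for z
    by (rule dderiv_eq[OF plane_test_has_derivative[OF \<theta>]])
  from Cons.prems have "v \<in> Basis" by simp
  then consider "v = (1, 0)" | l where "v = (0, axis l 1)"
    by (auto simp: Basis_prod_def Basis_vec_def)
  then show ?case
  proof cases
    case 1
    have "iter_deriv (v # vs) (plane_test \<theta> k a 0 c d) = plane_test \<theta> k a (Suc m) c' d'"
      by (rule ext) (simp add: IH D[unfolded 1] 1, simp add: plane_test_def)
    then show ?thesis by blast
  next
    case (2 l)
    have "iter_deriv (v # vs) (plane_test \<theta> k a 0 c d) = plane_test \<theta> k a m (c' * (freq k \<bullet> axis l 1)) (d' + pi / 2)"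
      by (rule ext) (simp add: IH D[unfolded 2] 2, simp add: plane_test_def sin_add cos_add add.assoc[symmetric])
    then show ?thesis by blast
  qed
qed

lemma smooth_plane_test:
  assumes "derivative_chain \<theta>"
  shows "smooth (plane_test \<theta> k a 0 c d)"
  unfolding smooth_def
proof (intro allI impI)
  fix vs :: "(real \<times> (real^'a)) list" and z assume "set vs \<subseteq> Basis"
  from iter_deriv_plane_test[OF assms this] obtain m c' d'
    where "iter_deriv vs (plane_test \<theta> k a 0 c d) = plane_test \<theta> k a m c' d'" by blast
  then show "iter_deriv vs (plane_test \<theta> k a 0 c d) differentiable at z"
    by (simp only:) (rule differentiableI[OF plane_test_has_derivative[OF assms]])
qed

lemma trig_periodic:
  "sin (freq k \<bullet> (x + axis l (2 * pi))) = sin (freq k \<bullet> x)"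
  "cos (freq k \<bullet> (x + axis l (2 * pi))) = cos (freq k \<bullet> x)"
proof -
  have "freq k \<bullet> (x + axis l (2 * pi)) = freq k \<bullet> x + 2 * pi * of_int (k $ l)"
    by (simp add: inner_add_right inner_axis freq_def)
  then show "sin (freq k \<bullet> (x + axis l (2 * pi))) = sin (freq k \<bullet> x)"
    "cos (freq k \<bullet> (x + axis l (2 * pi))) = cos (freq k \<bullet> x)"
    by (simp_all add: sin_add cos_add)
qed

lemma test_fun_plane_test:
  assumes \<theta>: "derivative_chain \<theta>"
    and supp: "\<And>t. t \<notin> {\<alpha>..\<beta>} \<Longrightarrow> \<theta> 0 t = 0" and ab: "0 < \<alpha>" "\<beta> < T"
  shows "test_fun T (plane_test \<theta> k a 0 1 0)"
  unfolding test_fun_def test_on_def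
  using smooth_plane_test[OF \<theta>] supp ab
  by (intro exI[of _ \<alpha>] exI[of _ \<beta>]) (auto simp: plane_test_def periodic_def trig_periodic)

lemma plane_test_derivs:
  assumes \<theta>: "derivative_chain \<theta>"
  shows "time_deriv (plane_test \<theta> k a 0 1 0) t x = (\<theta> 1 t * sin (freq k \<bullet> x)) *\<^sub>R a"
    "space_deriv l (plane_test \<theta> k a 0 1 0) t x = (\<theta> 0 t * cos (freq k \<bullet> x) * freq k $ l) *\<^sub>R a"
  unfolding time_deriv_def space_deriv_def dderiv_eq[OF plane_test_has_derivative[OF \<theta>]]
  by (simp_all add: inner_axis)

lemma divergence_plane_test:
  assumes \<theta>: "derivative_chain \<theta>" and a: "freq k \<bullet> a = 0"
  shows "divergence (plane_test \<theta> k a 0 1 0) = (\<lambda>z. 0)"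
proof
  fix z :: "real \<times> (real^'a)"
  have "divergence (plane_test \<theta> k a 0 1 0) z = (\<Sum>l\<in>UNIV. \<theta> 0 (fst z) * cos (freq k \<bullet> snd z) * (freq k $ l * a $ l))"
    by (cases z) (simp add: divergence_def plane_test_derivs[OF \<theta>] mult.assoc)
  also have "\<dots> = \<theta> 0 (fst z) * cos (freq k \<bullet> snd z) * (freq k \<bullet> a)"
    by (simp only: sum_distrib_left[symmetric] inner_vec_def inner_real_def)
  finally show "divergence (plane_test \<theta> k a 0 1 0) z = 0" using a by simp
qed

lemma distribution_zero:
  assumes "distribution T p" "T > 0"
  shows "p (\<lambda>z. 0) = 0"
proof -
  have "iter_deriv vs (\<lambda>z :: real \<times> (real^'a). 0 :: real) = (\<lambda>z. 0)" for vs
    by (induction vs) (auto intro!: ext dderiv_eq[where f' = "\<lambda>_. 0"])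
  then have "test_fun T (\<lambda>z :: real \<times> (real^'a). 0 :: real)"
    using assms(2) unfolding test_fun_def test_on_def smooth_def
    by (intro exI[of _ 1] exI[of _ 0]) (auto simp: periodic_def)
  then have "p (\<lambda>z. 0 * 0) = 0 * p (\<lambda>z. 0)"
    using assms(1) unfolding distribution_def by blast
  then show ?thesis by simp
qed

text \<open>
  Let \<open>S\<close> and \<open>M\<close> stay close to the constants \<open>S0\<close> and \<open>M0\<close> on the support of \<open>\<theta>\<close>. Since \<open>\<theta>'\<close> has integral
  zero, \<open>S0\<close> makes no contribution, and the weak identity bounds \<open>M0\<close> by the two deviations.
\<close>
lemma averaged_identity:
  fixes \<theta> \<theta>' S M :: "real \<Rightarrow> real"
  assumes ab: "0 < \<alpha>" "\<alpha> \<le> \<beta>" "\<beta> < T"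
    and d: "\<And>t. (\<theta> has_real_derivative \<theta>' t) (at t)" and c: "continuous_on UNIV \<theta>'"
    and supp: "\<And>t. t \<notin> {\<alpha>..\<beta>} \<Longrightarrow> \<theta> t = 0" "\<And>t. t \<notin> {\<alpha>..\<beta>} \<Longrightarrow> \<theta>' t = 0" and nn: "\<And>t. 0 \<le> \<theta> t"
    and S: "set_borel_measurable lborel {0<..<T} S" and M: "set_borel_measurable lborel {0<..<T} M"
    and bS: "\<And>t. t \<in> {\<alpha>..\<beta>} \<Longrightarrow> \<bar>S t - S0\<bar> \<le> A" and bM: "\<And>t. t \<in> {\<alpha>..\<beta>} \<Longrightarrow> \<bar>M t - M0\<bar> \<le> B"
    and zero: "(LINT t:{0<..<T}|lborel. \<theta>' t * S t + \<theta> t * M t) = 0"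
  shows "\<bar>M0\<bar> * (LINT t|lborel. \<theta> t) \<le> A * (LINT t|lborel. \<bar>\<theta>' t\<bar>) + B * (LINT t|lborel. \<theta> t)"
proof -
  have c0: "continuous_on UNIV \<theta>" using d by (meson DERIV_isCont continuous_at_imp_continuous_on)
  have supp': "g = (\<lambda>t. indicator {\<alpha>..\<beta>} t *\<^sub>R g t)" if "\<And>t. t \<notin> {\<alpha>..\<beta>} \<Longrightarrow> g t = 0" for g :: "real \<Rightarrow> real"
    using that by (auto simp: indicator_def fun_eq_iff)
  have int: "integrable lborel \<theta>" "integrable lborel \<theta>'"
  proof -
    have "integrable lborel (\<lambda>t. indicator {\<alpha>..\<beta>} t *\<^sub>R \<theta> t)" "integrable lborel (\<lambda>t. indicator {\<alpha>..\<beta>} t *\<^sub>R \<theta>' t)"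
      using borel_integrable_atLeastAtMost'[OF continuous_on_subset[OF c0]] borel_integrable_atLeastAtMost'[OF continuous_on_subset[OF c]]
      by (auto simp: set_integrable_def)
    then show "integrable lborel \<theta>" "integrable lborel \<theta>'"
      using supp'[OF supp(1), symmetric] supp'[OF supp(2), symmetric] by simp_all
  qed
  have m [measurable]: "\<theta> \<in> borel_measurable borel" "\<theta>' \<in> borel_measurable borel"
    using c c0 by (auto intro: borel_measurable_continuous_onI)
  have z': "(LINT t|lborel. \<theta>' t) = 0"
  proof -
    have "(LINT t|lborel. indicator {\<alpha> - 1..\<beta> + 1} t *\<^sub>R \<theta>' t) = \<theta> (\<beta> + 1) - \<theta> (\<alpha> - 1)"
      using ab d c by (intro integral_FTC_atLeastAtMost)
        (auto simp: has_real_derivative_iff_has_vector_derivative[symmetric] intro: has_field_derivative_at_within continuous_on_subset)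
    also have "(\<lambda>t. indicator {\<alpha> - 1..\<beta> + 1} t *\<^sub>R \<theta>' t) = \<theta>'"
    proof
      fix t
      show "indicator {\<alpha> - 1..\<beta> + 1} t *\<^sub>R \<theta>' t = \<theta>' t"
        using supp(2)[of t] by (cases "t \<in> {\<alpha> - 1..\<beta> + 1}") auto
    qed
    also have "\<theta> (\<beta> + 1) - \<theta> (\<alpha> - 1) = 0" using supp(1) by simp
    finally show ?thesis .
  qed
  \<comment> \<open>The functions \<open>S\<close> and \<open>M\<close> are only known to be measurable on \<open>(0, T)\<close>, so they are cut off.\<close>
  define S' M' where "S' = (\<lambda>t. indicator {0<..<T} t * S t)" and "M' = (\<lambda>t. indicator {0<..<T} t * M t)"
  have [measurable]: "S' \<in> borel_measurable borel" "M' \<in> borel_measurable borel"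
    using S M by (simp_all add: set_borel_measurable_def S'_def M'_def)
  define R where "R t = \<theta>' t * (S' t - S0) + \<theta> t * (M' t - M0)" for t
  have Rm [measurable]: "R \<in> borel_measurable borel"
    unfolding R_def by measurable
  have Rb: "\<bar>R t\<bar> \<le> \<bar>\<theta>' t\<bar> * A + \<theta> t * B" for t
  proof (cases "t \<in> {\<alpha>..\<beta>}")
    case True
    then have ind: "indicator {0<..<T} t = (1::real)" using ab by auto
    have "\<bar>R t\<bar> \<le> \<bar>\<theta>' t\<bar> * \<bar>S t - S0\<bar> + \<bar>\<theta> t\<bar> * \<bar>M t - M0\<bar>"
      unfolding R_def S'_def M'_def ind by (simp add: abs_mult[symmetric])
    also have "\<dots> \<le> \<bar>\<theta>' t\<bar> * A + \<theta> t * B"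
      using bS[OF True] bM[OF True] nn[of t] by (intro add_mono mult_mono) auto
    finally show ?thesis .
  next
    case False
    then show ?thesis using supp by (simp add: R_def)
  qed
  have bi: "integrable lborel (\<lambda>t. \<bar>\<theta>' t\<bar> * A + \<theta> t * B)" using int by auto
  have Ri: "integrable lborel R"
    by (rule Bochner_Integration.integrable_bound[OF bi]) (auto intro!: AE_I2 order_trans[OF Rb])
  have eq: "indicator {0<..<T} t *\<^sub>R (\<theta>' t * S t + \<theta> t * M t) = S0 * \<theta>' t + M0 * \<theta> t + R t" for t
  proof (cases "t \<in> {\<alpha>..\<beta>}")
    case True
    then have "indicator {0<..<T} t = (1::real)" using ab by auto
    then show ?thesis by (simp add: R_def S'_def M'_def algebra_simps)
  next
    case False
    then show ?thesis using supp by (simp add: R_def)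
  qed
  have "0 = S0 * (LINT t|lborel. \<theta>' t) + M0 * (LINT t|lborel. \<theta> t) + (LINT t|lborel. R t)"
    using zero unfolding set_lebesgue_integral_def eq using int Ri by simp
  then have "\<bar>M0 * (LINT t|lborel. \<theta> t)\<bar> = \<bar>LINT t|lborel. R t\<bar>" using z' by simp
  also have "\<dots> \<le> (LINT t|lborel. \<bar>\<theta>' t\<bar> * A + \<theta> t * B)"
  proof -
    have "\<bar>LINT t|lborel. R t\<bar> \<le> (LINT t|lborel. \<bar>R t\<bar>)" by (rule integral_abs_bound)
    also have "\<dots> \<le> (LINT t|lborel. \<bar>\<theta>' t\<bar> * A + \<theta> t * B)"
      using Ri bi Rb by (intro integral_mono) auto
    finally show ?thesis .
  qed
  also have "\<dots> = A * (LINT t|lborel. \<bar>\<theta>' t\<bar>) + B * (LINT t|lborel. \<theta> t)"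
    using int by simp
  finally show ?thesis using nn by (simp add: abs_mult)
qed

section \<open>Stability of the flux near the initial datum\<close>

text \<open>The frequency \<open>k = N e\<^sub>i + e\<^sub>j\<close> with \<open>N = 2\<^sup>q\<^sup>+\<^sup>1\<close>, so that \<open>N \<ge> 2\<close>.\<close>
definition test_mode :: "'n \<Rightarrow> 'n \<Rightarrow> nat \<Rightarrow> int^'n::finite" where
  "test_mode i j q = axis i (2 ^ Suc q) + axis j 1"

text \<open>The amplitude \<open>a = e\<^sub>i / N - e\<^sub>j\<close>, orthogonal to \<open>k\<close>.\<close>
definition test_dir :: "'n \<Rightarrow> 'n \<Rightarrow> nat \<Rightarrow> real^'n::finite" where
  "test_dir i j q = axis i (1 / 2 ^ Suc q) - axis j 1"

text \<open>The nonlinear term tested against the plane wave: the integral of \<open>(v \<bullet> a) (v \<bullet> k) cos(k \<bullet> x)\<close>.\<close>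
definition flux :: "'n \<Rightarrow> 'n \<Rightarrow> nat \<Rightarrow> (real^'n::finite \<Rightarrow> real^'n) \<Rightarrow> real" where
  "flux i j q v = cosint (\<lambda>x. (v x \<bullet> test_dir i j q) * (v x \<bullet> freq (test_mode i j q))) (test_mode i j q)"

text \<open>The \<open>L\<^sup>2\<close> inner product of \<open>v\<close> with the plane wave \<open>sin(k \<bullet> x) a\<close>.\<close>
definition moment :: "'n \<Rightarrow> 'n \<Rightarrow> nat \<Rightarrow> (real^'n::finite \<Rightarrow> real^'n) \<Rightarrow> real" where
  "moment i j q v = (LINT x|torus. v x \<bullet> (sin (freq (test_mode i j q) \<bullet> x) *\<^sub>R test_dir i j q))"

lemma inner_test:
  "v \<bullet> test_dir i j q = v $ i / 2 ^ Suc q - v $ j"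
  "v \<bullet> freq (test_mode i j q) = 2 ^ Suc q * v $ i + v $ j"
proof -
  have "freq (test_mode i j q) = 2 ^ Suc q *\<^sub>R axis i 1 + axis j 1"
    by (auto simp: freq_def test_mode_def vec_eq_iff axis_def)
  then show "v \<bullet> test_dir i j q = v $ i / 2 ^ Suc q - v $ j"
    "v \<bullet> freq (test_mode i j q) = 2 ^ Suc q * v $ i + v $ j"
    by (simp_all add: test_dir_def inner_diff_right inner_add_right inner_axis)
qed

lemma freq_test_mode_test_dir: "i \<noteq> j \<Longrightarrow> freq (test_mode i j q) \<bullet> test_dir i j q = 0"
  unfolding inner_test by (simp add: freq_def test_mode_def axis_def)

lemma norm_freq_test_mode:
  assumes "i \<noteq> j"
  shows "2 ^ Suc q \<le> norm (freq (test_mode i j q))"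
proof -
  have "2 ^ Suc q = \<bar>freq (test_mode i j q) $ i\<bar>"
    using assms by (simp add: freq_def test_mode_def axis_def)
  also have "\<dots> \<le> norm (freq (test_mode i j q))" by (rule component_le_norm_cart)
  finally show ?thesis .
qed

lemma integrable_mult_real:
  assumes "sqint (\<lambda>x. of_real (f x))" "sqint (\<lambda>x. of_real (g x))"
  shows "integrable torus (\<lambda>x. f x * g x :: real)"
proof -
  have "integrable torus (\<lambda>x. Re (of_real (f x) * of_real (g x)))"
    by (intro integrable_Re sqint_mult assms)
  then show ?thesis by simp
qed

lemma integrable_real: "sqint (\<lambda>x. of_real (f x)) \<Longrightarrow> integrable torus (f :: real^'n \<Rightarrow> real)"
  using integrable_Re[OF sqint_integrable, of "\<lambda>x. of_real (f x)"] by simp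

lemma cosint_linear:
  assumes "integrable torus f" "integrable torus g"
  shows "cosint (\<lambda>x. f x + g x) k = cosint f k + cosint g k" "cosint (\<lambda>x. c * f x) k = c * cosint f k"
    "cosint (\<lambda>x. f x - g x) k = cosint f k - cosint g k"
  using integrable_mult_cos[OF assms(1)] integrable_mult_cos[OF assms(2)]
  by (simp_all add: cosint_def distrib_right left_diff_distrib mult.assoc)

lemma flux_eq:
  assumes "sqint (\<lambda>x. of_real (v x $ i))" "sqint (\<lambda>x. of_real (v x $ j))"
  shows "flux i j q v = cosint (\<lambda>x. v x $ i * v x $ i) (test_mode i j q)
     + (1 / 2 ^ Suc q - 2 ^ Suc q) * cosint (\<lambda>x. v x $ i * v x $ j) (test_mode i j q)
     - cosint (\<lambda>x. v x $ j * v x $ j) (test_mode i j q)"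
proof -
  define N :: real where "N = 2 ^ Suc q"
  have N: "N > 0" by (simp add: N_def)
  have "(v x \<bullet> test_dir i j q) * (v x \<bullet> freq (test_mode i j q))
     = v x $ i * v x $ i + (1 / N - N) * (v x $ i * v x $ j) - v x $ j * v x $ j" for x
    unfolding inner_test N_def[symmetric] using N by (simp add: field_simps)
  moreover have "integrable torus (\<lambda>x. v x $ i * v x $ i)" "integrable torus (\<lambda>x. v x $ i * v x $ j)" "integrable torus (\<lambda>x. v x $ j * v x $ j)"
    by (intro integrable_mult_real assms)+
  ultimately show ?thesis
    unfolding flux_def N_def[symmetric] by (simp add: cosint_linear)
qed

lemma cosint_mult_perturb:
  assumes s: "sqint (\<lambda>x. of_real (f x))" "sqint (\<lambda>x. of_real (g x))"
    "sqint (\<lambda>x. of_real (f0 x))" "sqint (\<lambda>x. of_real (g0 x))"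
  shows "\<bar>cosint (\<lambda>x. f x * g x) k - cosint (\<lambda>x. f0 x * g0 x) k\<bar>
    \<le> \<bar>cosint (\<lambda>x. (f x - f0 x) * g0 x) k\<bar> + \<bar>cosint (\<lambda>x. (g x - g0 x) * f0 x) k\<bar>
      + \<bar>cosint (\<lambda>x. (f x - f0 x) * (g x - g0 x)) k\<bar>"
proof -
  have d: "sqint (\<lambda>x. of_real (f x - f0 x))" "sqint (\<lambda>x. of_real (g x - g0 x))"
    using sqint_diff[OF s(1,3)] sqint_diff[OF s(2,4)] by simp_all
  note i = integrable_mult_real[OF d(1) s(4)] integrable_mult_real[OF d(2) s(3)] integrable_mult_real[OF d(1) d(2)]
    integrable_mult_real[OF s(3,4)]
  have "cosint (\<lambda>x. f x * g x) k = cosint (\<lambda>x. ((f x - f0 x) * g0 x + (g x - g0 x) * f0 x) + ((f x - f0 x) * (g x - g0 x) + f0 x * g0 x)) k"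
    by (simp add: algebra_simps)
  also have "\<dots> = cosint (\<lambda>x. (f x - f0 x) * g0 x) k + cosint (\<lambda>x. (g x - g0 x) * f0 x) k
      + (cosint (\<lambda>x. (f x - f0 x) * (g x - g0 x)) k + cosint (\<lambda>x. f0 x * g0 x) k)"
    using i by (subst cosint_linear(1); (intro Bochner_Integration.integrable_add)?; simp only: cosint_linear(1))
  finally show ?thesis by linarith
qed

lemma sqint_bounded_real:
  assumes "f \<in> borel_measurable torus" "\<And>x. \<bar>f x\<bar> \<le> B"
  shows "sqint (\<lambda>x. of_real (f x))"
  using assms by (intro sqint_bounded[of _ B]) auto

lemma sqint_sin: "sqint (\<lambda>x. of_real (sin (freq k \<bullet> x)))"
  by (intro sqint_bounded_real[where B = 1] continuous_measurable_torus continuous_intros) auto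

lemma sqint_shear_datum:
  fixes i j l :: "'n::finite"
  assumes "s > 0" "i \<noteq> j"
  shows "sqint (\<lambda>x. of_real (shear_datum s i j x $ l))"
proof -
  have "sqint (\<lambda>x::real^'n. of_real (cos (freq (axis j 1) \<bullet> x)))"
    by (rule sqint_bounded_real[where B = 1]) auto
  moreover have "sqint (\<lambda>x::real^'n. of_real (rough s i x))"
    by (rule sqint_bounded_real[OF rough_measurable rough_bounded[OF assms(1)]])
  moreover have "sqint (\<lambda>x::real^'n. of_real 0)"
    by (rule sqint_bounded_real[where B = 0]) auto
  ultimately show ?thesis
    by (cases "l = i \<or> l = j") (auto simp: shear_datum_eq[OF assms(2)])
qed

text \<open>
  The constant \<open>C\<close> is independent of \<open>v\<close>, of the smallness \<open>D\<close> and of the frequency. In the first bound the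
  number subtracted is the flux of the datum.
\<close>
lemma flux_moment_perturb:
  fixes chi :: "real^'n \<Rightarrow> real" and i j :: 'n
  assumes chi: "LP_cutoff chi" and r: "1 \<le> r" and s: "s > 0" "loss TYPE('n) r < s" and ij: "i \<noteq> j"
  obtains C where "C > 0"
    "\<And>D q v. \<lbrakk>0 < D; D \<le> 1; \<And>l. blocks_le chi s r D (\<lambda>x. of_real (v x $ l - shear_datum s i j x $ l))\<rbrakk> \<Longrightarrow>
       \<bar>flux i j q v - (1 / 2 ^ Suc q - 2 ^ Suc q) * ((2 powr - s) ^ Suc q * tvol TYPE('n) / 4)\<bar> \<le> 2 ^ Suc q * (C * D * (2 powr - s) ^ q) \<and>
       \<bar>moment i j q v - moment i j q (shear_datum s i j)\<bar> \<le> C * D * (2 powr - s) ^ q"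
proof -
  define b where "b = 2 powr - s"
  have b: "0 < b" "b < 1" using s by (auto simp: b_def powr_less_one)
  define c where "c = 2 powr (loss TYPE('n) r - s)"
  have c: "0 < c" "c < 1" using s by (auto simp: c_def powr_less_one)
  define V where "V = tvol TYPE('n)"
  have V: "V > 0" by (simp add: V_def)
  define C1 where "C1 = 2 * (V + 1) / ((1 - b) * (1 - c))"
  define C2 where "C2 = (V + 1) / (1 - b)"
  define C3 where "C3 = C2 * (1 / (1 - b) + 1)"
  have C: "C1 > 0" "C2 > 0" "C3 > 0" using b c V by (auto simp: C1_def C2_def C3_def intro!: mult_pos_pos divide_pos_pos add_pos_pos)
  define Y where "Y = 2 * C3 + C1"
  have main: "\<bar>flux i j q v - (1 / 2 ^ Suc q - 2 ^ Suc q) * (b ^ Suc q * V / 4)\<bar> \<le> 2 ^ Suc q * ((2 * Y + 2 * C2) * D * b ^ q) \<and>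
       \<bar>moment i j q v - moment i j q (shear_datum s i j)\<bar> \<le> (2 * Y + 2 * C2) * D * b ^ q"
    if D: "0 < D" "D \<le> 1" and bl: "\<And>l. blocks_le chi s r D (\<lambda>x. of_real (v x $ l - shear_datum s i j x $ l))" for D q v
  proof -
    let ?k = "test_mode i j q"
    let ?cf = "\<lambda>x. cos (freq (axis j 1) \<bullet> x)" and ?rg = "rough s i :: real^'n \<Rightarrow> real"
    let ?f = "\<lambda>x. v x $ i" and ?g = "\<lambda>x. v x $ j"
    let ?wf = "\<lambda>x. ?f x - ?cf x" and ?wg = "\<lambda>x. ?g x - ?rg x"
    define N :: real where "N = 2 ^ Suc q"
    have N: "N \<ge> 2" unfolding N_def by (simp add: self_le_power)
    have blf: "blocks_le chi s r D (\<lambda>x. of_real (?wf x))" and blg: "blocks_le chi s r D (\<lambda>x. of_real (?wg x))"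
      using bl[of i] bl[of j] by (simp_all only: shear_datum_eq[OF ij])
    have sw: "sqint (\<lambda>x. of_real (?wf x))" "sqint (\<lambda>x. of_real (?wg x))"
      using blf blg by (auto simp: blocks_le_def)
    have s0: "sqint (\<lambda>x. of_real (?cf x))" "sqint (\<lambda>x. of_real (?rg x))"
      using sqint_shear_datum[OF s(1) ij, of i] sqint_shear_datum[OF s(1) ij, of j]
      by (simp_all only: shear_datum_eq[OF ij])
    have sv: "sqint (\<lambda>x. of_real (?f x))" "sqint (\<lambda>x. of_real (?g x))"
      using sqint_add[OF sw(1) s0(1)] sqint_add[OF sw(2) s0(2)] by simp_all
    have four: "norm (fourier (\<lambda>x. of_real (h x)) a) \<le> C2 * D * b ^ p"
      if "blocks_le chi s r D (\<lambda>x. of_real (h x))" "p = 0 \<or> 2 ^ p \<le> norm (freq a)" for h :: "real^'n \<Rightarrow> real" and a p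
      using norm_fourier_le_of_blocks[OF chi r s(1) D(1) that] by (simp add: C2_def V_def b_def mult.assoc)
    have cosb: "\<bar>cosint h a\<bar> \<le> C2 * D * b ^ p"
      if "blocks_le chi s r D (\<lambda>x. of_real (h x))" "p = 0 \<or> 2 ^ p \<le> norm (freq a)" for h :: "real^'n \<Rightarrow> real" and a p
      using abs_cosint_le[of h a] four[OF that] that(1) by (auto simp: blocks_le_def)
    have bq: "b ^ Suc q \<le> b ^ q" using b by (intro power_decreasing) auto
    have X: "0 \<le> C2 * D" using C D by simp
    have lin: "\<bar>cosint (\<lambda>x. h x * ?rg x) ?k\<bar> \<le> C3 * D * b ^ q" "\<bar>cosint (\<lambda>x. h x * ?cf x) ?k\<bar> \<le> C3 * D * b ^ q"
      if h: "blocks_le chi s r D (\<lambda>x. of_real (h x))" for h :: "real^'n \<Rightarrow> real"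
    proof -
      have hi: "integrable torus h" using h by (intro integrable_real) (auto simp: blocks_le_def)
      show "\<bar>cosint (\<lambda>x. h x * ?rg x) ?k\<bar> \<le> C3 * D * b ^ q"
        using abs_cosint_mult_rough_le[OF s(1) hi X ij cosb[OF h, unfolded b_def], of q]
        by (simp add: test_mode_def C3_def b_def ac_simps)
      have "\<bar>cosint (\<lambda>x. h x * ?cf x) ?k\<bar> \<le> C2 * D * b ^ Suc q"
        using abs_cosint_mult_cos_le[OF s(1) hi X ij cosb[OF h, unfolded b_def], of "Suc q"]
        by (simp add: test_mode_def b_def)
      also have "\<dots> \<le> C2 * D * b ^ q" by (intro mult_left_mono bq X)
      also have "\<dots> \<le> C3 * D * b ^ q"
        using b C D by (intro mult_right_mono) (auto simp: C3_def)
      finally show "\<bar>cosint (\<lambda>x. h x * ?cf x) ?k\<bar> \<le> C3 * D * b ^ q" .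
    qed
    have quad: "\<bar>cosint (\<lambda>x. h x * h' x) ?k\<bar> \<le> C1 * D * b ^ q"
      if h: "blocks_le chi s r D (\<lambda>x. of_real (h x))" "blocks_le chi s r D (\<lambda>x. of_real (h' x))" for h h' :: "real^'n \<Rightarrow> real"
    proof -
      have "\<bar>cosint (\<lambda>x. h x * h' x) ?k\<bar> \<le> norm (fourier (\<lambda>x. of_real (h x) * of_real (h' x)) ?k)"
        using h by (subst cosint_mult_eq_fourier) (auto simp: blocks_le_def abs_Re_le_cmod)
      also have "\<dots> \<le> C1 * (D\<^sup>2 * b ^ Suc q)"
        using norm_fourier_mult_le_of_blocks[OF chi r s D(1) h norm_freq_test_mode[OF ij]]
        by (simp add: C1_def V_def b_def c_def)
      also have "\<dots> \<le> C1 * (D * b ^ q)"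
      proof (intro mult_left_mono mult_mono bq)
        show "D\<^sup>2 \<le> D" using D by (simp add: power2_eq_square mult_left_le)
      qed (use C b D in auto)
      finally show ?thesis by (simp add: mult.assoc)
    qed
    have pert: "\<bar>cosint (\<lambda>x. p x * p' x) ?k - cosint (\<lambda>x. p0 x * p0' x) ?k\<bar> \<le> Y * D * b ^ q"
      if "(p, p0) \<in> {(?f, ?cf), (?g, ?rg)}" "(p', p0') \<in> {(?f, ?cf), (?g, ?rg)}" for p p' p0 p0' :: "real^'n \<Rightarrow> real"
    proof -
      have bp: "blocks_le chi s r D (\<lambda>x. of_real (p x - p0 x))" "blocks_le chi s r D (\<lambda>x. of_real (p' x - p0' x))"
        and sp: "sqint (\<lambda>x. of_real (p x))" "sqint (\<lambda>x. of_real (p' x))"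
          "sqint (\<lambda>x. of_real (p0 x))" "sqint (\<lambda>x. of_real (p0' x))"
        using that blf blg sv s0 by auto
      have "\<bar>cosint (\<lambda>x. (p x - p0 x) * p0' x) ?k\<bar> \<le> C3 * D * b ^ q"
        using that(2) lin[OF bp(1)] by auto
      moreover have "\<bar>cosint (\<lambda>x. (p' x - p0' x) * p0 x) ?k\<bar> \<le> C3 * D * b ^ q"
        using that(1) lin[OF bp(2)] by auto
      ultimately show ?thesis
        using cosint_mult_perturb[OF sp, of ?k] quad[OF bp] by (simp add: Y_def algebra_simps)
    qed
    have v0: "cosint (\<lambda>x. ?cf x * ?cf x) ?k = 0" "cosint (\<lambda>x. ?rg x * ?rg x) ?k = 0"
      "cosint (\<lambda>x. ?cf x * ?rg x) ?k = b ^ Suc q * V / 4"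
      unfolding test_mode_def b_def V_def
      using cosint_cos_cos_datum[OF ij] cosint_rough_rough_datum[OF s(1) ij] cosint_cos_rough_datum[OF s(1) ij, of "Suc q"]
      by (simp_all del: power_Suc)
    have p1: "\<bar>cosint (\<lambda>x. ?f x * ?f x) ?k\<bar> \<le> Y * D * b ^ q"
      using pert[of ?f ?cf ?f ?cf] unfolding v0 by simp
    have p2: "\<bar>cosint (\<lambda>x. ?g x * ?g x) ?k\<bar> \<le> Y * D * b ^ q"
      using pert[of ?g ?rg ?g ?rg] unfolding v0 by simp
    have p3: "\<bar>cosint (\<lambda>x. ?f x * ?g x) ?k - b ^ Suc q * V / 4\<bar> \<le> Y * D * b ^ q"
      using pert[of ?f ?cf ?g ?rg] unfolding v0 by simp
    have YD: "0 \<le> Y * D * b ^ q" using C D b by (simp add: Y_def)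
    have "1 / N \<le> N" using N by (simp add: divide_le_eq mult_mono[of 1 N 1 N] order_trans[of 1 N])
    then have NN: "\<bar>1 / N - N\<bar> \<le> N" using N by simp
    have triangle: "\<bar>z\<bar> \<le> 2 * B" if "z = p + m - p'" "\<bar>m\<bar> \<le> B" "2 * A \<le> B" "\<bar>p\<bar> \<le> A" "\<bar>p'\<bar> \<le> A"
      for z p m p' A B :: real
      using that by linarith
    have "flux i j q v - (1 / N - N) * (b ^ Suc q * V / 4) = cosint (\<lambda>x. ?f x * ?f x) ?k
        + (1 / N - N) * (cosint (\<lambda>x. ?f x * ?g x) ?k - b ^ Suc q * V / 4) - cosint (\<lambda>x. ?g x * ?g x) ?k"
      unfolding flux_eq[OF sv] N_def by (simp add: algebra_simps)
    moreover have "\<bar>(1 / N - N) * (cosint (\<lambda>x. ?f x * ?g x) ?k - b ^ Suc q * V / 4)\<bar> \<le> N * (Y * D * b ^ q)"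
      unfolding abs_mult using p3 NN N by (intro mult_mono) auto
    moreover have "2 * (Y * D * b ^ q) \<le> N * (Y * D * b ^ q)" using N YD by (intro mult_right_mono) auto
    ultimately have "\<bar>flux i j q v - (1 / N - N) * (b ^ Suc q * V / 4)\<bar> \<le> 2 * (N * (Y * D * b ^ q))"
      using p1 p2 by (rule triangle)
    also have "\<dots> \<le> N * ((2 * Y + 2 * C2) * D * b ^ q)"
    proof -
      have "0 \<le> N * (2 * C2 * D * b ^ q)" using N C D b by simp
      then show ?thesis by (simp add: algebra_simps)
    qed
    finally have flux: "\<bar>flux i j q v - (1 / N - N) * (b ^ Suc q * V / 4)\<bar> \<le> N * ((2 * Y + 2 * C2) * D * b ^ q)" .
    have sinb: "\<bar>LINT x|torus. h x * sin (freq ?k \<bullet> x)\<bar> \<le> C2 * D * b ^ q"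
      if h: "blocks_le chi s r D (\<lambda>x. of_real (h x))" for h :: "real^'n \<Rightarrow> real"
    proof -
      have i: "integrable torus (\<lambda>x. of_real (h x) * wave (- ?k) x)"
        using h by (intro sqint_mult sqint_wave) (auto simp: blocks_le_def)
      have "Im (fourier (\<lambda>x. of_real (h x)) ?k) = - (LINT x|torus. h x * sin (freq ?k \<bullet> x))"
        unfolding fourier_def by (subst integral_Im[OF i, symmetric]) (simp add: wave_def freq_simps)
      then have "\<bar>LINT x|torus. h x * sin (freq ?k \<bullet> x)\<bar> \<le> norm (fourier (\<lambda>x. of_real (h x)) ?k)"
        using abs_Im_le_cmod[of "fourier (\<lambda>x. of_real (h x)) ?k"] by simp
      also have "\<dots> \<le> C2 * D * b ^ Suc q" using norm_freq_test_mode[OF ij, of q] by (intro four h) simp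
      also have "\<dots> \<le> C2 * D * b ^ q" by (intro mult_left_mono bq X)
      finally show ?thesis .
    qed
    have sini: "integrable torus (\<lambda>x. h x * sin (freq ?k \<bullet> x))" if "sqint (\<lambda>x. of_real (h x))" for h :: "real^'n \<Rightarrow> real"
      by (intro integrable_mult_real[OF that sqint_sin])
    have mom: "moment i j q z = (LINT x|torus. z x $ i * sin (freq ?k \<bullet> x)) / N - (LINT x|torus. z x $ j * sin (freq ?k \<bullet> x))"
      if "sqint (\<lambda>x. of_real (z x $ i))" "sqint (\<lambda>x. of_real (z x $ j))" for z :: "real^'n \<Rightarrow> real^'n"
    proof -
      have "moment i j q z = (LINT x|torus. z x $ i * sin (freq ?k \<bullet> x) / N - z x $ j * sin (freq ?k \<bullet> x))"
        unfolding moment_def inner_scaleR_right inner_test N_def[symmetric]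
        by (intro Bochner_Integration.integral_cong) (auto simp: algebra_simps)
      then show ?thesis using sini[OF that(1)] sini[OF that(2)] by simp
    qed
    have sd: "sqint (\<lambda>x. of_real (shear_datum s i j x $ i))" "sqint (\<lambda>x. of_real (shear_datum s i j x $ j))"
      using s0 by (simp_all only: shear_datum_eq[OF ij])
    have "moment i j q v - moment i j q (shear_datum s i j)
      = (LINT x|torus. ?wf x * sin (freq ?k \<bullet> x)) / N - (LINT x|torus. ?wg x * sin (freq ?k \<bullet> x))"
      unfolding mom[OF sv] mom[OF sd] unfolding shear_datum_eq[OF ij] left_diff_distrib
      using sini[OF sv(1)] sini[OF sv(2)] sini[OF s0(1)] sini[OF s0(2)] by (simp add: diff_divide_distrib)
    moreover have "\<bar>(LINT x|torus. ?wf x * sin (freq ?k \<bullet> x)) / N\<bar> \<le> C2 * D * b ^ q"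
    proof -
      have "\<bar>(LINT x|torus. ?wf x * sin (freq ?k \<bullet> x)) / N\<bar> \<le> \<bar>LINT x|torus. ?wf x * sin (freq ?k \<bullet> x)\<bar> / 1"
        unfolding abs_divide using N by (intro divide_left_mono) auto
      then show ?thesis using sinb[OF blf] by simp
    qed
    ultimately have "\<bar>moment i j q v - moment i j q (shear_datum s i j)\<bar> \<le> 2 * (C2 * D * b ^ q)"
      using sinb[OF blg] by linarith
    also have "\<dots> \<le> (2 * Y + 2 * C2) * D * b ^ q" using YD by (simp add: algebra_simps)
    finally show ?thesis using flux unfolding N_def by blast
  qed
  show ?thesis
  proof (rule that)
    show "2 * Y + 2 * C2 > 0" using C by (simp add: Y_def)
  qed (use main in \<open>auto simp: b_def V_def\<close>)
qed

section \<open>Weak solutions tested against a plane wave\<close>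

lemma L2_field_component:
  fixes v :: "real^'n \<Rightarrow> real^'n"
  assumes "L2_field v"
  shows "sqint (\<lambda>x. of_real (v x $ l))"
proof -
  have "continuous_on UNIV (\<lambda>y::real^'n. complex_of_real (y $ l))" by (intro continuous_intros)
  then have "(\<lambda>y::real^'n. complex_of_real (y $ l)) \<in> borel_measurable borel"
    by (rule borel_measurable_continuous_onI)
  moreover have "v \<in> borel_measurable torus" using assms by (simp add: L2_field_def)
  ultimately have m [measurable]: "(\<lambda>x. complex_of_real (v x $ l)) \<in> borel_measurable torus"
    by (rule measurable_compose[rotated])
  have i: "integrable torus (\<lambda>x. (norm (v x))\<^sup>2)" using assms by (simp add: L2_field_def)
  have "integrable torus (\<lambda>x. (norm (complex_of_real (v x $ l)))\<^sup>2)"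
  proof (rule Bochner_Integration.integrable_bound[OF i])
    show "AE x in torus. norm ((norm (complex_of_real (v x $ l)))\<^sup>2) \<le> norm ((norm (v x))\<^sup>2)"
    proof (rule AE_I2)
      fix x
      have "\<bar>v x $ l\<bar>\<^sup>2 \<le> (norm (v x))\<^sup>2" by (intro power_mono component_le_norm_cart) auto
      then show "norm ((norm (complex_of_real (v x $ l)))\<^sup>2) \<le> norm ((norm (v x))\<^sup>2)" by simp
    qed
  qed measurable
  with m show ?thesis by (simp add: sqint_def)
qed

lemma L2_field_trig:
  fixes a :: "real^'n"
  shows "L2_field (\<lambda>x. cos (freq k \<bullet> x) *\<^sub>R a)" "L2_field (\<lambda>x. sin (freq k \<bullet> x) *\<^sub>R a)"
proof -
  have m: "(\<lambda>x. cos (freq k \<bullet> x) *\<^sub>R a) \<in> borel_measurable torus" "(\<lambda>x. sin (freq k \<bullet> x) *\<^sub>R a) \<in> borel_measurable torus"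
    by (intro continuous_measurable_torus continuous_intros)+
  have "(norm (c *\<^sub>R a))\<^sup>2 \<le> (norm a)\<^sup>2" if "\<bar>c\<bar> \<le> 1" for c :: real
    using that by (intro power_mono) (auto intro: mult_left_le_one_le)
  then have "integrable torus (\<lambda>x. (norm (cos (freq k \<bullet> x) *\<^sub>R a))\<^sup>2)" "integrable torus (\<lambda>x. (norm (sin (freq k \<bullet> x) *\<^sub>R a))\<^sup>2)"
    using m by (auto intro!: bounded_integrable_torus[where B = "(norm a)\<^sup>2"] simp del: norm_scaleR)
  with m show "L2_field (\<lambda>x. cos (freq k \<bullet> x) *\<^sub>R a)" "L2_field (\<lambda>x. sin (freq k \<bullet> x) *\<^sub>R a)"
    by (auto simp: L2_field_def periodic_def trig_periodic simp del: norm_scaleR)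
qed

lemma fourier_continuous_on_time:
  fixes u :: "real \<Rightarrow> real^'n \<Rightarrow> real^'n"
  assumes u: "\<And>t. t \<in> {0..<T} \<Longrightarrow> L2_field (u t)" and w: "weakly_continuous T u"
  shows "continuous_on {0..<T} (\<lambda>t. fourier (\<lambda>x. of_real (u t x $ l)) k)"
proof -
  let ?c = "\<lambda>t. LINT x|torus. u t x \<bullet> (cos (freq k \<bullet> x) *\<^sub>R axis l 1)"
  let ?s = "\<lambda>t. LINT x|torus. u t x \<bullet> (sin (freq k \<bullet> x) *\<^sub>R axis l 1)"
  have "continuous_on {0..<T} ?c" "continuous_on {0..<T} ?s"
    using w L2_field_trig unfolding weakly_continuous_def by blast+
  then have cont: "continuous_on {0..<T} (\<lambda>t. Complex (?c t) (- ?s t))"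
    unfolding Complex_eq by (intro continuous_intros)
  have eq: "Complex (?c t) (- ?s t) = fourier (\<lambda>x. of_real (u t x $ l)) k" if "t \<in> {0..<T}" for t
  proof -
    have i: "integrable torus (\<lambda>x. of_real (u t x $ l) * wave (- k) x)"
      by (intro sqint_mult sqint_wave L2_field_component u that)
    show ?thesis
      unfolding fourier_def
      by (rule complex_eqI; subst integral_Re[OF i, symmetric] integral_Im[OF i, symmetric])
        (simp_all add: wave_def freq_simps inner_axis mult.commute)
  qed
  show ?thesis by (rule continuous_on_eq[OF cont eq])
qed

text \<open>
  Weak continuity in time gives continuity of each Fourier coefficient, but not of quadratic quantities.
  Those are pointwise limits of finite sums of products of Fourier coefficients, hence measurable.
\<close>
lemma cosint_quadratic_measurable:
  fixes u :: "real \<Rightarrow> real^'n \<Rightarrow> real^'n" and chi :: "real^'n \<Rightarrow> real"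
  assumes chi: "LP_cutoff chi" and u: "\<And>t. t \<in> {0..<T} \<Longrightarrow> L2_field (u t)" and w: "weakly_continuous T u"
  shows "set_borel_measurable lborel {0<..<T} (\<lambda>t. cosint (\<lambda>x. u t x $ l * u t x $ m) k)"
proof -
  let ?F = "\<lambda>l t x. complex_of_real (u t x $ l)"
  let ?G = "\<lambda>Q t. fourier (\<lambda>x. low_part chi Q (?F l t) x * low_part chi Q (?F m t) x) k"
  have "continuous_on {0<..<T} (\<lambda>t. Re (?G Q t))" for Q
    unfolding low_part_def multiplier_def fourier_trig_mult
    by (intro continuous_intros continuous_on_subset[OF fourier_continuous_on_time[OF u w]]) auto
  then have m: "(\<lambda>t. indicator {0<..<T} t *\<^sub>R Re (?G Q t)) \<in> borel_measurable borel" for Q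
    by (intro borel_measurable_continuous_on_indicator) auto
  have "(\<lambda>t. indicator {0<..<T} t *\<^sub>R cosint (\<lambda>x. u t x $ l * u t x $ m) k) \<in> borel_measurable borel"
  proof (rule borel_measurable_LIMSEQ_real[OF _ m])
    fix t
    show "(\<lambda>Q. indicator {0<..<T} t *\<^sub>R Re (?G Q t)) \<longlonglongrightarrow> indicator {0<..<T} t *\<^sub>R cosint (\<lambda>x. u t x $ l * u t x $ m) k"
    proof (cases "t \<in> {0<..<T}")
      case True
      then have sq: "sqint (?F l t)" "sqint (?F m t)" by (auto intro!: L2_field_component u)
      have "(\<lambda>Q. Re (?G Q t)) \<longlonglongrightarrow> Re (fourier (\<lambda>x. ?F l t x * ?F m t x) k)"
        by (intro tendsto_Re fourier_mult_low_part_tendsto[OF chi] sq)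
      also have "Re (fourier (\<lambda>x. ?F l t x * ?F m t x) k) = cosint (\<lambda>x. u t x $ l * u t x $ m) k"
        by (rule cosint_mult_eq_fourier[OF sq, symmetric])
      finally show ?thesis using True by simp
    qed simp
  qed
  then show ?thesis by (simp add: set_borel_measurable_def)
qed

lemma flux_moment_measurable:
  fixes u :: "real \<Rightarrow> real^'n \<Rightarrow> real^'n" and chi :: "real^'n \<Rightarrow> real"
  assumes chi: "LP_cutoff chi" and u: "\<And>t. t \<in> {0..<T} \<Longrightarrow> L2_field (u t)" and w: "weakly_continuous T u"
  shows "set_borel_measurable lborel {0<..<T} (\<lambda>t. flux i j q (u t))"
    and "set_borel_measurable lborel {0<..<T} (\<lambda>t. moment i j q (u t))"
proof -
  let ?B = "\<lambda>l m t. indicator {0<..<T} t *\<^sub>R cosint (\<lambda>x. u t x $ l * u t x $ m) (test_mode i j q)"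
  have B: "?B l m \<in> borel_measurable lborel" for l m
    using cosint_quadratic_measurable[OF chi u w] by (simp add: set_borel_measurable_def)
  have "indicator {0<..<T} t *\<^sub>R flux i j q (u t) = ?B i i t + (1 / 2 ^ Suc q - 2 ^ Suc q) * ?B i j t - ?B j j t" for t
  proof (cases "t \<in> {0<..<T}")
    case True
    then have "sqint (\<lambda>x. of_real (u t x $ l))" for l by (intro L2_field_component u) auto
    from flux_eq[OF this this] show ?thesis using True by simp
  qed simp
  then show "set_borel_measurable lborel {0<..<T} (\<lambda>t. flux i j q (u t))"
    unfolding set_borel_measurable_def
    by (simp only:) (intro borel_measurable_diff borel_measurable_add borel_measurable_times borel_measurable_const B)
  have "continuous_on {0..<T} (\<lambda>t. moment i j q (u t))"
    using w L2_field_trig(2) unfolding weakly_continuous_def moment_def by blast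
  then have "continuous_on {0<..<T} (\<lambda>t. moment i j q (u t))"
    by (rule continuous_on_subset) auto
  then show "set_borel_measurable lborel {0<..<T} (\<lambda>t. moment i j q (u t))"
    unfolding set_borel_measurable_def measurable_lborel2
    by (intro borel_measurable_continuous_on_indicator) auto
qed

lemma weak_form_plane_test:
  fixes v :: "real^'n \<Rightarrow> real^'n"
  assumes \<theta>: "derivative_chain \<theta>" and v: "L2_field v"
  shows "(LINT x|torus. v x \<bullet> time_deriv (plane_test \<theta> (test_mode i j q) (test_dir i j q) 0 1 0) t x +
      (\<Sum>l\<in>UNIV. \<Sum>m\<in>UNIV. v x $ l * v x $ m * space_deriv m (plane_test \<theta> (test_mode i j q) (test_dir i j q) 0 1 0) t x $ l))
    = \<theta> 1 t * moment i j q v + \<theta> 0 t * flux i j q v"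
proof -
  let ?k = "test_mode i j q" and ?a = "test_dir i j q :: real^'n"
  have sq: "sqint (\<lambda>x. of_real (v x $ l))" for l by (rule L2_field_component[OF v])
  have i1: "integrable torus (\<lambda>x. v x \<bullet> (sin (freq ?k \<bullet> x) *\<^sub>R ?a))"
  proof -
    have "integrable torus (\<lambda>x. (v x $ i / 2 ^ Suc q - v x $ j) * sin (freq ?k \<bullet> x))"
    proof (rule integrable_mult_real)
      show "sqint (\<lambda>x. of_real (v x $ i / 2 ^ Suc q - v x $ j))"
        using sqint_diff[OF sqint_cmult[OF sq, of "1 / 2 ^ Suc q" i] sq[of j]] by simp
      show "sqint (\<lambda>x. of_real (sin (freq ?k \<bullet> x)))" by (rule sqint_sin)
    qed
    then show ?thesis by (simp add: inner_test mult.commute del: power_Suc)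
  qed
  have i2: "integrable torus (\<lambda>x. (v x \<bullet> ?a) * (v x \<bullet> freq ?k) * cos (freq ?k \<bullet> x))"
  proof (rule integrable_mult_cos)
    have "integrable torus (\<lambda>x. (v x $ i / 2 ^ Suc q - v x $ j) * (2 ^ Suc q * v x $ i + v x $ j))"
    proof (rule integrable_mult_real)
      show "sqint (\<lambda>x. of_real (v x $ i / 2 ^ Suc q - v x $ j))"
        using sqint_diff[OF sqint_cmult[OF sq, of "1 / 2 ^ Suc q" i] sq[of j]] by simp
      show "sqint (\<lambda>x. of_real (2 ^ Suc q * v x $ i + v x $ j))"
        using sqint_add[OF sqint_cmult[OF sq, of "2 ^ Suc q" i] sq[of j]] by simp
    qed
    then show "integrable torus (\<lambda>x. (v x \<bullet> ?a) * (v x \<bullet> freq ?k))" by (simp only: inner_test)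
  qed
  have "v x \<bullet> time_deriv (plane_test \<theta> ?k ?a 0 1 0) t x +
      (\<Sum>l\<in>UNIV. \<Sum>m\<in>UNIV. v x $ l * v x $ m * space_deriv m (plane_test \<theta> ?k ?a 0 1 0) t x $ l)
    = \<theta> 1 t * (v x \<bullet> (sin (freq ?k \<bullet> x) *\<^sub>R ?a)) + \<theta> 0 t * ((v x \<bullet> ?a) * (v x \<bullet> freq ?k) * cos (freq ?k \<bullet> x))" for x
  proof -
    have "(\<Sum>l\<in>UNIV. \<Sum>m\<in>UNIV. v x $ l * v x $ m * space_deriv m (plane_test \<theta> ?k ?a 0 1 0) t x $ l)
      = (\<Sum>l\<in>UNIV. \<Sum>m\<in>UNIV. \<theta> 0 t * cos (freq ?k \<bullet> x) * ((v x $ l * ?a $ l) * (v x $ m * freq ?k $ m)))"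
      unfolding plane_test_derivs[OF \<theta>] by (intro sum.cong refl) simp
    also have "\<dots> = \<theta> 0 t * cos (freq ?k \<bullet> x) * ((\<Sum>l\<in>UNIV. v x $ l * ?a $ l) * (\<Sum>m\<in>UNIV. v x $ m * freq ?k $ m))"
      by (simp only: sum_distrib_left[symmetric] sum_product)
    also have "\<dots> = \<theta> 0 t * ((v x \<bullet> ?a) * (v x \<bullet> freq ?k) * cos (freq ?k \<bullet> x))"
      by (simp add: inner_vec_def)
    finally show ?thesis
      by (simp only: plane_test_derivs(1)[OF \<theta>] inner_scaleR_right mult.assoc)
  qed
  then show ?thesis
    unfolding moment_def flux_def cosint_def using i1 i2 by simp
qed

theorem proposition2p1:
  fixes chi :: "real^'n \<Rightarrow> real" and i j :: 'n and r :: ennreal and s :: real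
  assumes "CARD('n) \<ge> 2" and "i \<noteq> j"
    and "LP_cutoff chi"
    and "1 \<le> r"
    and "r > 2 \<Longrightarrow> s > 0"
    and "r \<le> 2 \<Longrightarrow> s > real CARD('n) * (2 / enn2real r - 1)"
  shows "\<exists>\<delta>>0. \<forall>T>0. \<forall>u :: real \<Rightarrow> real^'n \<Rightarrow> real^'n.
           euler_weak_solution T u \<longrightarrow> (AE x in torus. u 0 x = shear_datum s i j x) \<longrightarrow>
           Limsup (at_right 0) (\<lambda>t. besov_norm chi s r (\<lambda>x. u t x - shear_datum s i j x))
             \<ge> ennreal \<delta>"
proof -
  note ij = assms(2) and chi = assms(3) and r = assms(4)
  have s2: "loss TYPE('n) r < s"
    using assms(5,6) by (auto simp: loss_def not_le)
  have "0 \<le> loss TYPE('n) r"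
  proof (cases "r \<le> 2")
    case True
    then have "enn2real r \<le> 2" using enn2real_mono[of r 2] by simp
    moreover have "1 \<le> enn2real r" using True by (intro enn2real_ge_1 r) (auto simp: top_unique)
    ultimately show ?thesis by (simp add: loss_def)
  qed (simp add: loss_def)
  with s2 have s: "s > 0" by linarith
  define b where "b = 2 powr - s"
  have b: "b > 0" by (simp add: b_def)
  define V where "V = tvol TYPE('n)"
  have V: "V > 0" by (simp add: V_def)
  obtain C where C: "C > 0" and pert: "\<And>D q v. \<lbrakk>0 < D; D \<le> 1; \<And>l. blocks_le chi s r D (\<lambda>x. of_real (v x $ l - shear_datum s i j x $ l))\<rbrakk> \<Longrightarrow>
       \<bar>flux i j q v - (1 / 2 ^ Suc q - 2 ^ Suc q) * (b ^ Suc q * V / 4)\<bar> \<le> 2 ^ Suc q * (C * D * b ^ q) \<and>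
       \<bar>moment i j q v - moment i j q (shear_datum s i j)\<bar> \<le> C * D * b ^ q"
    unfolding b_def V_def using flux_moment_perturb[OF chi r s s2 ij] by blast
  \<comment> \<open>The flux of the datum has absolute value at least \<open>N b\<^sup>q (b V / 8)\<close>, with \<open>N = 2\<^sup>q\<^sup>+\<^sup>1\<close>; this \<open>D\<close> keeps the error at most half of that.\<close>
  define D where "D = min 1 (b * V / (16 * C))"
  have D: "D > 0" "D \<le> 1" "C * D \<le> b * V / 16"
  proof -
    show "D > 0" "D \<le> 1" using b V C by (auto simp: D_def)
    have "C * D \<le> C * (b * V / (16 * C))" using C by (intro mult_left_mono) (auto simp: D_def)
    then show "C * D \<le> b * V / 16" using C by simp
  qed
  \<comment> \<open>Compensates the factor \<open>2\<^sup>s\<close> of \<open>besov_norm_imp_blocks_le\<close>.\<close>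
  define \<delta> where "\<delta> = D / 2 powr s"
  have \<delta>: "\<delta> > 0" "\<delta> * 2 powr s = D" using D by (auto simp: \<delta>_def)
  have "ennreal \<delta> \<le> Limsup (at_right 0) (\<lambda>t. besov_norm chi s r (\<lambda>x. u t x - shear_datum s i j x))"
    if T: "T > 0" and u: "euler_weak_solution T u" for T and u :: "real \<Rightarrow> real^'n \<Rightarrow> real^'n"
  proof (rule ccontr)
    assume "\<not> ?thesis"
    then have "eventually (\<lambda>t. besov_norm chi s r (\<lambda>x. u t x - shear_datum s i j x) < ennreal \<delta>) (at_right 0)"
      by (intro Limsup_lessD) auto
    then obtain \<tau>' where \<tau>': "\<tau>' > 0" "\<And>t. 0 < t \<Longrightarrow> t < \<tau>' \<Longrightarrow> besov_norm chi s r (\<lambda>x. u t x - shear_datum s i j x) < ennreal \<delta>"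
      unfolding eventually_at_right_field by auto
    define \<tau> where "\<tau> = min \<tau>' T"
    have \<tau>: "\<tau> > 0" "\<tau> \<le> \<tau>'" "\<tau> \<le> T" using \<tau>' T by (auto simp: \<tau>_def)
    from u have uL: "\<And>t. t \<in> {0..<T} \<Longrightarrow> L2_field (u t)" and uw: "weakly_continuous T u"
      unfolding euler_weak_solution_def by auto
    from u obtain p where p: "distribution T p" and weak: "\<And>\<Phi> :: real \<times> (real^'n) \<Rightarrow> real^'n. test_fun T \<Phi> \<Longrightarrow>
          (LINT t:{0<..<T}|lborel. LINT x|torus.
             (u t x \<bullet> time_deriv \<Phi> t x +
              (\<Sum>i\<in>UNIV. \<Sum>j\<in>UNIV. u t x $ i * u t x $ j * space_deriv j \<Phi> t x $ i)))
          + p (divergence \<Phi>) = 0"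
      unfolding euler_weak_solution_def by blast
    have blocks: "blocks_le chi s r D (\<lambda>x. of_real (u t x $ l - shear_datum s i j x $ l))" if t: "t \<in> {0<..<\<tau>}" for t l
    proof -
      have "sqint (\<lambda>x. of_real (u t x $ l) - of_real (shear_datum s i j x $ l))"
        using t \<tau> by (intro sqint_diff L2_field_component uL sqint_shear_datum[OF s ij]) auto
      then have sq: "sqint (\<lambda>x. of_real ((u t x - shear_datum s i j x) $ l))" by simp
      have "besov_norm chi s r (\<lambda>x. u t x - shear_datum s i j x) \<le> ennreal \<delta>"
        using \<tau>'(2)[of t] t \<tau> by auto
      from besov_norm_imp_blocks_le[OF chi r \<delta>(1) this sq] show ?thesis by (simp add: \<delta>)
    qed
    \<comment> \<open>Supported in \<open>[\<tau>/4, 3\<tau>/4]\<close> and independent of the frequency index \<open>q\<close> chosen below.\<close>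
    define \<theta> where "\<theta> = bump chi i (\<tau> / 2) (\<tau> / 4)"
    have chain: "derivative_chain \<theta>"
    proof -
      have "smooth chi" using chi unfolding LP_cutoff_def by blast
      then show ?thesis
        using \<tau> unfolding derivative_chain_def \<theta>_def by (intro allI bump_has_derivative) auto
    qed
    then have d: "(\<theta> m has_real_derivative \<theta> (Suc m) t) (at t)" for m t by (simp add: derivative_chain_def)
    have c: "continuous_on UNIV (\<theta> m)" for m using d by (meson DERIV_isCont continuous_at_imp_continuous_on)
    have supp: "\<theta> m t = 0" if "t \<notin> {\<tau> / 4..3 * \<tau> / 4}" for m t
      unfolding \<theta>_def using that \<tau> by (intro bump_0(3)[OF chi]) auto
    have nn: "0 \<le> \<theta> 0 t" for t unfolding \<theta>_def using \<tau> by (intro bump_0(1)[OF chi]) auto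
    define I0 where "I0 = (LINT t|lborel. \<theta> 0 t)"
    define I1 where "I1 = (LINT t|lborel. \<bar>\<theta> 1 t\<bar>)"
    have I0: "I0 > 0"
    proof -
      have "integrable lborel (\<lambda>t. indicator {\<tau> / 4..3 * \<tau> / 4} t *\<^sub>R \<theta> 0 t)"
        using borel_integrable_atLeastAtMost'[OF continuous_on_subset[OF c]] by (auto simp: set_integrable_def)
      also have "(\<lambda>t. indicator {\<tau> / 4..3 * \<tau> / 4} t *\<^sub>R \<theta> 0 t) = \<theta> 0"
      proof
        show "indicator {\<tau> / 4..3 * \<tau> / 4} t *\<^sub>R \<theta> 0 t = \<theta> 0 t" for t
          using supp[of t 0] by (cases "t \<in> {\<tau> / 4..3 * \<tau> / 4}") auto
      qed
      finally have i: "integrable lborel (\<theta> 0)" .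
      have "(LINT t|lborel. indicator {3 * \<tau> / 8..5 * \<tau> / 8} t) \<le> (LINT t|lborel. \<theta> 0 t)"
      proof (rule integral_mono)
        fix t
        show "indicator {3 * \<tau> / 8..5 * \<tau> / 8} t \<le> \<theta> 0 t"
        proof (cases "t \<in> {3 * \<tau> / 8..5 * \<tau> / 8}")
          case True
          then have "\<bar>t - \<tau> / 2\<bar> \<le> \<tau> / 4 / 2" by (simp add: abs_if)
          then have "\<theta> 0 t = 1" unfolding \<theta>_def using \<tau> by (intro bump_0(2)[OF chi]) auto
          then show ?thesis using True by simp
        qed (use nn in auto)
      qed (use i in \<open>auto intro!: integrable_real_indicator simp: emeasure_lborel_Icc_eq\<close>)
      then show ?thesis using \<tau> by (simp add: I0_def)
    qed
    \<comment> \<open>The left side grows with \<open>q\<close> while \<open>I0\<close> and \<open>I1\<close> do not depend on it.\<close>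
    have est: "2 ^ Suc q * (b * V / 16 * I0) \<le> C * D * I1" for q
    proof -
      let ?k = "test_mode i j q" and ?a = "test_dir i j q :: real^'n"
      let ?\<Phi> = "plane_test \<theta> ?k ?a 0 1 0"
      define N :: real where "N = 2 ^ Suc q"
      have N: "N \<ge> 2" unfolding N_def by (simp add: self_le_power)
      have test: "test_fun T ?\<Phi>"
        using \<tau> supp by (intro test_fun_plane_test[OF chain, of "\<tau> / 4" "3 * \<tau> / 4"]) auto
      have "p (divergence ?\<Phi>) = 0"
        unfolding divergence_plane_test[OF chain freq_test_mode_test_dir[OF ij]] by (rule distribution_zero[OF p T])
      with weak[OF test] have z: "(LINT t:{0<..<T}|lborel. LINT x|torus. (u t x \<bullet> time_deriv ?\<Phi> t x +
              (\<Sum>i\<in>UNIV. \<Sum>j\<in>UNIV. u t x $ i * u t x $ j * space_deriv j ?\<Phi> t x $ i))) = 0" by simp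
      have zero: "(LINT t:{0<..<T}|lborel. \<theta> 1 t * moment i j q (u t) + \<theta> 0 t * flux i j q (u t)) = 0"
      proof -
        have "(LINT t:{0<..<T}|lborel. LINT x|torus. (u t x \<bullet> time_deriv ?\<Phi> t x +
              (\<Sum>i\<in>UNIV. \<Sum>j\<in>UNIV. u t x $ i * u t x $ j * space_deriv j ?\<Phi> t x $ i)))
          = (LINT t:{0<..<T}|lborel. \<theta> 1 t * moment i j q (u t) + \<theta> 0 t * flux i j q (u t))"
        proof (rule set_lebesgue_integral_cong)
          show "\<forall>t. t \<in> {0<..<T} \<longrightarrow> (LINT x|torus. (u t x \<bullet> time_deriv ?\<Phi> t x +
              (\<Sum>i\<in>UNIV. \<Sum>j\<in>UNIV. u t x $ i * u t x $ j * space_deriv j ?\<Phi> t x $ i)))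
            = \<theta> 1 t * moment i j q (u t) + \<theta> 0 t * flux i j q (u t)"
            using uL by (intro allI impI weak_form_plane_test[OF chain]) auto
        qed simp
        with z show ?thesis by (simp only:)
      qed
      have "\<bar>(1 / N - N) * (b ^ Suc q * V / 4)\<bar> * (LINT t|lborel. \<theta> 0 t)
         \<le> C * D * b ^ q * (LINT t|lborel. \<bar>\<theta> 1 t\<bar>) + N * (C * D * b ^ q) * (LINT t|lborel. \<theta> 0 t)"
      proof (rule averaged_identity[OF _ _ _ _ _ _ _ nn flux_moment_measurable(2,1)[OF chi uL uw] _ _ zero])
        show "(\<theta> 0 has_real_derivative \<theta> 1 t) (at t)" for t using d[of 0 t] by simp
        show "\<bar>moment i j q (u t) - moment i j q (shear_datum s i j)\<bar> \<le> C * D * b ^ q" if "t \<in> {\<tau> / 4..3 * \<tau> / 4}" for t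
          using pert[OF D(1,2) blocks, of t q] that \<tau> by auto
        show "\<bar>flux i j q (u t) - (1 / N - N) * (b ^ Suc q * V / 4)\<bar> \<le> N * (C * D * b ^ q)" if "t \<in> {\<tau> / 4..3 * \<tau> / 4}" for t
          using pert[OF D(1,2) blocks, of t q] that \<tau> unfolding N_def by auto
      qed (use \<tau> supp c in auto)
      then have main: "\<bar>(1 / N - N) * (b ^ Suc q * V / 4)\<bar> * I0 \<le> C * D * b ^ q * I1 + N * (C * D * b ^ q) * I0"
        by (simp only: I0_def I1_def)
      have "N / 2 \<le> \<bar>1 / N - N\<bar>"
      proof -
        have "1 / N \<le> 1" using N by simp
        then have "1 / N \<le> N / 2" using N by linarith
        then show ?thesis by linarith
      qed
      then have "N / 2 * (b ^ Suc q * V / 4) \<le> \<bar>1 / N - N\<bar> * (b ^ Suc q * V / 4)"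
        using b V by (intro mult_right_mono) auto
      also have "\<dots> = \<bar>(1 / N - N) * (b ^ Suc q * V / 4)\<bar>" using b V by (simp add: abs_mult)
      finally have "N / 2 * (b ^ Suc q * V / 4) * I0 \<le> \<bar>(1 / N - N) * (b ^ Suc q * V / 4)\<bar> * I0"
        using I0 by (intro mult_right_mono) auto
      also note main
      also have "N * (C * D * b ^ q) * I0 \<le> N * (b * V / 16 * b ^ q) * I0"
        using N I0 D b by (intro mult_right_mono mult_left_mono) auto
      finally have "b ^ q * (N * (b * V / 16 * I0)) \<le> b ^ q * (C * D * I1)" by (simp add: algebra_simps)
      then show ?thesis using b by (simp add: N_def)
    qed
    have pos: "b * V / 16 * I0 > 0" using b V I0 by simp
    obtain q where "C * D * I1 / (b * V / 16 * I0) < 2 ^ q" using real_arch_pow[of 2] by auto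
    then have "C * D * I1 < 2 ^ q * (b * V / 16 * I0)" using pos by (simp add: pos_divide_less_eq)
    also have "\<dots> \<le> 2 ^ Suc q * (b * V / 16 * I0)" using pos by (intro mult_right_mono) auto
    finally show False using est[of q] by linarith
  qed
  with \<delta>(1) show ?thesis by blast
qed

end
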